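(* Let $0<a<1$ and $\kappa=\frac{1-a}{1+a}$. Also let $\Theta_{\mu,h}$ be a Schrödinger L-system with the main operator $T_h$ that has the modulus of von Neumann's parameter $\kappa$. Then the impedance function $V_{\Theta_{\mu,h}}(z)$ belongs to the class $\mathfrak M_\kappa$ if and only if either $$h=-\operatorname{Re}m_\infty(i)-\left(\frac{i}{a}\right)\operatorname{Im}m_\infty(i),$$ or $$h=\frac{a^2d^2\mu-d^2(c+\mu)-c(c+\mu)^2}{a^2d^2+(c+\mu)^2}-i\,\frac{ad^3+ad(c+\mu)^2}{a^2d^2+(c+\mu)^2},$$ where $c=\operatorname{Re}m_\infty(i)$ and $d=\operatorname{Im}m_\infty(i)$.
   Context: Setting. Let $\ell\in\mathbb R$, let $q$ be a real locally summable function on $[\ell,+\infty)$, $l(y)=-y''+q(x)y$, $\mathcal H=L_2(\ell,+\infty)$. Let $D^*$ be the set of $y\in\mathcal H$ that are locally absolutely continuous together with $y'$ and satisfy $l(y)\in\mathcal H$. The minimal symmetric operator $\dot A y=l(y)$ with boundary conditions $y(\ell)=y'(\ell)=0$ is assumed to have deficiency indices $(1,1)$; $\operatorname{Dom}(\dot A^* )=D^*$, $\dot A^*y=l(y)$. For $h\in\mathbb C$ with $\operatorname{Im}h>0$, $T_h y=l(y)$ with domain $\{y\in D^*: y'(\ell)=hy(\ell)\}$. Weyl function. Let $\varphi_1,\varphi_2$ solve $l(\varphi_k)=\lambda\varphi_k$ with $\varphi_1(\ell,\lambda)=0,\ \varphi_1'(\ell,\lambda)=1$, $\varphi_2(\ell,\lambda)=-1,\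 \varphi_2'(\ell,\lambda)=0$. The Weyl function $m_\infty(\lambda)$ is such that $\varphi_2(\cdot,\lambda)+m_\infty(\lambda)\varphi_1(\cdot,\lambda)\in L_2(\ell,+\infty)$. One has $\operatorname{Im}m_\infty(i)<0$. Schrödinger L-systems. $\mathcal H_+=D^*$ with $(y,z)_+=(y,z)+(\dot A^*y,\dot A^*z)$, and $\mathcal H_+\subset\mathcal H\subset\mathcal H_-$ is the corresponding rigged triplet; $\delta(x-\ell),\delta'(x-\ell)\in\mathcal H_-$ act by $(y,\delta)=y(\ell)$, $(y,\delta')=-y'(\ell)$. For $\mu\in\mathbb R\cup\{\infty\}$ put $\mathbb A_{\mu,h}y=-y''+q y-\frac1{\mu-h}[y'(\ell)-hy(\ell)][\mu\delta(x-\ell)+\delta'(x-\ell)]$ and $g=\frac{(\operatorname{Im}h)^{1/2}}{|\mu-h|}[\mu\delta(x-\ell)+\delta'(x-\ell)]$ (limits as $\mu\to\infty$ if $\mu=\infty$), $Kc=cg$ for $c\in\mathbb C$; then $\operatorname{Im}\mathbb A_{\mu,h}=KK^*$. The array $\Theta_{\mu,h}=(\mathbb A_{\mu,h},K,1;\ \mathcal H_+\subset\mathcal H\subset\mathcal H_-,\mathbb C)$ is the Schrödinger L-system with main operator $T_h$ and state-space operator $\mathbb A_{\mu,h}$. Its impedance function is $V_{\Theta_{\mu,h}}(z)=K^*(\operatorname{Re}\mathbb A_{\mu,h}-zI)^{-1}K=\frac{(m_\infty(z)+\mu)\operatorname{Im}h}{(\mu-\operatorname{Re}h)m_\infty(z)+\mu\operatorname{Re}h-|h|^2}$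 (for $\mu=\infty$: $\frac{\operatorname{Im}h}{m_\infty(z)+\operatorname{Re}h}$). Von Neumann's parameter of $T_h$: the number $\kappa$, $|\kappa|<1$, with $g_+-\kappa g_-\in\operatorname{Dom}(T_h)$, where $g_\pm\in\operatorname{Ker}(\dot A^*\mp iI)$, $\|g_\pm\|=1$. Its modulus does not depend on the choice of $g_\pm$ and equals $\left|\frac{m_\infty(i)+h}{m_\infty(i)+\bar h}\right|$. Generalized Donoghue class. For $0\le\kappa<1$, $\mathfrak M_\kappa$ is the class of all Herglotz-Nevanlinna functions $M(z)=\int_{\mathbb R}\left(\frac1{\lambda-z}-\frac{\lambda}{1+\lambda^2}\right)d\sigma(\lambda)$, $\sigma$ an infinite Borel measure with $\int_{\mathbb R}\frac{d\sigma(\lambda)}{1+\lambda^2}=\frac{1-\kappa}{1+\kappa}$ (equivalently, $M(i)=i\frac{1-\kappa}{1+\kappa}$).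
   Formalization: The first formula for h is counted only when μ = −Re m_∞(i); for any other μ, including ∞, it gives V(i) ≠ ia, so the printed "if" fails (e.g. q=0, ℓ=0, a=1/2, μ=0). At μ = ∞ the second formula is read as its limit. *)

theory Defs
  imports "HOL-Analysis.Analysis"
begin

text \<open>
  Functions on the half-line from \<open>l\<close> to infinity are represented by functions on all of
  \<open>real\<close>; every notion below only looks at their values there.  Integrals are Lebesgue
  integrals (of absolutely integrable functions).
\<close>

definition loc_integrable :: "real \<Rightarrow> (real \<Rightarrow> 'a::euclidean_space) \<Rightarrow> bool" where
  "loc_integrable l g \<longleftrightarrow> (\<forall>b. g absolutely_integrable_on {l..b})"

text \<open>
  Local absolute continuity: \<open>f\<close> is an indefinite Lebesgue integral of a locally summable
  function, its density.  The density is unique up to null sets and is the almost everywhere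
  derivative of \<open>f\<close>.
\<close>

definition ac_density_of :: "real \<Rightarrow> (real \<Rightarrow> complex) \<Rightarrow> (real \<Rightarrow> complex) \<Rightarrow> bool" where
  "ac_density_of l f g \<longleftrightarrow>
     loc_integrable l g \<and> (\<forall>x\<ge>l. f x = f l + integral {l..x} g)"

definition loc_abs_continuous :: "real \<Rightarrow> (real \<Rightarrow> complex) \<Rightarrow> bool" where
  "loc_abs_continuous l f \<longleftrightarrow> (\<exists>g. ac_density_of l f g)"

definition ae_deriv :: "real \<Rightarrow> (real \<Rightarrow> complex) \<Rightarrow> real \<Rightarrow> complex" where
  "ae_deriv l f = (SOME g. ac_density_of l f g)"

text \<open>The pointwise derivative (one-sided at \<open>l\<close>).\<close>

definition deriv1 :: "real \<Rightarrow> (real \<Rightarrow> complex) \<Rightarrow> real \<Rightarrow> complex" where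
  "deriv1 l y x = vector_derivative y (at x within {l..})"

definition regular :: "real \<Rightarrow> (real \<Rightarrow> complex) \<Rightarrow> bool" where
  "regular l y \<longleftrightarrow>
     y differentiable_on {l..} \<and> loc_abs_continuous l y \<and> loc_abs_continuous l (deriv1 l y)"

definition diff_expr :: "real \<Rightarrow> (real \<Rightarrow> real) \<Rightarrow> (real \<Rightarrow> complex) \<Rightarrow> real \<Rightarrow> complex" where
  "diff_expr l q y x = - ae_deriv l (deriv1 l y) x + of_real (q x) * y x"

definition L2 :: "real \<Rightarrow> (real \<Rightarrow> complex) \<Rightarrow> bool" where
  "L2 l f \<longleftrightarrow> f \<in> borel_measurable (lebesgue_on {l..}) \<and>
     (\<lambda>x. (cmod (f x))\<^sup>2) absolutely_integrable_on {l..}"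

definition ip :: "real \<Rightarrow> (real \<Rightarrow> complex) \<Rightarrow> (real \<Rightarrow> complex) \<Rightarrow> complex" where
  "ip l f g = integral {l..} (\<lambda>x. f x * cnj (g x))"

definition Dstar :: "real \<Rightarrow> (real \<Rightarrow> real) \<Rightarrow> (real \<Rightarrow> complex) set" where
  "Dstar l q = {y. regular l y \<and> L2 l y \<and> L2 l (diff_expr l q y)}"

definition solves :: "real \<Rightarrow> (real \<Rightarrow> real) \<Rightarrow> complex \<Rightarrow> (real \<Rightarrow> complex) \<Rightarrow> bool" where
  "solves l q lam y \<longleftrightarrow>
     regular l y \<and> (AE x in lebesgue. x \<ge> l \<longrightarrow> diff_expr l q y x = lam * y x)"

text \<open>
  The kernel of the adjoint of the minimal operator minus \<open>lam\<close>; that adjoint acts as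
  \<open>diff_expr l q\<close> on \<open>Dstar l q\<close>.
\<close>

definition defect_space :: "real \<Rightarrow> (real \<Rightarrow> real) \<Rightarrow> complex \<Rightarrow> (real \<Rightarrow> complex) set" where
  "defect_space l q lam = {y \<in> Dstar l q. solves l q lam y}"

definition one_dimensional :: "real \<Rightarrow> (real \<Rightarrow> complex) set \<Rightarrow> bool" where
  "one_dimensional l N \<longleftrightarrow>
     (\<exists>g\<in>N. (\<exists>x\<ge>l. g x \<noteq> 0) \<and> (\<forall>y\<in>N. \<exists>c. \<forall>x\<ge>l. y x = c * g x))"

definition deficiency_indices_1_1 :: "real \<Rightarrow> (real \<Rightarrow> real) \<Rightarrow> bool" where
  "deficiency_indices_1_1 l q \<longleftrightarrow>
     one_dimensional l (defect_space l q \<i>) \<and> one_dimensional l (defect_space l q (- \<i>))"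

definition Dom_T :: "real \<Rightarrow> (real \<Rightarrow> real) \<Rightarrow> complex \<Rightarrow> (real \<Rightarrow> complex) set" where
  "Dom_T l q h = {y \<in> Dstar l q. deriv1 l y l = h * y l}"

definition von_Neumann_parameter ::
    "real \<Rightarrow> (real \<Rightarrow> real) \<Rightarrow> complex \<Rightarrow> complex \<Rightarrow> bool" where
  "von_Neumann_parameter l q h k \<longleftrightarrow> cmod k < 1 \<and>
     (\<exists>gp\<in>defect_space l q \<i>. \<exists>gm\<in>defect_space l q (- \<i>).
        ip l gp gp = 1 \<and> ip l gm gm = 1 \<and> (\<lambda>x. gp x - k * gm x) \<in> Dom_T l q h)"

definition weyl_m :: "real \<Rightarrow> (real \<Rightarrow> real) \<Rightarrow> complex \<Rightarrow> complex" where
  "weyl_m l q lam = (THE m. \<exists>phi1 phi2.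
     solves l q lam phi1 \<and> phi1 l = 0 \<and> deriv1 l phi1 l = 1 \<and>
     solves l q lam phi2 \<and> phi2 l = - 1 \<and> deriv1 l phi2 l = 0 \<and>
     L2 l (\<lambda>x. phi2 x + m * phi1 x))"

text \<open>
  An element \<open>f\<close> of the negative space of the rigged triplet is represented by the antilinear
  functional \<open>w \<mapsto> (f, w)\<close> on the positive space \<open>Dstar l q\<close>, extending the inner
  product of \<open>L2\<close>.  Since \<open>(w, delta) = w(l)\<close> and \<open>(w, delta') = - w'(l)\<close>, the
  functionals \<open>(delta, w)\<close> and \<open>(delta', w)\<close> are the complex conjugates of these.
\<close>

type_synonym neg = "(real \<Rightarrow> complex) \<Rightarrow> complex"

definition delta :: "real \<Rightarrow> neg" where
  "delta l w = cnj (w l)"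

definition delta' :: "real \<Rightarrow> neg" where
  "delta' l w = - cnj (deriv1 l w l)"

text \<open>
  The parameter \<open>mu\<close> ranges over the reals and one point at infinity, encoded as \<open>None\<close>.
  The clauses for \<open>None\<close> are the limits for \<open>mu\<close> tending to \<open>+\<infinity>\<close>.
\<close>

definition state_space_op ::
    "real \<Rightarrow> (real \<Rightarrow> real) \<Rightarrow> real option \<Rightarrow> complex \<Rightarrow> (real \<Rightarrow> complex) \<Rightarrow> neg" where
  "state_space_op l q mu h y w =
     ip l (diff_expr l q y) w
     - (deriv1 l y l - h * y l) *
       (case mu of
          Some m \<Rightarrow> 1 / (of_real m - h) * (of_real m * delta l w + delta' l w)
        | None \<Rightarrow> delta l w)"

definition channel_vec :: "real \<Rightarrow> real option \<Rightarrow> complex \<Rightarrow> neg" where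
  "channel_vec l mu h w =
     (case mu of
        Some m \<Rightarrow> of_real (sqrt (Im h) / cmod (of_real m - h)) *
                    (of_real m * delta l w + delta' l w)
      | None \<Rightarrow> of_real (sqrt (Im h)) * delta l w)"

definition channel_op :: "real \<Rightarrow> real option \<Rightarrow> complex \<Rightarrow> complex \<Rightarrow> neg" where
  "channel_op l mu h c w = c * channel_vec l mu h w"

text \<open>From \<open>(K c, y) = c * cnj (K\<^sup>* y)\<close>.\<close>

definition channel_adj :: "real \<Rightarrow> real option \<Rightarrow> complex \<Rightarrow> (real \<Rightarrow> complex) \<Rightarrow> complex" where
  "channel_adj l mu h y = cnj (channel_op l mu h 1 y)"

text \<open>
  The adjoint of an operator from the positive to the negative space is again such an operator,
  determined by \<open>(A y, w) = (y, A\<^sup>* w)\<close>.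
\<close>

definition op_adj :: "((real \<Rightarrow> complex) \<Rightarrow> neg) \<Rightarrow> (real \<Rightarrow> complex) \<Rightarrow> neg" where
  "op_adj A y w = cnj (A w y)"

definition op_Re :: "((real \<Rightarrow> complex) \<Rightarrow> neg) \<Rightarrow> (real \<Rightarrow> complex) \<Rightarrow> neg" where
  "op_Re A y w = (A y w + op_adj A y w) / 2"

text \<open>
  The impedance function \<open>K\<^sup>* (Re A - z)\<^sup>-\<^sup>1 K\<close>, an operator on the complex numbers
  identified with its value at 1: if \<open>(Re A - z) y = K 1\<close> in the negative space, with \<open>y\<close>
  in the positive space, then the value is \<open>K\<^sup>* y\<close>.
\<close>

definition impedance ::
    "real \<Rightarrow> (real \<Rightarrow> real) \<Rightarrow> real option \<Rightarrow> complex \<Rightarrow> complex \<Rightarrow> complex" where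
  "impedance l q mu h z = (THE v. \<exists>y\<in>Dstar l q.
     (\<forall>w\<in>Dstar l q.
        op_Re (state_space_op l q mu h) y w - z * ip l y w = channel_op l mu h 1 w) \<and>
     v = channel_adj l mu h y)"

text \<open>
  Functions are compared off the real axis only, the domain of Herglotz-Nevanlinna functions.
  The integral representation makes every member Herglotz-Nevanlinna.
\<close>

definition gen_Donoghue_class :: "real \<Rightarrow> (complex \<Rightarrow> complex) set" where
  "gen_Donoghue_class k = {M. \<exists>sigma :: real measure.
     sets sigma = sets borel \<and> emeasure sigma UNIV = \<infinity> \<and>
     integrable sigma (\<lambda>t. 1 / (1 + t\<^sup>2)) \<and>
     (\<integral>t. 1 / (1 + t\<^sup>2) \<partial>sigma) = (1 - k) / (1 + k) \<and>
     (\<forall>z. Im z \<noteq> 0 \<longrightarrow>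
        M z = (\<integral>t. (1 / (of_real t - z) - of_real (t / (1 + t\<^sup>2))) \<partial>sigma))}"

definition h_formula :: "real \<Rightarrow> real \<Rightarrow> real \<Rightarrow> real \<Rightarrow> complex" where
  "h_formula a c d m =
     of_real ((a\<^sup>2 * d\<^sup>2 * m - d\<^sup>2 * (c + m) - c * (c + m)\<^sup>2) / (a\<^sup>2 * d\<^sup>2 + (c + m)\<^sup>2))
     - \<i> * of_real ((a * d ^ 3 + a * d * (c + m)\<^sup>2) / (a\<^sup>2 * d\<^sup>2 + (c + m)\<^sup>2))"

definition h_formula_ext :: "real \<Rightarrow> real \<Rightarrow> real \<Rightarrow> real option \<Rightarrow> complex" where
  "h_formula_ext a c d mu =
     (case mu of Some m \<Rightarrow> h_formula a c d m | None \<Rightarrow> Lim at_infinity (h_formula a c d))"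

end

theory Submission
  imports Defs "HOL-Probability.Probability" "HOL-Complex_Analysis.Complex_Analysis"
begin

text \<open>
  Both sides of the equivalence say the same thing about one number.  Every member of the class
  with parameter \<open>(1 - a) / (1 + a)\<close> takes the value \<open>\<i> * a\<close> at \<open>\<i>\<close>
  (\<open>gen_Donoghue_class_at_i\<close>), and the impedance function at \<open>\<i>\<close> is an explicit
  fractional linear expression in the Weyl function, so that solving \<open>V(\<i>) = \<i> * a\<close> for
  \<open>h\<close> gives the formula (\<open>impedance_at_i_iff\<close>); the first alternative is its case
  \<open>mu = - c\<close>.  What has to be shown beyond algebra is that the single condition
  \<open>V(\<i>) = \<i> * a\<close> already puts the impedance function into the class.

  The impedance function is a real Moebius transform of the Weyl function \<open>m\<close>
  (\<open>impedance_moebius\<close>), hence holomorphic with nonnegative imaginary part on the upper half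
  plane.  By the Herglotz representation (\<open>herglotz_half_plane\<close>) it equals \<open>b * z\<close> plus
  an integral against a measure \<open>sigma\<close>.  A real additive constant is absent because
  \<open>V(\<i>)\<close> is purely imaginary, and the normalisation of \<open>sigma\<close> is the value
  \<open>V(\<i>)\<close> itself once \<open>b = 0\<close>.  That \<open>b\<close> vanishes and that \<open>sigma\<close>
  is infinite both follow from the growth of \<open>m\<close> along the imaginary axis: \<open>\<bar>m\<bar>\<close>
  and \<open>\<bar>Im m\<bar>\<close> at \<open>\<i> * t\<^sup>2\<close> are both of exact order \<open>t\<close>
  (\<open>m_asymptotics\<close>).  This in turn is a statement about a tiny interval at the left endpoint:
  there the Weyl solution is close to its tangent \<open>- 1 + m * (x - l)\<close>, while its squared norm
  is \<open>- Im m / Im z\<close>.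

  Everything about \<open>m\<close> rests on one fact, the limit point property
  (\<open>bracket_tendsto_zero\<close>): the bracket \<open>y * cnj w' - y' * cnj w\<close> of two functions of the
  maximal domain tends to \<open>0\<close> at infinity.  It is obtained from a solution \<open>p\<close> at
  \<open>\<i>\<close> that is not square integrable; such a solution exists because the deficiency index is
  one.  A two-dimensional determinant identity expresses any bracket through brackets with
  \<open>p\<close> and its conjugate, divided by the bracket of \<open>p\<close> with itself, and the latter grows
  faster than the former by Cauchy-Schwarz.  The limit point property yields Lagrange's identity on
  the half-line, and with it the uniqueness of \<open>m\<close>, the kernel identity
  \<open>m_kernel\<close>, the holomorphy of \<open>m\<close> and the solution of the equation that defines the
  impedance function.
\<close>

section \<open>Absolutely continuous functions on a half-line\<close>

lemma at_within_Ici: "l \<le> (x::real) \<Longrightarrow> x < b \<Longrightarrow> at x within {l..} = at x within {l..b}"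
  by (rule at_within_nhd[where S="{..<b}"]) auto

lemma continuous_on_Ici:
  fixes f :: "real \<Rightarrow> 'a::topological_space"
  assumes "\<And>b. continuous_on {l..b} f"
  shows "continuous_on {l..} f"
  unfolding continuous_on_eq_continuous_within
proof
  fix x assume "x \<in> {l..}"
  then have "at x within {l..} = at x within {l..x+1}"
    by (intro at_within_Ici) auto
  moreover have "continuous (at x within {l..x+1}) f"
    using assms[of "x+1"] \<open>x \<in> {l..}\<close> by (auto simp: continuous_on_eq_continuous_within)
  ultimately show "continuous (at x within {l..}) f"
    by (simp add: continuous_within)
qed

lemma loc_integrable_subinterval:
  "loc_integrable l g \<Longrightarrow> l \<le> a \<Longrightarrow> g absolutely_integrable_on {a..b}"
  unfolding loc_integrable_def
  using absolutely_integrable_on_subcbox[where f=g and S="{l..b}" and a=a and b=b] by (cases "a \<le> b") auto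

lemma loc_integrable_integrable:
  "loc_integrable l g \<Longrightarrow> l \<le> a \<Longrightarrow> g integrable_on {a..b}"
  by (rule absolutely_integrable_on_def[THEN iffD1, THEN conjunct1, OF loc_integrable_subinterval])

lemma loc_integrable_norm:
  "loc_integrable l g \<Longrightarrow> loc_integrable l (\<lambda>x. norm (g x))"
  unfolding loc_integrable_def by (auto intro: absolutely_integrable_norm[unfolded o_def])

lemma loc_integrable_add:
  "loc_integrable l f \<Longrightarrow> loc_integrable l g \<Longrightarrow> loc_integrable l (\<lambda>x. f x + g x)"
  unfolding loc_integrable_def by auto

lemma loc_integrable_of_real:
  "loc_integrable l f \<Longrightarrow> loc_integrable l (\<lambda>x. of_real (f x) :: complex)"
  unfolding loc_integrable_def
  using absolutely_integrable_linear[OF _ bounded_linear_of_real] by (auto simp: o_def)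

lemma loc_integrable_cmult:
  fixes f :: "real \<Rightarrow> complex"
  shows "loc_integrable l f \<Longrightarrow> loc_integrable l (\<lambda>x. c * f x)"
  unfolding loc_integrable_def
  using absolutely_integrable_linear[OF _ bounded_linear_mult_right] by (auto simp: o_def)

lemma loc_integrable_cnj:
  "loc_integrable l f \<Longrightarrow> loc_integrable l (\<lambda>x. cnj (f x))"
  unfolding loc_integrable_def
  using absolutely_integrable_linear[OF _ bounded_linear_cnj] by (auto simp: o_def)

lemma continuous_imp_measurable_Icc:
  fixes f :: "real \<Rightarrow> 'a::euclidean_space"
  assumes "continuous_on {a..b} f"
  shows "f \<in> borel_measurable (lebesgue_on {a..b})"
  by (simp add: assms continuous_imp_measurable_on_sets_lebesgue)

lemma loc_integrable_mult_continuous: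
  fixes f v :: "real \<Rightarrow> complex"
  assumes "loc_integrable l f" "continuous_on {l..} v"
  shows "loc_integrable l (\<lambda>x. f x * v x)"
  unfolding loc_integrable_def
proof
  fix b
  have c: "continuous_on {l..b} v"
    using assms(2) by (rule continuous_on_subset) auto
  have "(\<lambda>x. v x * f x) absolutely_integrable_on {l..b}"
  proof (rule absolutely_integrable_bounded_measurable_product[OF bilinear_times])
    show "v \<in> borel_measurable (lebesgue_on {l..b})"
      using c by (rule continuous_imp_measurable_Icc)
    show "bounded (v ` {l..b})"
      using compact_continuous_image[OF c] compact_imp_bounded by blast
    show "f absolutely_integrable_on {l..b}"
      using assms(1) by (simp add: loc_integrable_def)
  qed auto
  then show "(\<lambda>x. f x * v x) absolutely_integrable_on {l..b}"
    by (simp add: mult.commute)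
qed

lemma continuous_imp_loc_integrable:
  fixes v :: "real \<Rightarrow> 'a::euclidean_space"
  assumes "continuous_on {l..} v"
  shows "loc_integrable l v"
  unfolding loc_integrable_def
proof
  fix b show "v absolutely_integrable_on {l..b}"
    by (rule absolutely_integrable_continuous_real, rule continuous_on_subset[OF assms]) auto
qed

lemma ac_density_loc_integrable: "ac_density_of l f g \<Longrightarrow> loc_integrable l g"
  by (simp add: ac_density_of_def)

lemma ac_density_integral: "ac_density_of l f g \<Longrightarrow> l \<le> x \<Longrightarrow> f x = f l + integral {l..x} g"
  unfolding ac_density_of_def by blast

lemma ac_density_increment:
  assumes "ac_density_of l f g" "l \<le> x" "x \<le> y"
  shows "f y - f x = integral {x..y} g"
proof -
  have "integral {l..x} g + integral {x..y} g = integral {l..y} g"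
    by (rule Henstock_Kurzweil_Integration.integral_combine) (use assms in \<open>auto intro: loc_integrable_integrable ac_density_loc_integrable\<close>)
  moreover have "f y = f l + integral {l..y} g" "f x = f l + integral {l..x} g"
    using assms by (auto intro: ac_density_integral)
  ultimately show ?thesis by (simp add: algebra_simps)
qed

lemma ac_density_continuous_on:
  assumes "ac_density_of l f g"
  shows "continuous_on {l..} f"
proof (rule continuous_on_Ici)
  fix b
  have "continuous_on {l..b} (\<lambda>x. f l + integral {l..x} g)"
    by (intro continuous_intros indefinite_integral_continuous_1 loc_integrable_integrable)
       (use assms in \<open>auto intro: ac_density_loc_integrable\<close>)
  then show "continuous_on {l..b} f"
    by (rule continuous_on_eq) (use assms in \<open>auto intro: ac_density_integral[symmetric]\<close>)
qed

text \<open>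
  By Lebesgue's differentiation theorem almost every value of \<open>g\<close> is a limit of its averages over
  intervals, and all of these averages are \<open>0\<close>.
\<close>

lemma integrals_zero_imp_AE_zero:
  fixes g :: "real \<Rightarrow> complex"
  assumes g: "loc_integrable l g" and 0: "\<And>x. l \<le> x \<Longrightarrow> integral {l..x} g = 0"
  shows "AE x in lebesgue. l \<le> x \<longrightarrow> g x = 0"
proof -
  define f where "f x = (if x \<in> {l..} then g x else 0)" for x
  have f_int: "f integrable_on cbox a b" and f_0: "integral (cbox a b) f = 0" for a b
  proof -
    have *: "cbox a b \<inter> {l..} = {max a l..b}" by auto
    show "f integrable_on cbox a b"
      unfolding f_def
      using integrable_restrict_Int[of "{l..}" g "cbox a b"] loc_integrable_integrable[OF g, of "max a l" b]
      unfolding * Int_commute[of "{l..}"] by simp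
    have "integral (cbox a b) f = integral {max a l..b} g"
      unfolding f_def using integral_restrict_Int[of "cbox a b" "{l..}" g] unfolding * by (simp add: max.commute)
    also have "\<dots> = 0"
    proof (cases "max a l \<le> b")
      case True
      have "integral {l..max a l} g + integral {max a l..b} g = integral {l..b} g"
        by (rule Henstock_Kurzweil_Integration.integral_combine) (use True g in \<open>auto intro: loc_integrable_integrable\<close>)
      then show ?thesis using 0 True by auto
    qed auto
    finally show "integral (cbox a b) f = 0" .
  qed
  obtain N where N: "negligible N" and
    e: "\<And>x e. x \<notin> N \<Longrightarrow> 0 < e \<Longrightarrow> \<exists>d>0. \<forall>h. 0 < h \<and> h < d \<longrightarrow>
      norm (integral (cbox x (x + h *\<^sub>R One)) f /\<^sub>R h ^ DIM(real) - f x) < e"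
    using integrable_ccontinuous_explicit[of f] f_int by metis
  have "f x = 0" if xN: "x \<notin> N" for x
  proof (rule ccontr)
    assume "f x \<noteq> 0"
    then obtain d where "d > 0" and d: "\<forall>h. 0 < h \<and> h < d \<longrightarrow> norm (0 /\<^sub>R h ^ DIM(real) - f x) < norm (f x)"
      using e[OF xN, of "norm (f x)"] unfolding f_0 by auto
    from d[rule_format, of "d/2"] \<open>d > 0\<close> show False by simp
  qed
  moreover have "AE x in lebesgue. x \<notin> N"
    using N by (simp add: AE_not_in negligible_iff_null_sets)
  ultimately show ?thesis
    by (elim eventually_mono) (metis f_def atLeast_iff)
qed

text \<open>
  This makes \<open>ae_deriv\<close>, a choice among densities, independent of the choice up to null sets.
\<close>

lemma ac_density_unique:
  assumes "ac_density_of l f g" "ac_density_of l f g'"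
  shows "AE x in lebesgue. l \<le> x \<longrightarrow> g x = g' x"
proof -
  have i: "g integrable_on {l..x}" "g' integrable_on {l..x}" for x
    using assms by (auto intro: loc_integrable_integrable ac_density_loc_integrable)
  have "AE x in lebesgue. l \<le> x \<longrightarrow> g x + (-1) * g' x = 0"
  proof (rule integrals_zero_imp_AE_zero)
    show "loc_integrable l (\<lambda>x. g x + (-1) * g' x)"
      using assms by (intro loc_integrable_add loc_integrable_cmult) (auto dest: ac_density_loc_integrable)
    show "integral {l..x} (\<lambda>x. g x + (-1) * g' x) = 0" if "l \<le> x" for x
      using ac_density_integral[OF assms(1) that] ac_density_integral[OF assms(2) that] i[of x]
      by (simp add: Henstock_Kurzweil_Integration.integral_diff)
  qed
  then show ?thesis by (auto elim!: eventually_mono)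
qed

text \<open>
  The inequality for short increments adds up along a partition into short intervals.  It replaces the
  mean value theorem for functions that are only absolutely continuous: with a small constant
  \<open>e\<close> and a fixed \<open>G\<close> it forces \<open>H\<close> to be constant.
\<close>

lemma increments_dominated_imp_le:
  fixes H :: "real \<Rightarrow> complex" and G :: "real \<Rightarrow> real"
  assumes "a \<le> b" "0 < d"
    and incr: "\<And>x y. a \<le> x \<Longrightarrow> x \<le> y \<Longrightarrow> y \<le> b \<Longrightarrow> y - x < d \<Longrightarrow> norm (H y - H x) \<le> e * (G y - G x)"
  shows "norm (H b - H a) \<le> e * (G b - G a)"
proof -
  obtain n :: nat where n: "(b - a) / d < real n"
    using reals_Archimedean2 by blast
  have "n > 0" 
    using n assms by (cases n) (auto simp: divide_less_0_iff)
  define w where "w = (b - a) / real n"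
  define t where "t i = a + real i * w" for i
  have step: "t (Suc i) - t i = w" for i
    by (simp add: t_def algebra_simps)
  have small: "w < d"
    using n \<open>n > 0\<close> \<open>0 < d\<close> by (simp add: w_def field_simps)
  have nn: "0 \<le> w" and nw: "real n * w = b - a"
    using assms \<open>n > 0\<close> by (simp_all add: w_def)
  have tb: "t i \<le> b" if "i \<le> n" for i
  proof -
    have "real i * w \<le> real n * w"
      by (rule mult_right_mono) (use that nn in auto)
    then show ?thesis using nw by (simp add: t_def)
  qed
  have ta: "a \<le> t i" for i using nn by (simp add: t_def)
  have "norm (H (t n) - H (t 0)) = norm (\<Sum>i<n. H (t (Suc i)) - H (t i))"
    by (subst sum_lessThan_telescope) simp
  also have "\<dots> \<le> (\<Sum>i<n. norm (H (t (Suc i)) - H (t i)))" by (rule norm_sum)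
  also have "\<dots> \<le> (\<Sum>i<n. e * (G (t (Suc i)) - G (t i)))"
  proof (rule sum_mono)
    fix i assume "i \<in> {..<n}"
    then show "norm (H (t (Suc i)) - H (t i)) \<le> e * (G (t (Suc i)) - G (t i))"
      using incr[of "t i" "t (Suc i)"] ta tb[of "Suc i"] step[of i] small nn by auto
  qed
  also have "\<dots> = e * (G (t n) - G (t 0))"
    unfolding sum_distrib_left[symmetric] by (subst sum_lessThan_telescope) simp
  finally show ?thesis using nw by (simp add: t_def)
qed

lemma integral_norm_increment_bound:
  fixes g v :: "real \<Rightarrow> complex"
  assumes g: "loc_integrable l g" and xy: "l \<le> x" and v: "continuous_on {l..} v"
    and e: "\<And>t. x \<le> t \<Longrightarrow> t \<le> y \<Longrightarrow> norm (v t) \<le> e"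
  shows "norm (integral {x..y} (\<lambda>t. g t * v t)) \<le> e * integral {x..y} (\<lambda>t. norm (g t))"
proof -
  have "norm (integral {x..y} (\<lambda>t. g t * v t)) \<le> integral {x..y} (\<lambda>t. e * norm (g t))"
  proof (rule integral_norm_bound_integral)
    show "(\<lambda>t. g t * v t) integrable_on {x..y}"
      by (rule loc_integrable_integrable[OF loc_integrable_mult_continuous[OF g v] xy])
    show "(\<lambda>t. e * norm (g t)) integrable_on {x..y}"
      by (intro integrable_on_mult_right loc_integrable_integrable[OF loc_integrable_norm[OF g] xy])
    show "norm (g t * v t) \<le> e * norm (g t)" if "t \<in> {x..y}" for t
      using mult_right_mono[OF e[of t] norm_ge_zero[of "g t"]] that by (simp add: norm_mult mult.commute)
  qed
  then show ?thesis by simp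
qed

text \<open>
  Both factors are merely absolutely continuous, so that differentiating the difference \<open>H\<close> of the
  two sides is not possible everywhere.  Its increments are, however, of second order: they are bounded by
  the oscillation of \<open>u\<close> and \<open>v\<close> over the interval times the increment of the total variation
  \<open>G\<close>, and therefore \<open>H\<close> is constant.
\<close>

lemma ac_density_mult:
  assumes u: "ac_density_of l u gu" and v: "ac_density_of l v gv"
  shows "ac_density_of l (\<lambda>x. u x * v x) (\<lambda>x. gu x * v x + u x * gv x)"
proof -
  have li: "loc_integrable l gu" "loc_integrable l gv" using u v by (auto intro: ac_density_loc_integrable)
  have cu: "continuous_on {l..} u" and cv: "continuous_on {l..} v"
    using u v ac_density_continuous_on by blast+
  let ?w = "\<lambda>x. gu x * v x + gv x * u x"
  have w: "loc_integrable l ?w"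
    by (intro loc_integrable_add loc_integrable_mult_continuous li cu cv)
  have "u b * v b = u l * v l + integral {l..b} ?w" if "l \<le> b" for b
  proof -
    define H where "H x = u x * v x - integral {l..x} ?w" for x
    define G where "G x = integral {l..x} (\<lambda>t. norm (gu t)) + integral {l..x} (\<lambda>t. norm (gv t))" for x
    have G_incr: "G y - G x = integral {x..y} (\<lambda>t. norm (gu t)) + integral {x..y} (\<lambda>t. norm (gv t))"
      if "l \<le> x" "x \<le> y" for x y
    proof -
      have "integral {l..x} (\<lambda>t. norm (g t)) + integral {x..y} (\<lambda>t. norm (g t)) = integral {l..y} (\<lambda>t. norm (g t))"
        if "loc_integrable l g" for g :: "real \<Rightarrow> complex"
        by (rule Henstock_Kurzweil_Integration.integral_combine) (use \<open>l \<le> x\<close> \<open>x \<le> y\<close> loc_integrable_norm[OF that] in \<open>auto intro: loc_integrable_integrable\<close>)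
      from this[OF li(1)] this[OF li(2)] show ?thesis by (simp add: G_def)
    qed
    have H_incr: "H y - H x = integral {x..y} (\<lambda>t. gu t * (v y - v t)) + integral {x..y} (\<lambda>t. gv t * (u x - u t))"
      if "l \<le> x" "x \<le> y" for x y
    proof -
      have "integral {l..x} ?w + integral {x..y} ?w = integral {l..y} ?w"
        by (rule Henstock_Kurzweil_Integration.integral_combine) (use that w in \<open>auto intro: loc_integrable_integrable\<close>)
      then have "H y - H x = u y * v y - u x * v x - integral {x..y} ?w"
        by (simp add: H_def algebra_simps)
      also have "integral {x..y} ?w = integral {x..y} (\<lambda>t. gu t * v t) + integral {x..y} (\<lambda>t. gv t * u t)"
        by (intro Henstock_Kurzweil_Integration.integral_add loc_integrable_integrable[OF _ that(1)]
             loc_integrable_mult_continuous li cu cv)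
      also have "integral {x..y} (\<lambda>t. gu t * v t) = integral {x..y} gu * v y - integral {x..y} (\<lambda>t. gu t * (v y - v t))"
      proof -
        have "integral {x..y} (\<lambda>t. gu t * (v y - v t)) = integral {x..y} (\<lambda>t. gu t * v y - gu t * v t)"
          by (simp add: algebra_simps)
        also have "\<dots> = integral {x..y} (\<lambda>t. gu t * v y) - integral {x..y} (\<lambda>t. gu t * v t)"
          by (intro Henstock_Kurzweil_Integration.integral_diff loc_integrable_integrable[OF _ that(1)]
             loc_integrable_mult_continuous li cv continuous_intros)
        finally show ?thesis by simp
      qed
      also have "integral {x..y} (\<lambda>t. gv t * u t) = integral {x..y} gv * u x - integral {x..y} (\<lambda>t. gv t * (u x - u t))"
      proof -
        have "integral {x..y} (\<lambda>t. gv t * (u x - u t)) = integral {x..y} (\<lambda>t. gv t * u x - gv t * u t)"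
          by (simp add: algebra_simps)
        also have "\<dots> = integral {x..y} (\<lambda>t. gv t * u x) - integral {x..y} (\<lambda>t. gv t * u t)"
          by (intro Henstock_Kurzweil_Integration.integral_diff loc_integrable_integrable[OF _ that(1)]
             loc_integrable_mult_continuous li cu continuous_intros)
        finally show ?thesis by simp
      qed
      finally show ?thesis
        unfolding ac_density_increment[OF u that, symmetric] ac_density_increment[OF v that, symmetric]
        by (simp add: algebra_simps)
    qed
    have small: "norm (H b - H l) \<le> e * (G b - G l)" if "e > 0" for e
    proof -
      have unif: "uniformly_continuous_on {l..b} u" "uniformly_continuous_on {l..b} v"
        by (rule compact_uniformly_continuous, rule continuous_on_subset[OF cu] continuous_on_subset[OF cv], auto)+
      obtain d1 where d1: "d1 > 0" "\<And>s t. s \<in> {l..b} \<Longrightarrow> t \<in> {l..b} \<Longrightarrow> dist t s < d1 \<Longrightarrow> dist (u t) (u s) < e"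
        using unif(1) \<open>e > 0\<close> unfolding uniformly_continuous_on_def by meson
      obtain d2 where d2: "d2 > 0" "\<And>s t. s \<in> {l..b} \<Longrightarrow> t \<in> {l..b} \<Longrightarrow> dist t s < d2 \<Longrightarrow> dist (v t) (v s) < e"
        using unif(2) \<open>e > 0\<close> unfolding uniformly_continuous_on_def by meson
      show ?thesis
      proof (rule increments_dominated_imp_le[OF \<open>l \<le> b\<close>, of "min d1 d2"])
        fix x y assume xy: "l \<le> x" "x \<le> y" "y \<le> b" "y - x < min d1 d2"
        have "norm (integral {x..y} (\<lambda>t. gu t * (v y - v t))) \<le> e * integral {x..y} (\<lambda>t. norm (gu t))"
        proof (rule integral_norm_increment_bound[OF li(1) xy(1)])
          show "norm (v y - v t) \<le> e" if "x \<le> t" "t \<le> y" for t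
            using d2(2)[of t y] xy that by (auto simp: dist_norm)
        qed (intro continuous_intros cv)
        moreover have "norm (integral {x..y} (\<lambda>t. gv t * (u x - u t))) \<le> e * integral {x..y} (\<lambda>t. norm (gv t))"
        proof (rule integral_norm_increment_bound[OF li(2) xy(1)])
          show "norm (u x - u t) \<le> e" if "x \<le> t" "t \<le> y" for t
            using d1(2)[of t x] xy that by (auto simp: dist_norm)
        qed (intro continuous_intros cu)
        ultimately show "norm (H y - H x) \<le> e * (G y - G x)"
          unfolding H_incr[OF xy(1,2)] G_incr[OF xy(1,2)] distrib_left
          by (meson add_mono norm_triangle_le)
      qed (use d1 d2 in auto)
    qed
    have "H b - H l = 0"
    proof (rule ccontr)
      assume "H b - H l \<noteq> 0"
      then have p: "0 < norm (H b - H l)" by simp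
      define K where "K = \<bar>G b - G l\<bar> + 1"
      have "K > 0" by (auto simp: K_def)
      have "norm (H b - H l) \<le> norm (H b - H l) / (2 * K) * (G b - G l)"
        by (rule small) (use p \<open>K > 0\<close> in auto)
      also have "\<dots> \<le> norm (H b - H l) / (2 * K) * K"
        by (rule mult_left_mono) (use p \<open>K > 0\<close> in \<open>auto simp: K_def\<close>)
      also have "\<dots> = norm (H b - H l) / 2" using \<open>K > 0\<close> by simp
      finally show False using p by simp
    qed
    then show ?thesis by (simp add: H_def diff_eq_eq)
  qed
  then show ?thesis
    using w unfolding ac_density_of_def mult.commute[of "gv x" "u x" for x] by blast
qed

lemma ac_density_cong:
  "ac_density_of l f g \<Longrightarrow> (\<And>x. l \<le> x \<Longrightarrow> f' x = f x) \<Longrightarrow> ac_density_of l f' g"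
  unfolding ac_density_of_def by (metis order_refl)

lemma ac_density_cong_AE:
  assumes "ac_density_of l f g" and AE: "AE x in lebesgue. l \<le> x \<longrightarrow> g' x = g x"
  shows "ac_density_of l f g'"
proof -
  obtain N where N: "N \<in> null_sets lebesgue" "{x. \<not> (l \<le> x \<longrightarrow> g' x = g x)} \<subseteq> N"
    using AE unfolding eventually_ae_filter by auto
  have neg: "negligible N" using N by (simp add: negligible_iff_null_sets)
  have "g' absolutely_integrable_on {l..b}" for b
    by (rule absolutely_integrable_spike[OF _ neg, where f = g])
       (use ac_density_loc_integrable[OF assms(1)] N in \<open>auto simp: loc_integrable_def\<close>)
  moreover have "integral {l..x} g' = integral {l..x} g" for x
    by (rule integral_spike[OF neg]) (use N in auto)
  ultimately show ?thesis
    using ac_density_integral[OF assms(1)] unfolding ac_density_of_def loc_integrable_def by metis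
qed

lemma ac_density_lincomb:
  assumes "ac_density_of l f g" "ac_density_of l f' g'"
  shows "ac_density_of l (\<lambda>x. a * f x + b * f' x) (\<lambda>x. a * g x + b * g' x)"
proof -
  note li = assms[THEN ac_density_loc_integrable]
  have "loc_integrable l (\<lambda>x. a * g x + b * g' x)"
    by (intro loc_integrable_add loc_integrable_cmult li)
  moreover have "a * f x + b * f' x = a * f l + b * f' l + integral {l..x} (\<lambda>x. a * g x + b * g' x)"
    if "l \<le> x" for x
  proof -
    have "integral {l..x} (\<lambda>x. a * g x + b * g' x) = a * integral {l..x} g + b * integral {l..x} g'"
      by (subst Henstock_Kurzweil_Integration.integral_add)
         (auto intro: loc_integrable_integrable loc_integrable_cmult li)
    then show ?thesis
      unfolding ac_density_integral[OF assms(1) that] ac_density_integral[OF assms(2) that]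
      by (simp add: algebra_simps)
  qed
  ultimately show ?thesis unfolding ac_density_of_def by blast
qed

lemma ac_density_cnj:
  assumes "ac_density_of l f g"
  shows "ac_density_of l (\<lambda>x. cnj (f x)) (\<lambda>x. cnj (g x))"
proof -
  have "cnj (f x) = cnj (f l) + integral {l..x} (\<lambda>x. cnj (g x))" if "l \<le> x" for x
    unfolding ac_density_integral[OF assms that] by (simp flip: integral_cnj)
  with loc_integrable_cnj[OF ac_density_loc_integrable[OF assms]] show ?thesis
    unfolding ac_density_of_def by blast
qed

lemma has_vector_derivative_indefinite:
  assumes y: "ac_density_of l y y1" and c: "continuous_on {l..} y1" and x: "l \<le> x"
  shows "(y has_vector_derivative y1 x) (at x within {l..})"
proof -
  have "((\<lambda>u. integral {l..u} y1) has_vector_derivative y1 x) (at x within {l..x+1})"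
    by (rule integral_has_vector_derivative) (use c x in \<open>auto intro: continuous_on_subset\<close>)
  then have "((\<lambda>u. y l + integral {l..u} y1) has_vector_derivative (0 + y1 x)) (at x within {l..x+1})"
    by (intro has_vector_derivative_add has_vector_derivative_const)
  then have "((\<lambda>u. y l + integral {l..u} y1) has_vector_derivative y1 x) (at x within {l..})"
    using at_within_Ici[of l x "x+1"] x by simp
  then show ?thesis
    by (rule has_vector_derivative_transform[rotated 2]) 
       (use x ac_density_integral[OF y, symmetric] in auto)
qed

lemma at_within_Ici_nontrivial: "l \<le> (x::real) \<Longrightarrow> at x within {l..} \<noteq> bot"
  using at_within_Ici[of l x "x+1"] by (simp add: trivial_limit_within)

text \<open>
  A function given by a continuous density which is itself absolutely continuous is differentiable
  everywhere, one-sidedly at \<open>l\<close>, so the chosen derivatives \<open>deriv1\<close> and \<open>ae_deriv\<close>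
  can be read off from the densities.
\<close>

lemma regularI:
  assumes y: "ac_density_of l y y1" and y1: "ac_density_of l y1 g"
  shows "regular l y" "\<And>x. l \<le> x \<Longrightarrow> deriv1 l y x = y1 x"
    "AE x in lebesgue. l \<le> x \<longrightarrow> ae_deriv l (deriv1 l y) x = g x"
proof -
  note vd = has_vector_derivative_indefinite[OF y ac_density_continuous_on[OF y1]]
  show d: "\<And>x. l \<le> x \<Longrightarrow> deriv1 l y x = y1 x"
    unfolding deriv1_def using vd at_within_Ici_nontrivial by (blast intro: vector_derivative_within)
  then have dg: "ac_density_of l (deriv1 l y) g"
    using ac_density_cong[OF y1] by blast
  have "y differentiable_on {l..}"
    unfolding differentiable_on_def using vd by (auto intro: differentiableI_vector)
  then show "regular l y"
    using y dg unfolding regular_def loc_abs_continuous_def by blast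
  have "ac_density_of l (deriv1 l y) (ae_deriv l (deriv1 l y))"
    unfolding ae_deriv_def by (rule someI[of _ g]) (rule dg)
  then show "AE x in lebesgue. l \<le> x \<longrightarrow> ae_deriv l (deriv1 l y) x = g x"
    using ac_density_unique dg by blast
qed

lemma regularD:
  assumes "regular l y"
  shows "ac_density_of l y (deriv1 l y)" "ac_density_of l (deriv1 l y) (ae_deriv l (deriv1 l y))"
proof -
  obtain g where g: "ac_density_of l (deriv1 l y) g"
    using assms unfolding regular_def loc_abs_continuous_def by blast
  show d: "ac_density_of l (deriv1 l y) (ae_deriv l (deriv1 l y))"
    unfolding ae_deriv_def by (rule someI[of _ g]) (rule g)
  have c: "continuous_on {l..} (deriv1 l y)"
    by (rule ac_density_continuous_on[OF d])
  have vd: "(y has_vector_derivative deriv1 l y x) (at x within {l..})" if "l \<le> x" for x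
    using assms that unfolding regular_def differentiable_on_def deriv1_def
    by (auto simp: vector_derivative_works)
  have "(deriv1 l y has_integral (y x - y l)) {l..x}" if "l \<le> x" for x
  proof (rule fundamental_theorem_of_calculus[OF that])
    fix t assume "t \<in> {l..x}"
    then show "(y has_vector_derivative deriv1 l y t) (at t within {l..x})"
      by (intro has_vector_derivative_within_subset[OF vd]) auto
  qed
  then have "y x = y l + integral {l..x} (deriv1 l y)" if "l \<le> x" for x
    using that by (metis add.commute diff_add_cancel integral_unique)
  then show "ac_density_of l y (deriv1 l y)"
    using continuous_imp_loc_integrable[OF c] unfolding ac_density_of_def by blast
qed

text \<open>
  The differential equation as a first-order system of integral equations for \<open>y\<close> and its
  derivative \<open>y1\<close>, free of choices of derivatives.
\<close>

definition solution_pair :: "real \<Rightarrow> (real \<Rightarrow> real) \<Rightarrow> complex \<Rightarrow> (real \<Rightarrow> complex) \<Rightarrow> (real \<Rightarrow> complex) \<Rightarrow> bool" where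
  "solution_pair l q z y y1 \<longleftrightarrow> ac_density_of l y y1 \<and> ac_density_of l y1 (\<lambda>x. (of_real (q x) - z) * y x)"

lemma solves_imp_solution_pair:
  assumes "solves l q z y"
  shows "solution_pair l q z y (deriv1 l y)"
proof -
  have r: "regular l y" and e: "AE x in lebesgue. l \<le> x \<longrightarrow> diff_expr l q y x = z * y x"
    using assms by (auto simp: solves_def)
  have "AE x in lebesgue. l \<le> x \<longrightarrow> (of_real (q x) - z) * y x = ae_deriv l (deriv1 l y) x"
    using e by eventually_elim (auto simp: diff_expr_def algebra_simps)
  from ac_density_cong_AE[OF regularD(2)[OF r] this] regularD(1)[OF r] show ?thesis
    by (simp add: solution_pair_def)
qed

lemma solution_pair_imp_solves:
  assumes "solution_pair l q z y y1"
  shows "solves l q z y" "\<And>x. l \<le> x \<Longrightarrow> deriv1 l y x = y1 x"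
proof -
  have *: "ac_density_of l y y1" "ac_density_of l y1 (\<lambda>x. (of_real (q x) - z) * y x)"
    using assms by (auto simp: solution_pair_def)
  show "\<And>x. l \<le> x \<Longrightarrow> deriv1 l y x = y1 x" by (rule regularI(2)[OF *])
  from regularI(3)[OF *] have "AE x in lebesgue. x \<ge> l \<longrightarrow> diff_expr l q y x = z * y x"
    by eventually_elim (auto simp: diff_expr_def algebra_simps)
  then show "solves l q z y" using regularI(1)[OF *] by (simp add: solves_def)
qed

lemma solution_pair_lincomb:
  assumes "solution_pair l q z f f1" "solution_pair l q z g g1"
  shows "solution_pair l q z (\<lambda>x. a * f x + b * g x) (\<lambda>x. a * f1 x + b * g1 x)"
proof -
  have "(\<lambda>x. (of_real (q x) - z) * (a * f x + b * g x)) =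
      (\<lambda>x. a * ((of_real (q x) - z) * f x) + b * ((of_real (q x) - z) * g x))"
    by (auto simp: algebra_simps)
  then show ?thesis using assms unfolding solution_pair_def
    by (auto intro: ac_density_lincomb)
qed

section \<open>The initial value problem\<close>

lemma ac_density_power:
  assumes "ac_density_of l f g"
  shows "ac_density_of l (\<lambda>x. f x ^ Suc n) (\<lambda>x. of_nat (Suc n) * g x * f x ^ n)"
proof (induction n)
  case 0
  then show ?case using assms by simp
next
  case (Suc n)
  have "(\<lambda>x. of_nat (Suc n) * g x * f x ^ n * f x + f x ^ Suc n * g x) = (\<lambda>x. of_nat (Suc (Suc n)) * g x * f x ^ Suc n)"
    by (auto simp: algebra_simps)
  with ac_density_mult[OF Suc assms] show ?case by (simp add: mult.commute)
qed

text \<open>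
  The substitution rule for a primitive of a locally summable function, which provides the factorials in
  the Picard iteration.
\<close>

lemma integral_mult_primitive_power:
  fixes k :: "real \<Rightarrow> real"
  assumes k: "loc_integrable l k" and "l \<le> x"
  shows "((\<lambda>t. k t * (integral {l..t} k) ^ n) has_integral (integral {l..x} k) ^ Suc n / Suc n) {l..x}"
proof -
  define F where "F t = integral {l..t} k" for t
  have F: "ac_density_of l (\<lambda>t. of_real (F t)) (\<lambda>t. of_real (k t))"
  proof -
    have "complex_of_real (F t) = of_real (F l) + integral {l..t} (\<lambda>t. of_real (k t))" for t
    proof -
      have "integral {l..t} (complex_of_real \<circ> k) = of_real (integral {l..t} k)"
        by (rule integral_linear[OF loc_integrable_integrable[OF k order_refl] bounded_linear_of_real])
      then show ?thesis by (simp add: F_def o_def)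
    qed
    then show ?thesis
      using loc_integrable_of_real[OF k] unfolding ac_density_of_def by blast
  qed
  note P = ac_density_power[OF F, of n]
  let ?g = "\<lambda>t. k t * F t ^ n"
  have "(\<lambda>t. of_nat (Suc n) * of_real (k t) * of_real (F t) ^ n) = (\<lambda>t. complex_of_real (real (Suc n) * ?g t))"
    by (auto simp del: of_nat_Suc)
  then have P': "ac_density_of l (\<lambda>t. of_real (F t ^ Suc n)) (\<lambda>t. complex_of_real (real (Suc n) * ?g t))"
    using P by (simp only: of_real_power)
  have "((\<lambda>t. complex_of_real (real (Suc n) * ?g t)) has_integral of_real (F x ^ Suc n)) {l..x}"
    using integrable_integral[OF loc_integrable_integrable[OF ac_density_loc_integrable[OF P'] order_refl, of x]]
      ac_density_integral[OF P' assms(2)] by (simp add: F_def)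
  from has_integral_linear[OF this bounded_linear_Re]
  have "((\<lambda>t. real (Suc n) * ?g t) has_integral F x ^ Suc n) {l..x}"
    by (simp only: o_def Re_complex_of_real)
  from has_integral_mult_right[OF this, of "1 / Suc n"] show ?thesis
    by (simp add: F_def del: of_nat_Suc)
qed

text \<open>
  Picard iteration.  With a coefficient that is only locally summable the equation is read as
  \<open>y = al + be * (x - l) + B y\<close>, where \<open>B\<close> integrates \<open>(q - z) * y\<close> twice.  The \<open>n\<close>-th
  iterate is bounded by \<open>((b - l) * F x) ^ n / n!\<close> with \<open>F\<close> the primitive of
  \<open>\<bar>q - z\<bar>\<close>, so one and the same series converges uniformly on every bounded interval and
  gives the solution on the whole half-line.
\<close>

lemma initial_value_problem_ex:
  fixes q :: "real \<Rightarrow> real" and z al be :: complex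
  assumes q: "loc_integrable l q"
  shows "\<exists>y y1. solution_pair l q z y y1 \<and> y l = al \<and> y1 l = be"
proof -
  define p where "p x = of_real (q x) - z" for x
  define k where "k x = norm (p x)" for x
  define F where "F x = integral {l..x} k" for x
  define A where "A y x = integral {l..x} (\<lambda>t. p t * y t)" for y x
  define B where "B y x = integral {l..x} (A y)" for y x
  define d where "d n = (B ^^ n) (\<lambda>x. al + be * of_real (x - l))" for n
  have d_simps: "d 0 = (\<lambda>x. al + be * of_real (x - l))" "d (Suc n) = B (d n)" for n
    by (simp_all add: d_def)
  have p: "loc_integrable l p"
    using loc_integrable_add[OF loc_integrable_of_real[OF q] continuous_imp_loc_integrable[of l "\<lambda>x. -z"]]
    by (simp add: p_def[abs_def])
  have k: "loc_integrable l k"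
    using loc_integrable_norm[OF p] by (simp add: k_def[abs_def])
  have k0: "0 \<le> k t" for t by (simp add: k_def)
  have F0: "0 \<le> F x" for x
    unfolding F_def by (rule Henstock_Kurzweil_Integration.integral_nonneg) 
      (auto intro: k0 loc_integrable_integrable[OF k])
  have F_mono: "F x \<le> F y" if "x \<le> y" for x y
    unfolding F_def by (rule integral_subset_le) 
      (use that in \<open>auto intro: k0 loc_integrable_integrable[OF k]\<close>)
  have A_dens: "ac_density_of l (A y) (\<lambda>t. p t * y t)" if "continuous_on {l..} y" for y
    using loc_integrable_mult_continuous[OF p that] by (simp add: ac_density_of_def A_def)
  have A_cont: "continuous_on {l..} (A y)" if "continuous_on {l..} y" for y
    using A_dens[OF that] by (rule ac_density_continuous_on)
  have B_dens: "ac_density_of l (B y) (A y)" if "continuous_on {l..} y" for y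
    using continuous_imp_loc_integrable[OF A_cont[OF that]] by (simp add: ac_density_of_def B_def)
  have B_cont: "continuous_on {l..} (B y)" if "continuous_on {l..} y" for y
    using B_dens[OF that] by (rule ac_density_continuous_on)
  have d_cont: "continuous_on {l..} (d n)" for n
    by (induction n) (auto simp: d_simps intro!: continuous_intros B_cont)
  \<comment> \<open>The factor (x - l) comes from the outer integration; the inner one is estimated by its value at x.\<close>
  have B_bound: "norm (B y x) \<le> (x - l) * integral {l..x} (\<lambda>t. k t * h t)"
    if y: "continuous_on {l..} y" and h: "continuous_on {l..} h" and x: "l \<le> x"
      and yh: "\<And>t. l \<le> t \<Longrightarrow> t \<le> x \<Longrightarrow> norm (y t) \<le> h t" for x y and h :: "real \<Rightarrow> real"
  proof -
    have kh: "(\<lambda>t. k t * h t) integrable_on {l..s}" for s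
    proof -
      have "(\<lambda>t. complex_of_real (k t) * of_real (h t)) integrable_on {l..s}"
        using loc_integrable_integrable[OF loc_integrable_mult_continuous[OF loc_integrable_of_real[OF k]
              continuous_on_of_real[OF h]] order_refl] .
      from integrable_linear[OF this bounded_linear_Re] show ?thesis by (simp add: o_def)
    qed
    have A_le: "norm (A y s) \<le> integral {l..x} (\<lambda>t. k t * h t)" if s: "l \<le> s" "s \<le> x" for s
    proof -
      have "norm (A y s) \<le> integral {l..s} (\<lambda>t. k t * h t)"
        unfolding A_def
      proof (rule integral_norm_bound_integral)
        show "norm (p t * y t) \<le> k t * h t" if "t \<in> {l..s}" for t
          using yh[of t] that s by (auto simp: norm_mult k_def intro!: mult_left_mono)
      qed (use kh in \<open>auto intro: loc_integrable_integrable[OF loc_integrable_mult_continuous[OF p y]]\<close>)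
      also have "\<dots> \<le> integral {l..x} (\<lambda>t. k t * h t)"
      proof (rule integral_subset_le)
        show "\<forall>t\<in>{l..x}. 0 \<le> k t * h t"
          using order_trans[OF norm_ge_zero yh] k0 by simp
      qed (use s kh in auto)
      finally show ?thesis .
    qed
    have "norm (B y x) \<le> integral {l..x} (\<lambda>t. k t * h t) * (x - l)"
      unfolding B_def by (rule integral_bound[OF x]) 
        (use A_le A_cont[OF y] in \<open>auto intro: continuous_on_subset\<close>)
    then show ?thesis by (simp add: mult.commute)
  qed
  have F_cont: "continuous_on {l..} F"
    unfolding F_def[abs_def] by (rule continuous_on_Ici) (auto intro!: indefinite_integral_continuous_1 loc_integrable_integrable[OF k])
  have d_bound: "norm (d n x) \<le> (norm al + norm be * (b - l)) * ((b - l) * F x) ^ n / fact n"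
    if x: "l \<le> x" "x \<le> b" for n x b
    using x
  proof (induction n arbitrary: x)
    case 0
    have "norm (d 0 x) \<le> norm al + norm be * (x - l)"
      using 0 norm_triangle_ineq[of al "be * of_real (x - l)"] by (simp add: d_simps norm_mult del: of_real_diff)
    also have "\<dots> \<le> norm al + norm be * (b - l)"
      using 0 by (auto intro: mult_left_mono)
    finally show ?case by simp
  next
    case (Suc n)
    define C where "C = (norm al + norm be * (b - l)) * (b - l) ^ n / fact n"
    have C0: "0 \<le> C" using Suc.prems by (simp add: C_def)
    have "norm (d (Suc n) x) \<le> (x - l) * integral {l..x} (\<lambda>t. k t * (C * F t ^ n))"
      unfolding d_simps
    proof (rule B_bound)
      show "norm (d n t) \<le> C * F t ^ n" if "l \<le> t" "t \<le> x" for t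
        using Suc.IH[of t] Suc.prems that by (simp add: C_def power_mult_distrib)
    qed (use Suc.prems in \<open>auto intro!: continuous_intros F_cont d_cont\<close>)
    also have "integral {l..x} (\<lambda>t. k t * (C * F t ^ n)) = C * (F x ^ Suc n / Suc n)"
    proof -
      from has_integral_mult_right[OF integral_mult_primitive_power[OF k Suc.prems(1), of n], of C]
      show ?thesis unfolding F_def[symmetric]
        by (intro integral_unique) (simp add: mult.left_commute del: of_nat_Suc power_Suc)
    qed
    also have "(x - l) * (C * (F x ^ Suc n / Suc n)) \<le> (b - l) * (C * (F x ^ Suc n / Suc n))"
      by (rule mult_right_mono) (use Suc.prems C0 F0 in auto)
    also have "\<dots> = (norm al + norm be * (b - l)) * ((b - l) * F x) ^ Suc n / fact (Suc n)"
      by (simp add: C_def power_mult_distrib mult_ac)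
    finally show ?case .
  qed
  define y where "y x = (\<Sum>n. d n x)" for x
  have unif: "uniform_limit {l..b} (\<lambda>n x. \<Sum>i<n. d i x) y sequentially" for b
    unfolding y_def[abs_def]
  proof (rule Weierstrass_m_test)
    fix n x assume "x \<in> {l..b}"
    then have x: "l \<le> x" "x \<le> b" by auto
    have "norm (d n x) \<le> (norm al + norm be * (b - l)) * ((b - l) * F x) ^ n / fact n"
      by (rule d_bound[OF x])
    also have "\<dots> \<le> (norm al + norm be * (b - l)) * ((b - l) * F b) ^ n / fact n"
      using x F_mono[OF x(2)] F0[of x]
      by (intro divide_right_mono mult_left_mono power_mono mult_nonneg_nonneg add_nonneg_nonneg) auto
    also have "\<dots> = (norm al + norm be * (b - l)) * (((b - l) * F b) ^ n /\<^sub>R fact n)"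
      by (simp add: field_simps)
    finally show "norm (d n x) \<le> (norm al + norm be * (b - l)) * (((b - l) * F b) ^ n /\<^sub>R fact n)" .
  next
    show "summable (\<lambda>n. (norm al + norm be * (b - l)) * (((b - l) * F b) ^ n /\<^sub>R fact n))"
      by (intro summable_mult summable_exp_generic)
  qed
  have S_cont: "continuous_on {l..} (\<lambda>x. \<Sum>i<n. d i x)" for n
    by (intro continuous_intros d_cont)
  have y_cont: "continuous_on {l..} y"
  proof (rule continuous_on_Ici)
    fix b show "continuous_on {l..b} y"
      by (rule uniform_limit_theorem[OF always_eventually unif])
        (auto intro: continuous_on_subset[OF S_cont])
  qed
  have p_int: "(\<lambda>t. p t * u t) integrable_on {l..s}" if "continuous_on {l..} u" for u s
    by (rule loc_integrable_integrable[OF loc_integrable_mult_continuous[OF p that] order_refl])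
  have c_int: "u integrable_on {l..s}" if "continuous_on {l..} u" for u :: "real \<Rightarrow> complex" and s
    by (rule loc_integrable_integrable[OF continuous_imp_loc_integrable[OF that] order_refl])
  have B_diff: "B u x - B v x = B (\<lambda>t. u t - v t) x"
    if "continuous_on {l..} u" "continuous_on {l..} v" "l \<le> x" for u v x
  proof -
    have "A u s - A v s = A (\<lambda>t. u t - v t) s" for s
      unfolding A_def right_diff_distrib
      by (rule Henstock_Kurzweil_Integration.integral_diff[symmetric]) (intro p_int that)+
    then show ?thesis
      unfolding B_def
      by (subst Henstock_Kurzweil_Integration.integral_diff[symmetric])
        (auto intro: c_int A_cont that)
  qed
  \<comment> \<open>The partial sums of the series are the Picard iterates.\<close>
  have S_Suc: "(\<Sum>i<Suc n. d i x) = al + be * of_real (x - l) + B (\<lambda>t. \<Sum>i<n. d i t) x" if "l \<le> x" for n x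
  proof (induction n)
    case 0
    have "B (\<lambda>t. 0) x = 0" by (simp add: B_def A_def[abs_def])
    then show ?case by (simp add: d_simps)
  next
    case (Suc n)
    have "B (\<lambda>t. \<Sum>i<Suc n. d i t) x - B (\<lambda>t. \<Sum>i<n. d i t) x = d (Suc n) x"
      using B_diff[OF S_cont[of "Suc n"] S_cont[of n] that] by (simp add: d_simps)
    then show ?case using Suc by (simp add: algebra_simps)
  qed
  have fix_eq: "y x = al + be * of_real (x - l) + B y x" if x: "l \<le> x" for x
  proof (rule LIMSEQ_unique)
    show "(\<lambda>n. \<Sum>i<Suc n. d i x) \<longlonglongrightarrow> y x"
      using tendsto_uniform_limitI[OF unif[of x], of x] x by (intro LIMSEQ_Suc) auto
    have "(\<lambda>n. B (\<lambda>t. \<Sum>i<n. d i t) x) \<longlonglongrightarrow> B y x"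
    proof (rule LIMSEQ_I)
      fix e :: real assume "e > 0"
      define e' where "e' = e / ((x - l) * F x + 1)"
      have pos: "0 < (x - l) * F x + 1" using x F0[of x] by (simp add: add_nonneg_pos)
      have "e' > 0" using \<open>e > 0\<close> pos by (simp add: e'_def)
      then obtain N where N: "\<And>n t. n \<ge> N \<Longrightarrow> t \<in> {l..x} \<Longrightarrow> dist (\<Sum>i<n. d i t) (y t) < e'"
        using unif[of x] unfolding uniform_limit_sequentially_iff by meson
      have "norm (B (\<lambda>t. \<Sum>i<n. d i t) x - B y x) < e" if "n \<ge> N" for n
      proof -
        have "norm (B (\<lambda>t. \<Sum>i<n. d i t) x - B y x) \<le> (x - l) * integral {l..x} (\<lambda>t. k t * e')"
          unfolding B_diff[OF S_cont y_cont x]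
          by (rule B_bound) (use x N[OF that] in \<open>auto intro!: continuous_intros S_cont y_cont simp: dist_norm less_imp_le\<close>)
        also have "\<dots> = (x - l) * F x * e'" by (simp add: F_def)
        also have "\<dots> < ((x - l) * F x + 1) * e'" using \<open>e' > 0\<close> by (simp add: algebra_simps)
        also have "\<dots> = e" using pos by (simp add: e'_def)
        finally show ?thesis .
      qed
      then show "\<exists>N. \<forall>n\<ge>N. norm (B (\<lambda>t. \<Sum>i<n. d i t) x - B y x) < e" by blast
    qed
    then show "(\<lambda>n. \<Sum>i<Suc n. d i x) \<longlonglongrightarrow> al + be * of_real (x - l) + B y x"
      unfolding S_Suc[OF x] by (intro tendsto_intros)
  qed
  define y1 where "y1 x = be + A y x" for x
  have y1d: "ac_density_of l y1 (\<lambda>t. p t * y t)"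
    using A_dens[OF y_cont] unfolding y1_def[abs_def] ac_density_of_def by (auto simp: A_def)
  have yd: "ac_density_of l y y1"
  proof -
    have "y x = y l + integral {l..x} y1" if "l \<le> x" for x
    proof -
      have "integral {l..x} y1 = be * of_real (x - l) + B y x"
        unfolding y1_def[abs_def] B_def using that
        by (subst Henstock_Kurzweil_Integration.integral_add)
          (auto simp: scaleR_conv_of_real mult.commute intro: c_int A_cont y_cont)
      moreover have "B y l = 0" by (simp add: B_def)
      ultimately show ?thesis using fix_eq[OF that] fix_eq[of l] by simp
    qed
    then show ?thesis
      using continuous_imp_loc_integrable[OF ac_density_continuous_on[OF y1d]]
      unfolding ac_density_of_def by blast
  qed
  have "y l = al" "y1 l = be" using fix_eq[of l] by (auto simp: B_def y1_def A_def)
  then show ?thesis using yd y1d unfolding solution_pair_def p_def by blast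
qed

section \<open>Square integrable functions\<close>

definition sq_integrable :: "real set \<Rightarrow> (real \<Rightarrow> complex) \<Rightarrow> bool" where
  "sq_integrable S f \<longleftrightarrow> f \<in> borel_measurable (lebesgue_on S) \<and> (\<lambda>x. (cmod (f x))\<^sup>2) absolutely_integrable_on S"

lemma L2_iff_sq_integrable: "L2 l f \<longleftrightarrow> sq_integrable {l..} f"
  by (simp add: L2_def sq_integrable_def)

lemma abs_integrable_integrable:
  fixes f :: "real \<Rightarrow> 'a::euclidean_space"
  shows "f absolutely_integrable_on S \<Longrightarrow> f integrable_on S"
  by (rule set_lebesgue_integral_eq_integral(1))

lemma borel_measurable_cnj [measurable]: "cnj \<in> borel_measurable borel"
  by (intro borel_measurable_continuous_onI continuous_intros)

lemma sq_integrable_subset: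
  assumes "sq_integrable S f" "T \<subseteq> S" "T \<in> sets lebesgue"
  shows "sq_integrable T f"
  using assms unfolding sq_integrable_def
  by (auto intro: measurable_restrict_mono set_integrable_subset)

lemma sq_integrable_continuous:
  "continuous_on {a..b} f \<Longrightarrow> sq_integrable {a..b} f"
  unfolding sq_integrable_def
  by (auto intro!: continuous_imp_measurable_Icc absolutely_integrable_continuous_real continuous_intros)

lemma quadratic_nonneg_imp_discriminant:
  fixes a b r :: real
  assumes "\<And>t. 0 \<le> t\<^sup>2 * a - 2 * t * r + b" "0 \<le> a"
  shows "r\<^sup>2 \<le> a * b"
proof (cases "a = 0")
  case True
  have "r = 0"
  proof (rule ccontr)
    assume "r \<noteq> 0"
    with assms(1)[of "(b + 1) / (2 * r)"] True show False by simp
  qed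
  then show ?thesis using True by simp
next
  case False
  with assms have "a > 0" by simp
  have "0 \<le> (r / a)\<^sup>2 * a - 2 * (r / a) * r + b" by (rule assms(1))
  also have "\<dots> = b - r\<^sup>2 / a" using \<open>a > 0\<close> by (simp add: power2_eq_square field_simps)
  finally show ?thesis using \<open>a > 0\<close> by (simp add: field_simps)
qed

lemma sq_integrable_mult:
  assumes S: "S \<in> sets lebesgue" and f: "sq_integrable S f" and g: "sq_integrable S g"
  shows "(\<lambda>x. f x * cnj (g x)) absolutely_integrable_on S"
proof (rule measurable_bounded_by_integrable_imp_absolutely_integrable[OF _ S])
  have [measurable]: "f \<in> borel_measurable (lebesgue_on S)" "g \<in> borel_measurable (lebesgue_on S)"
    using f g by (auto simp: sq_integrable_def)
  show "(\<lambda>x. f x * cnj (g x)) \<in> borel_measurable (lebesgue_on S)" by measurable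
  show "(\<lambda>x. (cmod (f x))\<^sup>2 + (cmod (g x))\<^sup>2) integrable_on S"
    using f g by (auto simp: sq_integrable_def intro!: integrable_add abs_integrable_integrable)
  show "norm (f x * cnj (g x)) \<le> (cmod (f x))\<^sup>2 + (cmod (g x))\<^sup>2" for x
    using sum_squares_bound[of "cmod (f x)" "cmod (g x)"]
      mult_nonneg_nonneg[OF norm_ge_zero[of "f x"] norm_ge_zero[of "g x"]]
    unfolding norm_mult complex_mod_cnj mult.assoc by linarith
qed

lemma integral_Cauchy_Schwarz:
  assumes S: "S \<in> sets lebesgue" and f: "sq_integrable S f" and g: "sq_integrable S g"
  shows "(cmod (integral S (\<lambda>x. f x * cnj (g x))))\<^sup>2
    \<le> integral S (\<lambda>x. (cmod (f x))\<^sup>2) * integral S (\<lambda>x. (cmod (g x))\<^sup>2)"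
proof -
  let ?a = "integral S (\<lambda>x. (cmod (f x))\<^sup>2)" and ?b = "integral S (\<lambda>x. (cmod (g x))\<^sup>2)"
  let ?r = "integral S (\<lambda>x. cmod (f x) * cmod (g x))"
  note fg = sq_integrable_mult[OF assms]
  have i1: "(\<lambda>x. (cmod (f x))\<^sup>2) integrable_on S" and i2: "(\<lambda>x. (cmod (g x))\<^sup>2) integrable_on S"
    using f g by (auto simp: sq_integrable_def intro!: abs_integrable_integrable)
  have i3: "(\<lambda>x. cmod (f x) * cmod (g x)) integrable_on S"
    using fg by (simp add: absolutely_integrable_on_def norm_mult)
  have "cmod (integral S (\<lambda>x. f x * cnj (g x))) \<le> ?r"
    by (rule integral_norm_bound_integral[OF abs_integrable_integrable[OF fg] i3]) (simp add: norm_mult)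
  then have "(cmod (integral S (\<lambda>x. f x * cnj (g x))))\<^sup>2 \<le> ?r\<^sup>2"
    by (rule power_mono) auto
  also have "?r\<^sup>2 \<le> ?a * ?b"
  proof (rule quadratic_nonneg_imp_discriminant)
    fix t :: real
    have eq: "(\<lambda>x. (t * cmod (f x) - cmod (g x))\<^sup>2)
        = (\<lambda>x. t\<^sup>2 * (cmod (f x))\<^sup>2 - (2 * t) * (cmod (f x) * cmod (g x)) + (cmod (g x))\<^sup>2)"
      by (auto simp: power2_eq_square algebra_simps)
    have "(\<lambda>x. (t * cmod (f x) - cmod (g x))\<^sup>2) integrable_on S"
      unfolding eq using i1 i2 i3 by (auto intro!: integrable_add integrable_diff integrable_on_mult_right)
    then have "0 \<le> integral S (\<lambda>x. (t * cmod (f x) - cmod (g x))\<^sup>2)"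
      by (rule Henstock_Kurzweil_Integration.integral_nonneg) auto
    also have "integral S (\<lambda>x. (t * cmod (f x) - cmod (g x))\<^sup>2) = t\<^sup>2 * ?a - 2 * t * ?r + ?b"
      unfolding eq
      by (intro integral_unique has_integral_add has_integral_diff has_integral_mult_right integrable_integral i1 i2 i3)
    finally show "0 \<le> t\<^sup>2 * ?a - 2 * t * ?r + ?b" .
  qed (rule Henstock_Kurzweil_Integration.integral_nonneg[OF i1], auto)
  finally show ?thesis .
qed

lemma borel_measurable_cong_AE_on:
  fixes f g :: "real \<Rightarrow> complex"
  assumes S: "S \<in> sets lebesgue" and f: "f \<in> borel_measurable (lebesgue_on S)"
    and AE: "AE x in lebesgue. x \<in> S \<longrightarrow> f x = g x"
  shows "g \<in> borel_measurable (lebesgue_on S)"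
proof -
  have "(\<lambda>x. if x \<in> S then f x else 0) \<in> borel_measurable lebesgue"
    using f S by (rule borel_measurable_if_I)
  moreover have "AE x in lebesgue. (if x \<in> S then f x else 0) = (if x \<in> S then g x else 0)"
    by (rule eventually_mono[OF AE]) auto
  ultimately have "(\<lambda>x. if x \<in> S then g x else 0) \<in> borel_measurable lebesgue"
    by (rule borel_measurable_AE)
  then show ?thesis by (rule borel_measurable_if_D)
qed

lemma AE_on_negligibleE:
  assumes "AE x in lebesgue. P (x::real)"
  obtains N where "negligible N" "\<And>x. x \<notin> N \<Longrightarrow> P x"
proof -
  obtain N where "N \<in> null_sets lebesgue" "{x. \<not> P x} \<subseteq> N"
    using assms unfolding eventually_ae_filter by auto
  then show ?thesis
    by (intro that[of N]) (auto simp: negligible_iff_null_sets)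
qed

lemma sq_integrable_cong_AE:
  fixes f g :: "real \<Rightarrow> complex"
  assumes S: "S \<in> sets lebesgue" and f: "sq_integrable S f"
    and AE: "AE x in lebesgue. x \<in> S \<longrightarrow> f x = g x"
  shows "sq_integrable S g"
proof -
  obtain N where N: "negligible N" "\<And>x. x \<notin> N \<Longrightarrow> x \<in> S \<Longrightarrow> f x = g x"
    using AE_on_negligibleE[OF AE] by metis
  have "(\<lambda>x. (cmod (g x))\<^sup>2) absolutely_integrable_on S"
    by (rule absolutely_integrable_spike[OF _ N(1), where f="\<lambda>x. (cmod (f x))\<^sup>2"])
      (use f N(2) in \<open>auto simp: sq_integrable_def\<close>)
  then show ?thesis
    using f borel_measurable_cong_AE_on[OF S _ AE] by (simp add: sq_integrable_def)
qed

lemma sq_integrable_cmult: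
  assumes "sq_integrable S f"
  shows "sq_integrable S (\<lambda>x. c * f x)"
  using assms unfolding sq_integrable_def
  by (auto simp: norm_mult power_mult_distrib intro!: set_integrable_mult_right)

lemma cmod_sq_triangle: "(cmod (a + b))\<^sup>2 \<le> 2 * (cmod a)\<^sup>2 + 2 * (cmod b)\<^sup>2"
proof -
  have "(cmod (a + b))\<^sup>2 \<le> (cmod a + cmod b)\<^sup>2"
    by (intro power_mono norm_triangle_ineq) auto
  also have "\<dots> \<le> 2 * (cmod a)\<^sup>2 + 2 * (cmod b)\<^sup>2"
    using sum_squares_bound[of "cmod a" "cmod b"] by (simp add: power2_sum)
  finally show ?thesis .
qed

lemma sq_integrable_add:
  assumes S: "S \<in> sets lebesgue" and f: "sq_integrable S f" and g: "sq_integrable S g"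
  shows "sq_integrable S (\<lambda>x. f x + g x)"
proof -
  have m[measurable]: "f \<in> borel_measurable (lebesgue_on S)" "g \<in> borel_measurable (lebesgue_on S)"
    using f g by (auto simp: sq_integrable_def)
  have "(\<lambda>x. (cmod (f x + g x))\<^sup>2) absolutely_integrable_on S"
  proof (rule measurable_bounded_by_integrable_imp_absolutely_integrable[OF _ S])
    show "(\<lambda>x. (cmod (f x + g x))\<^sup>2) \<in> borel_measurable (lebesgue_on S)" by measurable
    show "(\<lambda>x. 2 * (cmod (f x))\<^sup>2 + 2 * (cmod (g x))\<^sup>2) integrable_on S"
      using f g by (auto simp: sq_integrable_def intro!: integrable_add abs_integrable_integrable)
    show "norm ((cmod (f x + g x))\<^sup>2) \<le> 2 * (cmod (f x))\<^sup>2 + 2 * (cmod (g x))\<^sup>2" for x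
      using cmod_sq_triangle[of "f x" "g x"] by simp
  qed
  then show ?thesis unfolding sq_integrable_def by (auto intro: borel_measurable_add m)
qed

lemma sets_lebesgue_intervals [simp]: "{l::real..} \<in> sets lebesgue" "{a..b::real} \<in> sets lebesgue"
  by auto

lemma absolutely_integrable_Ici_bounded:
  fixes f :: "real \<Rightarrow> real"
  assumes f: "continuous_on {l..} f" and nn: "\<And>x. l \<le> x \<Longrightarrow> 0 \<le> f x"
    and K: "\<And>b. l \<le> b \<Longrightarrow> integral {l..b} f \<le> K"
  shows "f absolutely_integrable_on {l..}"
proof (rule nonnegative_absolutely_integrable_1)
  define g where "g n x = (if x \<in> {l..l + real n} then f x else 0)" for n x
  have fi: "f integrable_on {l..b}" for b
    by (rule integrable_continuous_real) (rule continuous_on_subset[OF f], auto)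
  have sub: "{l..l + real n} \<inter> {l..} = {l..l + real n}" for n by auto
  have gi: "g n integrable_on {l..}" for n
    unfolding g_def[abs_def] using integrable_restrict_Int[of "{l..l + real n}" f "{l..}"] fi sub by simp
  have g_int: "integral {l..} (g n) = integral {l..l + real n} f" for n
    unfolding g_def[abs_def] using integral_restrict_Int[of "{l..}" "{l..l + real n}" f] sub by (simp add: Int_commute)
  have "f integrable_on {l..} \<and> (\<lambda>k. integral {l..} (g k)) \<longlonglongrightarrow> integral {l..} f"
  proof (rule monotone_convergence_increasing)
    show "g k x \<le> g (Suc k) x" if "x \<in> {l..}" for k x
      using nn that by (auto simp: g_def)
    show "(\<lambda>k. g k x) \<longlonglongrightarrow> f x" if "x \<in> {l..}" for x
    proof (rule tendsto_eventually)
      obtain N where "x - l \<le> real N" using real_arch_simple by blast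
      then have "\<forall>n\<ge>N. g n x = f x" using that by (auto simp: g_def)
      then show "\<forall>\<^sub>F n in sequentially. g n x = f x" by (auto simp: eventually_sequentially)
    qed
    show "bounded (range (\<lambda>k. integral {l..} (g k)))"
      unfolding g_int bounded_iff
    proof (intro exI[of _ "K"] ballI, clarify)
      fix n
      have "0 \<le> integral {l..l + real n} f"
        by (rule Henstock_Kurzweil_Integration.integral_nonneg[OF fi]) (use nn in auto)
      then show "norm (integral {l..l + real n} f) \<le> K" using K[of "l + real n"] by simp
    qed
  qed (rule gi)
  then show "f integrable_on {l..}" by blast
qed (use nn in auto)

lemma continuous_measurable_Ici: "continuous_on {l..} f \<Longrightarrow> (f :: real \<Rightarrow> complex) \<in> borel_measurable (lebesgue_on {l..})"
  by (simp add: continuous_imp_measurable_on_sets_lebesgue)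

lemma L2_continuousI:
  assumes "continuous_on {l..} f" "\<And>b. l \<le> b \<Longrightarrow> integral {l..b} (\<lambda>x. (cmod (f x))\<^sup>2) \<le> K"
  shows "L2 l f"
  unfolding L2_def
  by (intro conjI continuous_measurable_Ici absolutely_integrable_Ici_bounded[where K=K] continuous_intros assms) auto

lemma integral_Ici_tendsto:
  fixes f :: "real \<Rightarrow> 'a::euclidean_space"
  assumes "f absolutely_integrable_on {l..}"
  shows "((\<lambda>b. integral {l..b} f) \<longlongrightarrow> integral {l..} f) at_top"
proof -
  have i: "f absolutely_integrable_on {l..b}" for b
    using assms by (rule set_integrable_subset) auto
  have "((\<lambda>b. LINT x:{l..b}|lebesgue. f x) \<longlongrightarrow> (LINT x:{l..}|lebesgue. f x)) at_top"
    using assms by (intro tendsto_set_lebesgue_integral_at_top) auto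
  then show ?thesis
    using set_lebesgue_integral_eq_integral(2)[OF i] set_lebesgue_integral_eq_integral(2)[OF assms] by simp
qed

lemma integral_sq_mono:
  fixes f :: "real \<Rightarrow> complex"
  assumes "continuous_on {l..} f" "a \<le> b" "l \<le> a"
  shows "integral {l..a} (\<lambda>x. (cmod (f x))\<^sup>2) \<le> integral {l..b} (\<lambda>x. (cmod (f x))\<^sup>2)"
proof (rule integral_subset_le)
  have "(\<lambda>x. (cmod (f x))\<^sup>2) integrable_on {l..c}" for c
    by (intro integrable_continuous_real continuous_intros continuous_on_subset[OF assms(1)]) auto
  then show "(\<lambda>x. (cmod (f x))\<^sup>2) integrable_on {l..a}" "(\<lambda>x. (cmod (f x))\<^sup>2) integrable_on {l..b}" by auto
qed (use assms in auto)

lemma not_L2_integral_at_top: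
  assumes f: "continuous_on {l..} f" and nL2: "\<not> L2 l f"
  shows "filterlim (\<lambda>b. integral {l..b} (\<lambda>x. (cmod (f x))\<^sup>2)) at_top at_top"
  unfolding filterlim_at_top_ge[where c=0]
proof (intro allI impI)
  fix Z :: real
  obtain b where b: "l \<le> b" "Z < integral {l..b} (\<lambda>x. (cmod (f x))\<^sup>2)"
    using L2_continuousI[OF f, of Z] nL2 by force
  then have "\<forall>x\<ge>b. Z \<le> integral {l..x} (\<lambda>x. (cmod (f x))\<^sup>2)"
    using integral_sq_mono[OF f] by force
  then show "\<forall>\<^sub>F x in at_top. Z \<le> integral {l..x} (\<lambda>x. (cmod (f x))\<^sup>2)"
    by (auto simp: eventually_at_top_linorder)
qed

text \<open>
  For square integrable \<open>f\<close>, Cauchy-Schwarz gives only \<open>O\<close> of the norm of \<open>p\<close> over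
  \<open>[l, b]\<close>.  The improvement to little \<open>o\<close> comes from splitting at a fixed point \<open>n\<close>: the
  part up to \<open>n\<close> is a constant, which the divergent norm of \<open>p\<close> absorbs, and beyond \<open>n\<close> the
  norm of \<open>f\<close> is small.
\<close>

lemma integral_mult_little_o:
  assumes f: "L2 l f" and p: "continuous_on {l..} p" and nL2: "\<not> L2 l p"
  shows "((\<lambda>b. (C + integral {l..b} (\<lambda>x. f x * cnj (p x))) / of_real (sqrt (integral {l..b} (\<lambda>x. (cmod (p x))\<^sup>2))))
    \<longlongrightarrow> 0) at_top"
proof -
  define P where "P b = integral {l..b} (\<lambda>x. (cmod (p x))\<^sup>2)" for b
  define I where "I b = integral {l..b} (\<lambda>x. f x * cnj (p x))" for b
  define Q where "Q b = integral {l..b} (\<lambda>x. (cmod (f x))\<^sup>2)" for b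
  have P_top: "filterlim P at_top at_top"
    using not_L2_integral_at_top[OF p nL2] by (simp add: P_def[abs_def])
  have Q_lim: "(Q \<longlongrightarrow> integral {l..} (\<lambda>x. (cmod (f x))\<^sup>2)) at_top"
    using f integral_Ici_tendsto unfolding L2_def Q_def[abs_def] by blast
  have fs: "sq_integrable {l..} f" using f by (simp add: L2_iff_sq_integrable)
  have ps: "sq_integrable {a..b} p" if "l \<le> a" for a b
    by (rule sq_integrable_continuous) (rule continuous_on_subset[OF p], use that in auto)
  have step: "cmod (I b - I n) \<le> sqrt (Q b - Q n) * sqrt (P b)" if "l \<le> n" "n \<le> b" for n b
  proof -
    have fs': "sq_integrable {a..b} f" if "l \<le> a" for a b
      by (rule sq_integrable_subset[OF fs]) (use that in auto)
    have "I n + integral {n..b} (\<lambda>x. f x * cnj (p x)) = I b"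
      unfolding I_def by (rule Henstock_Kurzweil_Integration.integral_combine)
        (use that in \<open>auto intro!: abs_integrable_integrable sq_integrable_mult fs' ps\<close>)
    then have "cmod (I b - I n) ^ 2 = cmod (integral {n..b} (\<lambda>x. f x * cnj (p x))) ^ 2"
      by (metis add_diff_cancel_left')
    also have "\<dots> \<le> integral {n..b} (\<lambda>x. (cmod (f x))\<^sup>2) * integral {n..b} (\<lambda>x. (cmod (p x))\<^sup>2)"
      by (rule integral_Cauchy_Schwarz) (use that fs' ps in auto)
    also have "integral {n..b} (\<lambda>x. (cmod (f x))\<^sup>2) = Q b - Q n"
    proof -
      have "Q n + integral {n..b} (\<lambda>x. (cmod (f x))\<^sup>2) = Q b"
        unfolding Q_def by (rule Henstock_Kurzweil_Integration.integral_combine)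
          (use that fs'[of l b] in \<open>auto simp: sq_integrable_def intro: abs_integrable_integrable\<close>)
      then show ?thesis by simp
    qed
    also have "(Q b - Q n) * integral {n..b} (\<lambda>x. (cmod (p x))\<^sup>2) \<le> (Q b - Q n) * P b"
    proof (rule mult_left_mono)
      show "integral {n..b} (\<lambda>x. (cmod (p x))\<^sup>2) \<le> P b"
        unfolding P_def by (rule integral_subset_le)
          (use that ps[of l b] ps[of n b] in \<open>auto simp: sq_integrable_def intro: abs_integrable_integrable\<close>)
      have "Q n \<le> Q b" unfolding Q_def by (rule integral_subset_le)
          (use that fs'[of l b] fs'[of l n] in \<open>auto simp: sq_integrable_def intro: abs_integrable_integrable\<close>)
      then show "0 \<le> Q b - Q n" by simp
    qed
    finally show ?thesis
      by (simp add: real_le_rsqrt flip: real_sqrt_mult)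
  qed
  have "((\<lambda>b. (C + I b) / of_real (sqrt (P b))) \<longlongrightarrow> 0) at_top"
  proof (rule tendstoI)
    fix e :: real assume "e > 0"
    let ?L = "integral {l..} (\<lambda>x. (cmod (f x))\<^sup>2)"
    have e2: "(e/4)^2 > 0" using \<open>e > 0\<close> by simp
    have ev: "\<forall>\<^sub>F b in at_top. dist (Q b) ?L < (e/4)^2 / 2"
      using tendstoD[OF Q_lim, of "(e/4)^2 / 2"] e2 by simp
    then obtain n0 where n0: "\<And>b. b \<ge> n0 \<Longrightarrow> dist (Q b) ?L < (e/4)^2 / 2"
      by (auto simp: eventually_at_top_linorder)
    define n where "n = max l n0"
    define K where "K = cmod (C + I n)"
    have evP: "\<forall>\<^sub>F b in at_top. P b \<ge> (2 * K / e + 1)^2"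
      using P_top by (simp add: filterlim_at_top)
    have "\<forall>\<^sub>F b in at_top. b \<ge> n" by (rule eventually_ge_at_top)
    with evP show "\<forall>\<^sub>F b in at_top. dist ((C + I b) / of_real (sqrt (P b))) 0 < e"
    proof eventually_elim
      case (elim b)
      have K0: "0 \<le> K" by (simp add: K_def)
      have sP: "2 * K / e + 1 \<le> sqrt (P b)"
        using elim(1) by (rule real_le_rsqrt)
      have sP0: "0 < sqrt (P b)"
        by (rule less_le_trans[OF _ sP]) (use K0 \<open>e > 0\<close> in \<open>simp add: add_nonneg_pos\<close>)
      have "Q b - Q n < (e/4)^2"
        using n0[of b] n0[of n] elim(2) max.cobounded2[of n0 l]
        unfolding dist_real_def abs_less_iff n_def[symmetric] by linarith
      then have "sqrt (Q b - Q n) \<le> e / 4"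
        using \<open>e > 0\<close> by (intro real_le_lsqrt) auto
      then have "sqrt (Q b - Q n) * sqrt (P b) \<le> e / 4 * sqrt (P b)"
        by (rule mult_right_mono) (use sP0 in simp)
      moreover have "cmod (I b - I n) \<le> sqrt (Q b - Q n) * sqrt (P b)"
        by (rule step) (use elim in \<open>auto simp: n_def\<close>)
      ultimately have "cmod (I b - I n) \<le> e / 4 * sqrt (P b)"
        by linarith
      moreover have "K \<le> e / 2 * sqrt (P b)"
      proof -
        have "K \<le> e / 2 * (2 * K / e + 1)" using \<open>e > 0\<close> by (simp add: field_simps)
        also have "\<dots> \<le> e / 2 * sqrt (P b)" using sP \<open>e > 0\<close> by (intro mult_left_mono) auto
        finally show ?thesis .
      qed
      moreover have "cmod (C + I b) \<le> K + cmod (I b - I n)"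
        unfolding K_def using norm_triangle_ineq[of "C + I n" "I b - I n"] by simp
      ultimately have "cmod (C + I b) \<le> 3 / 4 * e * sqrt (P b)" by simp
      also have "\<dots> < e * sqrt (P b)" using \<open>e > 0\<close> sP0 by simp
      finally show ?case
        using sP0 by (simp add: norm_divide divide_less_eq)
    qed
  qed
  then show ?thesis by (simp add: I_def P_def)
qed

section \<open>The limit point property\<close>

definition bracket :: "real \<Rightarrow> (real \<Rightarrow> complex) \<Rightarrow> (real \<Rightarrow> complex) \<Rightarrow> real \<Rightarrow> complex" where
  "bracket l y w x = y x * cnj (deriv1 l w x) - deriv1 l y x * cnj (w x)"

lemma regular_continuous:
  assumes "regular l y"
  shows "continuous_on {l..} y" "continuous_on {l..} (deriv1 l y)"
  using regularD[OF assms] ac_density_continuous_on by blast+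

lemma bracket_density:
  assumes y: "regular l y" and w: "regular l w"
  shows "ac_density_of l (bracket l y w)
    (\<lambda>x. diff_expr l q y x * cnj (w x) - y x * cnj (diff_expr l q w x))"
proof -
  note Y = regularD[OF y] and W = regularD[OF w]
  have "ac_density_of l (\<lambda>x. 1 * (y x * cnj (deriv1 l w x)) + (-1) * (deriv1 l y x * cnj (w x)))
     (\<lambda>x. 1 * (deriv1 l y x * cnj (deriv1 l w x) + y x * cnj (ae_deriv l (deriv1 l w) x)) +
       (-1) * (ae_deriv l (deriv1 l y) x * cnj (w x) + deriv1 l y x * cnj (deriv1 l w x)))"
    by (intro ac_density_lincomb ac_density_mult ac_density_cnj Y W)
  also have "(\<lambda>x. 1 * (y x * cnj (deriv1 l w x)) + (-1) * (deriv1 l y x * cnj (w x))) = bracket l y w"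
    by (auto simp: bracket_def)
  also have "(\<lambda>x. 1 * (deriv1 l y x * cnj (deriv1 l w x) + y x * cnj (ae_deriv l (deriv1 l w) x)) +
       (-1) * (ae_deriv l (deriv1 l y) x * cnj (w x) + deriv1 l y x * cnj (deriv1 l w x))) =
     (\<lambda>x. diff_expr l q y x * cnj (w x) - y x * cnj (diff_expr l q w x))"
    by (auto simp: diff_expr_def algebra_simps)
  finally show ?thesis .
qed

lemma bracket_density_solves:
  assumes y: "regular l y" and w: "solves l q z w"
  shows "ac_density_of l (bracket l y w) (\<lambda>x. (diff_expr l q y x - cnj z * y x) * cnj (w x))"
proof (rule ac_density_cong_AE[OF bracket_density[OF y]])
  show "regular l w" using w by (simp add: solves_def)
  from w have "AE x in lebesgue. l \<le> x \<longrightarrow> diff_expr l q w x = z * w x" by (simp add: solves_def)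
  then show "AE x in lebesgue. l \<le> x \<longrightarrow> (diff_expr l q y x - cnj z * y x) * cnj (w x) =
      diff_expr l q y x * cnj (w x) - y x * cnj (diff_expr l q w x)"
    by eventually_elim (auto simp: algebra_simps)
qed

text \<open>
  For a solution at \<open>z\<close> the bracket with itself measures the norm: its density is
  \<open>(z - cnj z) * \<bar>y\<bar>\<^sup>2\<close>.
\<close>

lemma bracket_self_solves:
  assumes "solves l q z y" "l \<le> x"
  shows "bracket l y y x = bracket l y y l + 2 * \<i> * of_real (Im z * integral {l..x} (\<lambda>t. (cmod (y t))\<^sup>2))"
proof -
  have r: "regular l y" using assms by (simp add: solves_def)
  from assms have AE: "AE x in lebesgue. l \<le> x \<longrightarrow> diff_expr l q y x = z * y x" by (simp add: solves_def)
  have "ac_density_of l (bracket l y y) (\<lambda>x. (2 * \<i> * of_real (Im z)) * of_real ((cmod (y x))\<^sup>2))"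
  proof (rule ac_density_cong_AE[OF bracket_density_solves[OF r assms(1)]])
    show "AE x in lebesgue. l \<le> x \<longrightarrow> (2 * \<i> * of_real (Im z)) * of_real ((cmod (y x))\<^sup>2) = (diff_expr l q y x - cnj z * y x) * cnj (y x)"
      using AE
    proof eventually_elim
      case (elim x)
      have "z - cnj z = 2 * \<i> * of_real (Im z)" by (simp add: complex_eq_iff)
      then show ?case using elim complex_norm_square[of "y x"] by (auto simp flip: left_diff_distrib)
    qed
  qed
  from ac_density_integral[OF this assms(2)]
  have "bracket l y y x = bracket l y y l + (2 * \<i> * of_real (Im z)) * integral {l..x} (\<lambda>x. complex_of_real ((cmod (y x))\<^sup>2))"
    by simp
  also have "integral {l..x} (\<lambda>x. complex_of_real ((cmod (y x))\<^sup>2)) = of_real (integral {l..x} (\<lambda>x. (cmod (y x))\<^sup>2))"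
  proof -
    have "(\<lambda>x. (cmod (y x))\<^sup>2) integrable_on {l..x}"
      by (intro integrable_continuous_real continuous_intros continuous_on_subset[OF regular_continuous(1)[OF r]]) auto
    from integral_linear[OF this bounded_linear_of_real[where 'a=complex]] show ?thesis by (simp add: o_def)
  qed
  finally show ?thesis by simp
qed

lemma L2_diff_expr_sub:
  assumes "y \<in> Dstar l q"
  shows "L2 l (\<lambda>x. diff_expr l q y x - c * y x)"
proof -
  have "sq_integrable {l..} (\<lambda>x. diff_expr l q y x + (-c) * y x)"
    using assms by (intro sq_integrable_add sq_integrable_cmult) (auto simp: Dstar_def L2_iff_sq_integrable)
  then show ?thesis by (simp add: L2_iff_sq_integrable)
qed

lemma solves_cnj:
  assumes "solves l q z y"
  shows "solves l q (cnj z) (\<lambda>x. cnj (y x))" "\<And>x. l \<le> x \<Longrightarrow> deriv1 l (\<lambda>x. cnj (y x)) x = cnj (deriv1 l y x)"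
proof -
  have "solution_pair l q (cnj z) (\<lambda>x. cnj (y x)) (\<lambda>x. cnj (deriv1 l y x))"
    using ac_density_cnj[of l y] ac_density_cnj[of l "deriv1 l y"] solves_imp_solution_pair[OF assms]
    unfolding solution_pair_def by fastforce
  from solution_pair_imp_solves[OF this]
  show "solves l q (cnj z) (\<lambda>x. cnj (y x))" "\<And>x. l \<le> x \<Longrightarrow> deriv1 l (\<lambda>x. cnj (y x)) x = cnj (deriv1 l y x)" .
qed

lemma L2_cnj: "L2 l (\<lambda>x. cnj (f x)) \<longleftrightarrow> L2 l f"
proof -
  have "L2 l (\<lambda>x. cnj (f x))" if "L2 l f" for f
    using that unfolding L2_def by (auto intro: measurable_compose[OF _ borel_measurable_cnj])
  from this[of f] this[of "\<lambda>x. cnj (f x)"] show ?thesis by auto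
qed

text \<open>
  The values \<open>(y, y')\<close> and \<open>(w, w')\<close> at a point are vectors of a two-dimensional space with an
  indefinite hermitian form, the bracket.  The Gram determinant of such vectors against \<open>(p, p')\<close>
  factors into the two Wronskians with \<open>p\<close>, that is, into brackets with the conjugate solution
  \<open>p'\<close>; hence \<open>{y,w} {p,p} = {y,p} {p,w} + {y,p'} cnj {w,p'}\<close>.  Since \<open>p\<close> solves the
  equation at \<open>\<i>\<close> and \<open>p'\<close> the one at \<open>- \<i>\<close>, the four brackets on the right are
  constants plus integrals of a square integrable function against \<open>p\<close> or \<open>p'\<close>, so they are
  \<open>o(sqrt P)\<close> with \<open>P\<close> the squared norm of \<open>p\<close> up to \<open>x\<close>.  The factor \<open>{p,p}\<close>
  grows like \<open>2 * \<i> * P\<close>, and \<open>P\<close> is unbounded.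
\<close>

lemma bracket_tendsto_zero:
  assumes p: "solves l q \<i> p" and nL2: "\<not> L2 l p"
    and y: "y \<in> Dstar l q" and w: "w \<in> Dstar l q"
  shows "(bracket l y w \<longlongrightarrow> 0) at_top"
proof -
  define P where "P x = integral {l..x} (\<lambda>x. (cmod (p x))\<^sup>2)" for x
  define p' where "p' x = cnj (p x)" for x
  have rp: "regular l p" using p by (simp add: solves_def)
  have P_top: "filterlim P at_top at_top"
    using not_L2_integral_at_top[OF regular_continuous(1)[OF rp] nL2] by (simp add: P_def[abs_def])
  have small: "((\<lambda>x. bracket l u v x / of_real (sqrt (P x))) \<longlongrightarrow> 0) at_top"
    if u: "u \<in> Dstar l q" and v: "solves l q z v" "\<not> L2 l v" and P: "\<And>x. cmod (v x) = cmod (p x)" for u v z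
  proof -
    have ru: "regular l u" using u by (simp add: Dstar_def)
    have cv: "continuous_on {l..} v" using v regular_continuous(1) by (auto simp: solves_def)
    from integral_mult_little_o[OF L2_diff_expr_sub[OF u] cv v(2), of "bracket l u v l" "cnj z"]
    have "((\<lambda>x. (bracket l u v l + integral {l..x} (\<lambda>x. (diff_expr l q u x - cnj z * u x) * cnj (v x)))
        / of_real (sqrt (P x))) \<longlongrightarrow> 0) at_top"
      by (simp add: P_def P)
    moreover have "\<forall>\<^sub>F x in at_top. (bracket l u v l + integral {l..x} (\<lambda>x. (diff_expr l q u x - cnj z * u x) * cnj (v x))) / of_real (sqrt (P x))
        = bracket l u v x / of_real (sqrt (P x))"
      using eventually_ge_at_top[of l]
    proof eventually_elim
      case (elim x)
      show ?case unfolding ac_density_integral[OF bracket_density_solves[OF ru v(1)] elim] by simp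
    qed
    ultimately show ?thesis by (rule Lim_transform_eventually)
  qed
  have p': "solves l q (cnj \<i>) p'" "\<not> L2 l p'" 
    using solves_cnj[OF p] nL2 L2_cnj[of l p] by (auto simp: p'_def[abs_def])
  have small1: "((\<lambda>x. bracket l u p x / of_real (sqrt (P x))) \<longlongrightarrow> 0) at_top" if "u \<in> Dstar l q" for u
    by (rule small[OF that p nL2]) simp
  have small2: "((\<lambda>x. bracket l u p' x / of_real (sqrt (P x))) \<longlongrightarrow> 0) at_top" if "u \<in> Dstar l q" for u
    by (rule small[OF that p']) (simp add: p'_def)
  have ev: "\<forall>\<^sub>F x in at_top. 1 \<le> P x" using P_top by (simp add: filterlim_at_top)
  have lim_pp: "((\<lambda>x. bracket l p p x / of_real (P x)) \<longlongrightarrow> 2 * \<i>) at_top"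
  proof -
    have "filterlim (\<lambda>x. complex_of_real (P x)) at_infinity at_top"
      using P_top by (rule filterlim_compose[OF filterlim_of_real_at_infinity])
    then have "((\<lambda>x. bracket l p p l / of_real (P x) + 2 * \<i>) \<longlongrightarrow> 0 + 2 * \<i>) at_top"
      by (intro tendsto_intros tendsto_divide_0[OF tendsto_const])
    moreover have "\<forall>\<^sub>F x in at_top. bracket l p p l / of_real (P x) + 2 * \<i> = bracket l p p x / of_real (P x)"
      using ev eventually_ge_at_top[of l]
    proof eventually_elim
      case (elim x)
      show ?case unfolding bracket_self_solves[OF p elim(2)] P_def[symmetric]
        using elim(1) by (simp add: field_simps)
    qed
    ultimately show ?thesis by (simp add: Lim_transform_eventually)
  qed
  have ev_pp: "\<forall>\<^sub>F x in at_top. bracket l p p x / of_real (P x) \<noteq> 0"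
    by (rule tendsto_imp_eventually_ne[OF lim_pp]) simp
  let ?s = "\<lambda>x. complex_of_real (sqrt (P x))"
  have "((\<lambda>x. ((bracket l y p x / ?s x) * (- cnj (bracket l w p x / ?s x))
      + (bracket l y p' x / ?s x) * cnj (bracket l w p' x / ?s x)) / (bracket l p p x / of_real (P x)))
      \<longlongrightarrow> (0 * (- cnj 0) + 0 * cnj 0) / (2 * \<i>)) at_top"
    by (intro tendsto_intros small1 small2 y w lim_pp) auto
  moreover have "\<forall>\<^sub>F x in at_top. ((bracket l y p x / ?s x) * (- cnj (bracket l w p x / ?s x))
      + (bracket l y p' x / ?s x) * cnj (bracket l w p' x / ?s x)) / (bracket l p p x / of_real (P x)) = bracket l y w x"
    using ev eventually_ge_at_top[of l] ev_pp
  proof eventually_elim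
    case (elim x)
    have ss: "?s x * ?s x = of_real (P x)"
      using elim by (simp flip: of_real_mult)
    have P0: "complex_of_real (P x) \<noteq> 0" "?s x \<noteq> 0" using elim by auto
    have id: "bracket l y w x * bracket l p p x = bracket l y p x * (- cnj (bracket l w p x)) + bracket l y p' x * cnj (bracket l w p' x)"
      using solves_cnj(2)[OF p elim(2)] unfolding p'_def bracket_def by (simp add: algebra_simps)
    have "(bracket l y p x / ?s x) * (- cnj (bracket l w p x / ?s x)) + (bracket l y p' x / ?s x) * cnj (bracket l w p' x / ?s x)
      = (bracket l y p x * (- cnj (bracket l w p x)) + bracket l y p' x * cnj (bracket l w p' x)) / (?s x * ?s x)"
      using P0 by (simp add: field_simps)
    also have "\<dots> = bracket l y w x * (bracket l p p x / of_real (P x))"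
      unfolding ss id[symmetric] by simp
    finally show ?case using elim(3) by simp
  qed
  ultimately show ?thesis by (simp add: Lim_transform_eventually)
qed

lemma solves_ex:
  assumes "loc_integrable l q"
  obtains y where "solves l q z y" "y l = al" "deriv1 l y l = be"
  using initial_value_problem_ex[OF assms, of z al be] solution_pair_imp_solves by (metis order_refl)

lemma solves_lincomb:
  assumes "solves l q z f" "solves l q z g"
  shows "solves l q z (\<lambda>x. a * f x + b * g x)"
    "\<And>x. l \<le> x \<Longrightarrow> deriv1 l (\<lambda>x. a * f x + b * g x) x = a * deriv1 l f x + b * deriv1 l g x"
  using solution_pair_imp_solves[OF solution_pair_lincomb[OF assms[THEN solves_imp_solution_pair]]] by auto

text \<open>
  Being in the maximal domain requires the image under the differential expression to be square
  integrable, and for a solution the image is almost everywhere a multiple of the function.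
\<close>

lemma solves_L2_imp_Dstar:
  assumes "solves l q z y" "L2 l y"
  shows "y \<in> Dstar l q"
proof -
  have AE: "AE x in lebesgue. x \<in> {l..} \<longrightarrow> z * y x = diff_expr l q y x"
    using assms(1) unfolding solves_def by (auto elim: eventually_mono)
  have "sq_integrable {l..} (diff_expr l q y)"
    by (rule sq_integrable_cong_AE[OF _ sq_integrable_cmult AE]) (use assms in \<open>auto simp: L2_iff_sq_integrable\<close>)
  then show ?thesis using assms by (simp add: Dstar_def solves_def L2_iff_sq_integrable)
qed

text \<open>
  Were both standard solutions at \<open>\<i>\<close> square integrable, they would span a two-dimensional
  defect space; so one of them is a solution as required by \<open>bracket_tendsto_zero\<close>.
\<close>

lemma deficiency_imp_limit_point:
  assumes q: "loc_integrable l q" and def: "deficiency_indices_1_1 l q"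
    and y: "y \<in> Dstar l q" and w: "w \<in> Dstar l q"
  shows "(bracket l y w \<longlongrightarrow> 0) at_top"
proof -
  obtain p1 where p1: "solves l q \<i> p1" "p1 l = 0" "deriv1 l p1 l = 1" by (rule solves_ex[OF q])
  obtain p2 where p2: "solves l q \<i> p2" "p2 l = -1" "deriv1 l p2 l = 0" by (rule solves_ex[OF q])
  have "\<not> (L2 l p1 \<and> L2 l p2)"
  proof
    assume L2: "L2 l p1 \<and> L2 l p2"
    then have "p1 \<in> defect_space l q \<i>" "p2 \<in> defect_space l q \<i>"
      using p1 p2 by (auto simp: defect_space_def intro: solves_L2_imp_Dstar)
    then obtain g c1 c2 where g: "\<And>x. l \<le> x \<Longrightarrow> p1 x = c1 * g x" "\<And>x. l \<le> x \<Longrightarrow> p2 x = c2 * g x"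
      using def unfolding deficiency_indices_1_1_def one_dimensional_def by metis
    have "c1 = 0" using g[of l] p1 p2 by auto
    then have 0: "\<And>x. l \<le> x \<Longrightarrow> p1 x = 0" using g by simp
    have "deriv1 l p1 l = 0"
    proof -
      have "ac_density_of l p1 (\<lambda>x. 0)" "ac_density_of l (\<lambda>x. 0) (\<lambda>x. 0)"
        using 0 by (auto simp: ac_density_of_def loc_integrable_def)
      from regularI(2)[OF this] show ?thesis by simp
    qed
    then show False using p1 by simp
  qed
  then show ?thesis using bracket_tendsto_zero[OF p1(1) _ y w] bracket_tendsto_zero[OF p2(1) _ y w] by blast
qed

section \<open>The Weyl solution and the Weyl function\<close>

lemma cmod_sq_integrable_on: "sq_integrable S f \<Longrightarrow> (\<lambda>x. (cmod (f x))\<^sup>2) integrable_on S"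
  unfolding sq_integrable_def by (blast intro: abs_integrable_integrable)

lemma integral_cmod_sq_triangle:
  assumes "sq_integrable {a..b} f" "sq_integrable {a..b} g"
  shows "integral {a..b} (\<lambda>x. (cmod (f x + g x))\<^sup>2)
    \<le> 2 * integral {a..b} (\<lambda>x. (cmod (f x))\<^sup>2) + 2 * integral {a..b} (\<lambda>x. (cmod (g x))\<^sup>2)"
proof -
  note i = cmod_sq_integrable_on[OF assms(1)] cmod_sq_integrable_on[OF assms(2)]
  have "integral {a..b} (\<lambda>x. (cmod (f x + g x))\<^sup>2) \<le> integral {a..b} (\<lambda>x. 2 * (cmod (f x))\<^sup>2 + 2 * (cmod (g x))\<^sup>2)"
    by (intro integral_le cmod_sq_integrable_on sq_integrable_add assms integrable_add integrable_on_mult_right i cmod_sq_triangle) auto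
  also have "\<dots> = 2 * integral {a..b} (\<lambda>x. (cmod (f x))\<^sup>2) + 2 * integral {a..b} (\<lambda>x. (cmod (g x))\<^sup>2)"
    by (intro integral_unique has_integral_add has_integral_mult_right integrable_integral i)
  finally show ?thesis .
qed

text \<open>
  If the solution vanished on \<open>[l, b]\<close>, its derivative would have density \<open>0\<close> there and stay
  equal to \<open>1\<close>.
\<close>

lemma dirichlet_solution_pos:
  assumes p: "solves l q z p" "p l = 0" "deriv1 l p l = 1" and b: "l < b"
  shows "0 < integral {l..b} (\<lambda>x. (cmod (p x))\<^sup>2)"
proof -
  have r: "regular l p" using p by (simp add: solves_def)
  have c: "continuous_on {l..b} (\<lambda>x. (cmod (p x))\<^sup>2)"
    by (intro continuous_intros continuous_on_subset[OF regular_continuous(1)[OF r]]) auto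
  have "integral {l..b} (\<lambda>x. (cmod (p x))\<^sup>2) \<noteq> 0"
  proof
    assume "integral {l..b} (\<lambda>x. (cmod (p x))\<^sup>2) = 0"
    then have 0: "p x = 0" if "x \<in> {l..b}" for x
      using integral_eq_0_iff[OF c b] that by simp
    have s: "ac_density_of l p (deriv1 l p)" "ac_density_of l (deriv1 l p) (\<lambda>x. (of_real (q x) - z) * p x)"
      using solves_imp_solution_pair[OF p(1)] by (auto simp: solution_pair_def)
    have 1: "deriv1 l p x = 1" if "x \<in> {l..b}" for x
    proof -
      have "integral {l..x} (\<lambda>x. (of_real (q x) - z) * p x) = integral {l..x} (\<lambda>x. 0)"
        by (rule integral_cong) (use 0 that in auto)
      then show ?thesis using ac_density_integral[OF s(2), of x] that p(3) by simp
    qed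
    have "integral {l..b} (deriv1 l p) = integral {l..b} (\<lambda>x. 1)"
      by (rule integral_cong) (use 1 in auto)
    then have "p b = of_real (b - l)"
      using ac_density_integral[OF s(1), of b] b p(2) by (simp add: scaleR_conv_of_real)
    then show False using 0[of b] b by simp
  qed
  moreover have "0 \<le> integral {l..b} (\<lambda>x. (cmod (p x))\<^sup>2)"
    by (rule Henstock_Kurzweil_Integration.integral_nonneg[OF integrable_continuous_real[OF c]]) auto
  ultimately show ?thesis by simp
qed

text \<open>
  Weyl's nested discs in a compactness form.  The solution \<open>p2 + m * p1\<close> which vanishes at \<open>b\<close>
  has zero bracket there, and comparison with its bracket at \<open>l\<close> bounds its norm on \<open>[l, b]\<close> by
  \<open>\<bar>Im m / Im z\<bar>\<close>.  On the fixed interval \<open>[l, l + 1]\<close> this inequality is quadratic in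
  \<open>m\<close> on one side and linear on the other, so the numbers \<open>m\<close> stay bounded as \<open>b\<close> grows,
  and any of their limit points gives a square integrable solution.
\<close>

lemma weyl_solution_ex:
  assumes q: "loc_integrable l q" and z: "Im z \<noteq> 0"
  shows "\<exists>y. solves l q z y \<and> L2 l y \<and> y l = -1"
proof -
  obtain p1 where p1: "solves l q z p1" "p1 l = 0" "deriv1 l p1 l = 1" by (rule solves_ex[OF q])
  obtain p2 where p2: "solves l q z p2" "p2 l = -1" "deriv1 l p2 l = 0" by (rule solves_ex[OF q])
  define y where "y m x = p2 x + m * p1 x" for m x
  have y: "solves l q z (y m)" "y m l = -1" "deriv1 l (y m) l = m" for m
    using solves_lincomb[OF p2(1) p1(1), where a=1 and b=m] p1 p2 by (auto simp: y_def[abs_def])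
  define I where "I u b = integral {l..b} (\<lambda>x. (cmod (u x))\<^sup>2)" for u b
  have cont: "continuous_on {l..} u" if "solves l q z u" for u
    using that regular_continuous by (auto simp: solves_def)
  have sq: "sq_integrable {l..b} u" if "solves l q z u" for u b
    by (rule sq_integrable_continuous) (rule continuous_on_subset[OF cont[OF that]], auto)
  have I_nonneg: "0 \<le> I u b" if "solves l q z u" for u b
    unfolding I_def by (rule Henstock_Kurzweil_Integration.integral_nonneg[OF cmod_sq_integrable_on[OF sq[OF that]]]) auto
  have I_mono: "I u a \<le> I u b" if "solves l q z u" "l \<le> a" "a \<le> b" for u a b
    unfolding I_def by (rule integral_sq_mono[OF cont[OF that(1)]]) (use that in auto)
  \<comment> \<open>A nonreal number is not an eigenvalue of the Dirichlet problem on a bounded interval.\<close>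
  have p1_nz: "p1 b \<noteq> 0" if "l < b" for b
  proof
    assume "p1 b = 0"
    then have "bracket l p1 p1 b = 0" by (simp add: bracket_def)
    with bracket_self_solves[OF p1(1), of b] that p1(2) z have "I p1 b = 0"
      by (simp add: bracket_def I_def)
    with dirichlet_solution_pos[OF p1 that] show False by (simp add: I_def)
  qed
  \<comment> \<open>The right endpoints start at l + 1 so that all intervals contain the one used for the bound on m.\<close>
  define b where "b n = l + 1 + real n" for n
  define m where "m n = - p2 (b n) / p1 (b n)" for n
  have lb: "l < b n" "l + 1 \<le> b n" for n by (auto simp: b_def)
  have Im_m: "\<bar>Im z\<bar> * I (y (m n)) (b n) \<le> cmod (m n)" for n
  proof -
    have "y (m n) (b n) = 0" using p1_nz[OF lb(1)[of n]] by (simp add: y_def m_def)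
    then have "bracket l (y (m n)) (y (m n)) (b n) = 0" by (simp add: bracket_def)
    moreover have "bracket l (y (m n)) (y (m n)) l = 2 * \<i> * of_real (Im (m n))"
      using y[of "m n"] by (simp add: bracket_def complex_eq_iff)
    ultimately have "Im (m n) + Im z * I (y (m n)) (b n) = 0"
      using bracket_self_solves[OF y(1)[of "m n"], of "b n"] lb[of n] unfolding I_def
      by (simp add: complex_eq_iff)
    then have "\<bar>Im z\<bar> * I (y (m n)) (b n) = \<bar>Im (m n)\<bar>"
      using I_nonneg[OF y(1)[of "m n"], of "b n"] by (metis abs_minus_cancel abs_mult abs_of_nonneg add_eq_0_iff)
    then show ?thesis using abs_Im_le_cmod[of "m n"] by simp
  qed
  define al where "al = I p1 (l + 1)"
  define be where "be = I p2 (l + 1)"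
  have al: "al > 0" using dirichlet_solution_pos[OF p1, of "l + 1"] by (simp add: al_def I_def)
  have be: "be \<ge> 0" using I_nonneg[OF p2(1)] by (simp add: be_def)
  define K where "K = (2 / \<bar>Im z\<bar> + 2 * be) / al + 1"
  have m_bound: "cmod (m n) \<le> K" for n
  proof (cases "cmod (m n) \<le> 1")
    case True
    then show ?thesis using al be z by (simp add: K_def add_increasing)
  next
    case False
    have "(cmod (m n))\<^sup>2 * al = I (\<lambda>x. m n * p1 x) (l + 1)"
      by (simp add: al_def I_def norm_mult power_mult_distrib)
    also have "(\<lambda>x. m n * p1 x) = (\<lambda>x. y (m n) x + (-1) * p2 x)"
      by (auto simp: y_def)
    also have "I \<dots> (l + 1) \<le> 2 * I (y (m n)) (l + 1) + 2 * I (\<lambda>x. (-1) * p2 x) (l + 1)"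
      unfolding I_def by (intro integral_cmod_sq_triangle sq_integrable_cmult sq y p2)
    also have "I (\<lambda>x. (-1) * p2 x) (l + 1) = be"
      by (simp add: be_def I_def)
    also have "I (y (m n)) (l + 1) \<le> cmod (m n) / \<bar>Im z\<bar>"
    proof -
      have "I (y (m n)) (l + 1) \<le> I (y (m n)) (b n)"
        using I_mono[OF y(1)] lb by simp
      also have "\<dots> \<le> cmod (m n) / \<bar>Im z\<bar>"
        using Im_m[of n] z by (simp add: field_simps)
      finally show ?thesis .
    qed
    finally have "(cmod (m n))\<^sup>2 * al \<le> 2 * (cmod (m n) / \<bar>Im z\<bar>) + 2 * be" by simp
    also have "\<dots> \<le> 2 * (cmod (m n) / \<bar>Im z\<bar>) + 2 * be * cmod (m n)"
      using False be mult_left_mono[of 1 "cmod (m n)" "2 * be"] by simp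
    also have "\<dots> = cmod (m n) * (2 / \<bar>Im z\<bar> + 2 * be)" by (simp add: algebra_simps)
    finally have "cmod (m n) * (cmod (m n) * al) \<le> cmod (m n) * (2 / \<bar>Im z\<bar> + 2 * be)"
      by (simp add: power2_eq_square mult.assoc)
    then have "cmod (m n) * al \<le> 2 / \<bar>Im z\<bar> + 2 * be"
      using False by (subst (asm) mult_le_cancel_left_pos) auto
    then show ?thesis using al by (simp add: K_def field_simps)
  qed
  obtain M r where r: "strict_mono (r :: nat \<Rightarrow> nat)" and lim: "(m \<circ> r) \<longlonglongrightarrow> M"
    using compact_cball[of "0::complex" K] m_bound unfolding compact_def
    by (metis dist_0_norm mem_cball)
  have "I (y M) x \<le> 2 * (K / \<bar>Im z\<bar>) + 2" if x: "l \<le> x" for x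
  proof -
    have "(\<lambda>n. (cmod (M - m (r n)))\<^sup>2 * I p1 x) \<longlonglongrightarrow> (cmod (M - M))\<^sup>2 * I p1 x"
      using lim by (intro tendsto_intros) (simp add: o_def)
    then have "\<forall>\<^sub>F n in sequentially. (cmod (M - m (r n)))\<^sup>2 * I p1 x < 1"
      by (rule order_tendstoD) simp
    moreover obtain n0 where n0: "x - l \<le> real n0" using real_arch_simple by blast
    have "\<forall>\<^sub>F n in sequentially. x \<le> b (r n)"
      using eventually_ge_at_top[of n0]
    proof eventually_elim
      case (elim n)
      have "real n0 \<le> real (r n)" using elim seq_suble[OF r, of n] by simp
      then show ?case using n0 by (simp add: b_def)
    qed
    ultimately have "\<forall>\<^sub>F n in sequentially. (cmod (M - m (r n)))\<^sup>2 * I p1 x < 1 \<and> x \<le> b (r n)"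
      by (rule eventually_conj)
    then obtain n where n: "(cmod (M - m (r n)))\<^sup>2 * I p1 x < 1" "x \<le> b (r n)"
      unfolding eventually_sequentially by blast
    have eq: "y M = (\<lambda>x. y (m (r n)) x + (M - m (r n)) * p1 x)"
      by (auto simp: y_def algebra_simps)
    have "I (y M) x \<le> 2 * I (y (m (r n))) x + 2 * I (\<lambda>x. (M - m (r n)) * p1 x) x"
      unfolding I_def eq by (intro integral_cmod_sq_triangle sq_integrable_cmult sq y p1)
    also have "I (\<lambda>x. (M - m (r n)) * p1 x) x = (cmod (M - m (r n)))\<^sup>2 * I p1 x"
      by (simp add: I_def norm_mult power_mult_distrib)
    also have "I (y (m (r n))) x \<le> K / \<bar>Im z\<bar>"
    proof -
      have "I (y (m (r n))) x \<le> I (y (m (r n))) (b (r n))"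
        using I_mono[OF y(1) x n(2)] .
      also have "\<dots> \<le> K / \<bar>Im z\<bar>"
        using order_trans[OF Im_m[of "r n"] m_bound[of "r n"]] z by (simp add: field_simps)
      finally show ?thesis .
    qed
    finally show ?thesis using n by simp
  qed
  then have "L2 l (y M)"
    unfolding I_def by (rule L2_continuousI[OF cont[OF y(1)]])
  then show ?thesis using y[of M] by blast
qed

lemma ip_L2:
  assumes "L2 l f" "L2 l g"
  shows "(\<lambda>x. f x * cnj (g x)) absolutely_integrable_on {l..}"
  using assms sq_integrable_mult[of "{l..}"] by (simp add: L2_iff_sq_integrable)

lemma ip_cnj: "cnj (ip l f g) = ip l g f"
  unfolding ip_def by (simp add: Henstock_Kurzweil_Integration.integral_cnj mult.commute)

lemma ip_solves_left:
  assumes "solves l q z y"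
  shows "ip l (diff_expr l q y) w = z * ip l y w"
proof -
  have "AE x in lebesgue. l \<le> x \<longrightarrow> diff_expr l q y x = z * y x"
    using assms by (simp add: solves_def)
  then obtain N where N: "negligible N" "\<And>x. x \<notin> N \<Longrightarrow> l \<le> x \<longrightarrow> diff_expr l q y x = z * y x"
    by (rule AE_on_negligibleE) blast
  have "ip l (diff_expr l q y) w = integral {l..} (\<lambda>x. z * (y x * cnj (w x)))"
    unfolding ip_def by (rule integral_spike[OF N(1)]) (use N(2) in auto)
  then show ?thesis by (simp add: ip_def)
qed

locale limit_point =
  fixes l :: real and q :: "real \<Rightarrow> real"
  assumes loc_int: "loc_integrable l q"
    and bracket_lim: "\<And>y w. y \<in> Dstar l q \<Longrightarrow> w \<in> Dstar l q \<Longrightarrow> (bracket l y w \<longlongrightarrow> 0) at_top"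
begin

text \<open>
  Integration by parts twice; the boundary term at infinity is what the limit point property removes.
\<close>

lemma lagrange_identity:
  assumes y: "y \<in> Dstar l q" and w: "w \<in> Dstar l q"
  shows "ip l (diff_expr l q y) w - cnj (ip l (diff_expr l q w) y) = - bracket l y w l"
proof -
  define F where "F x = diff_expr l q y x * cnj (w x) - y x * cnj (diff_expr l q w x)" for x
  have L: "L2 l y" "L2 l (diff_expr l q y)" "L2 l w" "L2 l (diff_expr l q w)" "regular l y" "regular l w"
    using y w by (auto simp: Dstar_def)
  note i1 = ip_L2[OF L(2) L(3)] and i2 = ip_L2[OF L(1) L(4)]
  have F: "F absolutely_integrable_on {l..}"
    unfolding F_def[abs_def] by (rule set_integral_diff(1)[OF i1 i2])
  have "((\<lambda>x. bracket l y w l + integral {l..x} F) \<longlongrightarrow> bracket l y w l + integral {l..} F) at_top"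
    by (intro tendsto_intros integral_Ici_tendsto F)
  moreover have "\<forall>\<^sub>F x in at_top. bracket l y w l + integral {l..x} F = bracket l y w x"
    using eventually_ge_at_top[of l]
  proof eventually_elim
    case (elim x)
    show ?case
      unfolding ac_density_integral[OF bracket_density[OF L(5,6), of q] elim] F_def[abs_def] ..
  qed
  ultimately have "(bracket l y w \<longlongrightarrow> bracket l y w l + integral {l..} F) at_top"
    by (rule Lim_transform_eventually)
  then have "bracket l y w l + integral {l..} F = 0"
    using bracket_lim[OF y w] by (rule tendsto_unique[rotated]) simp
  moreover have "integral {l..} F = ip l (diff_expr l q y) w - ip l y (diff_expr l q w)"
    unfolding F_def[abs_def] ip_def
    by (intro Henstock_Kurzweil_Integration.integral_diff abs_integrable_integrable i1 i2)
  ultimately show ?thesis unfolding ip_cnj by (simp add: eq_neg_iff_add_eq_0 add.commute)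
qed

text \<open>
  A function on the half-line is determined only there, hence the choice among the representatives.
\<close>

definition weyl :: "complex \<Rightarrow> real \<Rightarrow> complex" where
  "weyl z = (SOME y. solves l q z y \<and> L2 l y \<and> y l = -1)"

lemma weyl:
  assumes "Im z \<noteq> 0"
  shows "solves l q z (weyl z)" "L2 l (weyl z)" "weyl z l = -1" "weyl z \<in> Dstar l q"
proof -
  have "solves l q z (weyl z) \<and> L2 l (weyl z) \<and> weyl z l = -1"
    unfolding weyl_def by (rule someI_ex[OF weyl_solution_ex[OF loc_int assms]])
  then show "solves l q z (weyl z)" "L2 l (weyl z)" "weyl z l = -1" "weyl z \<in> Dstar l q"
    using solves_L2_imp_Dstar by auto
qed

text \<open>
  Lagrange's identity for two square integrable solutions, at possibly different spectral parameters,
  with the boundary value \<open>- 1\<close> at \<open>l\<close>.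
\<close>

lemma ip_solutions:
  assumes y: "solves l q z y" "L2 l y" "y l = -1" and w: "solves l q z' w" "L2 l w" "w l = -1"
  shows "(z - cnj z') * ip l y w = cnj (deriv1 l w l) - deriv1 l y l"
proof -
  have "z * ip l y w - cnj (z' * ip l w y) = - bracket l y w l"
    using lagrange_identity[OF solves_L2_imp_Dstar[OF y(1,2)] solves_L2_imp_Dstar[OF w(1,2)]]
    by (simp add: ip_solves_left[OF y(1)] ip_solves_left[OF w(1)])
  then show ?thesis using y(3) w(3) by (simp add: ip_cnj bracket_def algebra_simps)
qed

definition m :: "complex \<Rightarrow> complex" where "m z = deriv1 l (weyl z) l"

text \<open>
  Any candidate for the Weyl function at \<open>z\<close> comes with a square integrable solution.  Pairing that
  solution with the Weyl solution at \<open>cnj z\<close> in \<open>ip_solutions\<close> makes the left-hand side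
  vanish, and the candidate is the conjugate of one and the same number.
\<close>

lemma weyl_m_eq:
  assumes "Im z \<noteq> 0"
  shows "weyl_m l q z = m z"
  unfolding weyl_m_def
proof (rule the_equality)
  note W = weyl[OF assms]
  obtain p1 where p1: "solves l q z p1" "p1 l = 0" "deriv1 l p1 l = 1" by (rule solves_ex[OF loc_int])
  define p2 where "p2 x = 1 * weyl z x + (- m z) * p1 x" for x
  have "solves l q z p2" "p2 l = -1" "deriv1 l p2 l = 0"
    using solves_lincomb[OF W(1) p1(1), where a=1 and b="- m z"] p1 W(3) by (auto simp: p2_def[abs_def] m_def)
  moreover have "(\<lambda>x. p2 x + m z * p1 x) = weyl z" by (auto simp: p2_def)
  ultimately show "\<exists>phi1 phi2. solves l q z phi1 \<and> phi1 l = 0 \<and> deriv1 l phi1 l = 1 \<and>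
      solves l q z phi2 \<and> phi2 l = - 1 \<and> deriv1 l phi2 l = 0 \<and> L2 l (\<lambda>x. phi2 x + m z * phi1 x)"
    using p1 W(2) by metis
next
  fix m' assume "\<exists>phi1 phi2. solves l q z phi1 \<and> phi1 l = 0 \<and> deriv1 l phi1 l = 1 \<and>
      solves l q z phi2 \<and> phi2 l = - 1 \<and> deriv1 l phi2 l = 0 \<and> L2 l (\<lambda>x. phi2 x + m' * phi1 x)"
  then obtain p1 p2 where p: "solves l q z p1" "p1 l = 0" "deriv1 l p1 l = 1"
      "solves l q z p2" "p2 l = - 1" "deriv1 l p2 l = 0" "L2 l (\<lambda>x. 1 * p2 x + m' * p1 x)" by auto
  note s = solves_lincomb[OF p(4,1), where a=1 and b=m']
  have cz: "Im (cnj z) \<noteq> 0" using assms by simp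
  note W' = weyl[OF cz] and W = weyl[OF assms]
  have "0 = cnj (deriv1 l (weyl (cnj z)) l) - deriv1 l (\<lambda>x. 1 * p2 x + m' * p1 x) l"
    using ip_solutions[OF s(1) p(7) _ W'(1,2,3)] p by simp
  moreover have "0 = cnj (deriv1 l (weyl (cnj z)) l) - m z"
    using ip_solutions[OF W(1,2,3) W'(1,2,3)] by (simp add: m_def)
  ultimately show "m' = m z" using s(2)[of l] p by simp
qed

lemma m_kernel:
  assumes "Im z \<noteq> 0" "Im w \<noteq> 0"
  shows "(z - cnj w) * ip l (weyl z) (weyl w) = cnj (m w) - m z"
  unfolding m_def by (rule ip_solutions) (use weyl assms in auto)

lemma m_cnj: "Im z \<noteq> 0 \<Longrightarrow> m (cnj z) = cnj (m z)"
  using m_kernel[of "cnj z" z] by simp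

definition weyl_norm_sq :: "complex \<Rightarrow> real" where
  "weyl_norm_sq z = integral {l..} (\<lambda>x. (cmod (weyl z x))\<^sup>2)"

lemma weyl_sq_abs_integrable: "Im z \<noteq> 0 \<Longrightarrow> (\<lambda>x. (cmod (weyl z x))\<^sup>2) absolutely_integrable_on {l..}"
  using weyl(2) by (simp add: L2_def)

lemma ip_self: 
  assumes "L2 l f"
  shows "ip l f f = of_real (integral {l..} (\<lambda>x. (cmod (f x))\<^sup>2))"
proof -
  have "(\<lambda>x. (cmod (f x))\<^sup>2) integrable_on {l..}"
    using assms by (auto simp: L2_def intro: abs_integrable_integrable)
  from integral_linear[OF this bounded_linear_of_real[where 'a=complex]] show ?thesis
    by (simp add: ip_def o_def complex_norm_square[symmetric] flip: of_real_power)
qed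

text \<open>
  The kernel identity on the diagonal.  It shows the sign of \<open>Im m\<close> and converts bounds for the Weyl
  solution into bounds for \<open>m\<close>.
\<close>

lemma weyl_norm_sq_eq: "Im z \<noteq> 0 \<Longrightarrow> Im z * weyl_norm_sq z = - Im (m z)"
  using m_kernel[of z z] by (simp add: ip_self weyl weyl_norm_sq_def complex_eq_iff)

lemma integral_le_weyl_norm_sq:
  assumes "Im z \<noteq> 0" "S \<subseteq> {l..}" "S \<in> sets lebesgue"
  shows "integral S (\<lambda>x. (cmod (weyl z x))\<^sup>2) \<le> weyl_norm_sq z"
  unfolding weyl_norm_sq_def
  by (rule integral_subset_le[OF assms(2)])
    (auto intro!: abs_integrable_integrable weyl_sq_abs_integrable set_integrable_subset[OF weyl_sq_abs_integrable] assms)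

lemma interval_le_weyl_norm_sq:
  assumes z: "Im z \<noteq> 0" and uv: "l \<le> u" "u \<le> v" and B: "0 \<le> B" "\<And>x. u \<le> x \<Longrightarrow> x \<le> v \<Longrightarrow> B \<le> cmod (weyl z x)"
  shows "(v - u) * B\<^sup>2 \<le> weyl_norm_sq z"
proof -
  have "(v - u) * B\<^sup>2 = integral {u..v} (\<lambda>x. B\<^sup>2)" using uv by simp
  also have "\<dots> \<le> integral {u..v} (\<lambda>x. (cmod (weyl z x))\<^sup>2)"
    by (rule integral_le) 
      (use B uv in \<open>auto intro!: power_mono abs_integrable_integrable set_integrable_subset[OF weyl_sq_abs_integrable[OF z]]\<close>)
  also have "\<dots> \<le> weyl_norm_sq z" by (rule integral_le_weyl_norm_sq) (use z uv in auto)
  finally show ?thesis .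
qed

lemma m_Im_neg:
  assumes "0 < Im z"
  shows "Im (m z) < 0"
proof -
  have "Im (m z) \<le> 0" 
  proof -
    have "0 \<le> weyl_norm_sq z" using interval_le_weyl_norm_sq[of z l l 0] assms by simp
    then have "0 \<le> Im z * weyl_norm_sq z" using assms by simp
    then show ?thesis using weyl_norm_sq_eq[of z] assms by simp
  qed
  moreover have "Im (m z) \<noteq> 0"
  proof
    assume "Im (m z) = 0"
    then have n0: "weyl_norm_sq z = 0" using weyl_norm_sq_eq[of z] assms by simp
    have cw: "continuous_on {l..} (weyl z)"
      using weyl(1)[of z] assms regular_continuous by (auto simp: solves_def)
    have c: "continuous_on {l..l+1} (\<lambda>x. (cmod (weyl z x))\<^sup>2)"
      by (intro continuous_intros continuous_on_subset[OF cw]) auto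
    have "integral {l..l+1} (\<lambda>x. (cmod (weyl z x))\<^sup>2) \<le> 0"
      using integral_le_weyl_norm_sq[of z "{l..l+1}"] n0 assms by simp
    moreover have "0 \<le> integral {l..l+1} (\<lambda>x. (cmod (weyl z x))\<^sup>2)"
      by (rule Henstock_Kurzweil_Integration.integral_nonneg[OF integrable_continuous_real[OF c]]) auto
    ultimately have "weyl z l = 0"
      using integral_eq_0_iff[OF c] by simp
    then show False using weyl(3)[of z] assms by simp
  qed
  ultimately show ?thesis by simp
qed

end

section \<open>Growth and holomorphy of the Weyl function\<close>

text \<open>
  A solution differs from its tangent at \<open>l\<close> by a double integral of \<open>(q - z) * y\<close>.  With \<open>R\<close>
  the maximum of \<open>\<bar>y\<bar>\<close> on the interval the difference is at most \<open>eta * R\<close>, and then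
  \<open>R\<close> itself is at most \<open>4/3\<close> of the bound \<open>S\<close> for the tangent because \<open>eta\<close> is at most
  \<open>1/4\<close>.
\<close>

lemma solution_near_tangent:
  assumes y: "solves l q z y" and q: "loc_integrable l q" and d: "0 < d"
    and eta: "d * (integral {l..l+d} (\<lambda>t. \<bar>q t\<bar>) + cmod z * d) \<le> eta" "eta \<le> 1/4"
    and x: "l \<le> x" "x \<le> l + d"
  shows "cmod (y x - (y l + deriv1 l y l * of_real (x - l))) \<le> 4/3 * eta * (cmod (y l) + cmod (deriv1 l y l) * d)"
proof -
  define S where "S = cmod (y l) + cmod (deriv1 l y l) * d"
  define \<kappa> where "\<kappa> = integral {l..l+d} (\<lambda>t. \<bar>q t\<bar>) + cmod z * d"
  have s: "ac_density_of l y (deriv1 l y)" "ac_density_of l (deriv1 l y) (\<lambda>x. (of_real (q x) - z) * y x)"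
    using solves_imp_solution_pair[OF y] by (auto simp: solution_pair_def)
  note cy = ac_density_continuous_on[OF s(1)] and cy1 = ac_density_continuous_on[OF s(2)]
  obtain x0 where x0: "x0 \<in> {l..l+d}" "\<And>t. t \<in> {l..l+d} \<Longrightarrow> cmod (y t) \<le> cmod (y x0)"
  proof -
    have "continuous_on {l..l+d} (\<lambda>t. cmod (y t))"
      by (intro continuous_intros continuous_on_subset[OF cy]) auto
    from continuous_attains_sup[OF _ _ this] show ?thesis using that d by auto
  qed
  define R where "R = cmod (y x0)"
  have R0: "0 \<le> R" by (simp add: R_def)
  have qi: "(\<lambda>t. \<bar>q t\<bar>) integrable_on {l..b}" for b
    using loc_integrable_integrable[OF loc_integrable_norm[OF q] order_refl] by simp
  have d1: "cmod (deriv1 l y t - deriv1 l y l) \<le> R * \<kappa>" if t: "t \<in> {l..l+d}" for t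
  proof -
    have "cmod (deriv1 l y t - deriv1 l y l) = cmod (integral {l..t} (\<lambda>x. (of_real (q x) - z) * y x))"
      using ac_density_integral[OF s(2), of t] t by simp
    also have "\<dots> \<le> integral {l..t} (\<lambda>x. R * (\<bar>q x\<bar> + cmod z))"
    proof (rule integral_norm_bound_integral)
      show "(\<lambda>x. (of_real (q x) - z) * y x) integrable_on {l..t}"
        by (rule loc_integrable_integrable[OF ac_density_loc_integrable[OF s(2)] order_refl])
      show "(\<lambda>x. R * (\<bar>q x\<bar> + cmod z)) integrable_on {l..t}"
        by (intro integrable_on_mult_right integrable_add qi integrable_const_ivl)
      show "norm ((of_real (q x) - z) * y x) \<le> R * (\<bar>q x\<bar> + cmod z)" if "x \<in> {l..t}" for x
      proof -
        have "cmod (of_real (q x) - z) \<le> \<bar>q x\<bar> + cmod z"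
          using norm_triangle_ineq4[of "complex_of_real (q x)" z] by simp
        moreover have "cmod (y x) \<le> R" using x0(2)[of x] that t by (simp add: R_def)
        ultimately show ?thesis unfolding norm_mult mult.commute[of R] by (intro mult_mono) auto
      qed
    qed
    also have "\<dots> \<le> integral {l..l+d} (\<lambda>x. R * (\<bar>q x\<bar> + cmod z))"
    proof (rule integral_subset_le)
      show "(\<lambda>x. R * (\<bar>q x\<bar> + cmod z)) integrable_on {l..t}" "(\<lambda>x. R * (\<bar>q x\<bar> + cmod z)) integrable_on {l..l+d}"
        by (intro integrable_on_mult_right integrable_add qi integrable_const_ivl)+
    qed (use t R0 in auto)
    also have "\<dots> = R * (integral {l..l+d} (\<lambda>t. \<bar>q t\<bar>) + d * cmod z)"
    proof -
      have "((\<lambda>x. cmod z) has_integral d * cmod z) {l..l+d}"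
        using has_integral_const_real[of "cmod z" l "l+d"] d by simp
      then show ?thesis
        by (intro integral_unique has_integral_mult_right has_integral_add integrable_integral qi)
    qed
    finally show ?thesis by (simp add: \<kappa>_def mult.commute)
  qed
  have \<kappa>0: "0 \<le> \<kappa>" using d integral_nonneg[OF qi] by (auto simp: \<kappa>_def intro!: add_nonneg_nonneg)
  have err: "cmod (y t - (y l + deriv1 l y l * of_real (t - l))) \<le> eta * R" if t: "t \<in> {l..l+d}" for t
  proof -
    have i: "deriv1 l y integrable_on {l..t}"
      by (rule loc_integrable_integrable[OF ac_density_loc_integrable[OF s(1)] order_refl])
    have "integral {l..t} (\<lambda>s. deriv1 l y s - deriv1 l y l) = integral {l..t} (deriv1 l y) - of_real (t - l) * deriv1 l y l"
      using t i by (subst Henstock_Kurzweil_Integration.integral_diff) (auto simp: scaleR_conv_of_real)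
    then have "y t - (y l + deriv1 l y l * of_real (t - l)) = integral {l..t} (\<lambda>s. deriv1 l y s - deriv1 l y l)"
      using ac_density_integral[OF s(1), of t] t by (simp add: mult.commute)
    also have "cmod \<dots> \<le> (R * \<kappa>) * (t - l)"
      by (rule integral_bound) (use t d1 in \<open>auto intro!: continuous_intros continuous_on_subset[OF cy1]\<close>)
    also have "\<dots> \<le> (R * \<kappa>) * d" using t R0 \<kappa>0 by (intro mult_left_mono) auto
    also have "\<dots> \<le> R * eta" using eta(1) R0 mult_left_mono[OF eta(1) R0] by (simp add: \<kappa>_def mult_ac)
    finally show ?thesis by (simp add: mult.commute)
  qed
  have eta0: "0 \<le> eta" using order_trans[OF _ eta(1)] d \<kappa>0 by (simp add: \<kappa>_def)
  have "R \<le> S + eta * R"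
  proof -
    have "R \<le> cmod (y l + deriv1 l y l * of_real (x0 - l)) + cmod (y x0 - (y l + deriv1 l y l * of_real (x0 - l)))"
      unfolding R_def by (rule norm_triangle_sub)
    also have "cmod (y l + deriv1 l y l * of_real (x0 - l)) \<le> S"
      unfolding S_def
      by (rule order_trans[OF norm_triangle_ineq]) (use x0 in \<open>auto simp: norm_mult simp del: of_real_diff intro!: mult_left_mono\<close>)
    finally show ?thesis using err[OF x0(1)] by linarith
  qed
  also have "S + eta * R \<le> S + 1/4 * R" using eta(2) R0 by (intro add_left_mono mult_right_mono) auto
  finally have "R \<le> 4/3 * S" by simp
  then have "eta * R \<le> eta * (4/3 * S)" using eta0 by (rule mult_left_mono)
  also have "\<dots> = 4/3 * eta * S" by simp
  finally have "eta * R \<le> 4/3 * eta * S" .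
  with err[of x] x show ?thesis unfolding S_def by (meson atLeastAtMost_iff order_trans)
qed

context limit_point begin

lemma ip_weyl_CS:
  assumes "L2 l f" "Im w \<noteq> 0"
  shows "(cmod (ip l f (weyl w)))\<^sup>2 \<le> integral {l..} (\<lambda>x. (cmod (f x))\<^sup>2) * weyl_norm_sq w"
  unfolding ip_def weyl_norm_sq_def
  by (rule integral_Cauchy_Schwarz) (use assms weyl(2) in \<open>auto simp: L2_iff_sq_integrable\<close>)

lemma weyl_norm_sq_cnj: "Im z \<noteq> 0 \<Longrightarrow> weyl_norm_sq (cnj z) = weyl_norm_sq z"
proof -
  assume z: "Im z \<noteq> 0"
  then have "Im z * weyl_norm_sq (cnj z) = Im z * weyl_norm_sq z"
    using weyl_norm_sq_eq[of z] weyl_norm_sq_eq[of "cnj z"] m_cnj[of z] by simp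
  then show ?thesis using z by simp
qed

lemma weyl_norm_sq_eq_divide: "Im z \<noteq> 0 \<Longrightarrow> weyl_norm_sq z = - Im (m z) / Im z"
  using weyl_norm_sq_eq[of z] by (metis nonzero_mult_div_cancel_left)

lemma weyl_norm_sq_nonneg: "Im z \<noteq> 0 \<Longrightarrow> 0 \<le> weyl_norm_sq z"
  using interval_le_weyl_norm_sq[of z l l 0] by simp

text \<open>
  The kernel identity with \<open>cnj w\<close> in place of \<open>w\<close>: it turns the difference quotient of \<open>m\<close>
  into an inner product of Weyl solutions.
\<close>

lemma m_diff:
  assumes "Im z \<noteq> 0" "Im w \<noteq> 0"
  shows "m z - m w = - (z - w) * ip l (weyl z) (weyl (cnj w))"
  using m_kernel[of z "cnj w"] m_cnj[of w] assms by (simp add: algebra_simps)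

lemma m_diff_le:
  assumes "Im z \<noteq> 0" "Im w \<noteq> 0"
  shows "(cmod (m z - m w))\<^sup>2 \<le> (cmod (z - w))\<^sup>2 * (weyl_norm_sq z * weyl_norm_sq w)"
proof -
  have "(cmod (ip l (weyl z) (weyl (cnj w))))\<^sup>2 \<le> weyl_norm_sq z * weyl_norm_sq w"
    using ip_weyl_CS[OF weyl(2)[OF assms(1)], of "cnj w"] assms weyl_norm_sq_cnj[of w] by (simp add: weyl_norm_sq_def)
  then show ?thesis
    unfolding m_diff[OF assms] norm_mult norm_minus_cancel power_mult_distrib
    by (intro mult_left_mono) auto
qed

text \<open>
  By \<open>m_diff_le\<close> the increment \<open>D\<close> of \<open>m\<close> satisfies
  \<open>D\<^sup>2 \<le> \<bar>z - w\<bar>\<^sup>2 * const * (\<bar>m w\<bar> + D)\<close>, since the norm of the Weyl solution at \<open>z\<close> is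
  controlled by \<open>m z\<close> itself.  Near \<open>w\<close> this first excludes \<open>D \<ge> 1\<close> and then makes \<open>D\<close> of the
  order of \<open>\<bar>z - w\<bar>\<close>.
\<close>

lemma isCont_m:
  assumes w: "0 < Im w"
  shows "isCont m w"
proof -
  define c where "c = 2 * weyl_norm_sq w / Im w * (cmod (m w) + 1)"
  have c0: "0 \<le> c" using weyl_norm_sq_nonneg[of w] w by (simp add: c_def)
  have ev: "\<forall>\<^sub>F z in at w. cmod (m z - m w) \<le> cmod (z - w) * sqrt c"
  proof -
    have "((\<lambda>z. (cmod (z - w))\<^sup>2 * c) \<longlongrightarrow> (cmod (w - w))\<^sup>2 * c) (at w)"
      by (intro tendsto_intros)
    then have "\<forall>\<^sub>F z in at w. (cmod (z - w))\<^sup>2 * c < 1"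
      by (rule order_tendstoD) simp
    moreover have "\<forall>\<^sub>F z in at w. Im w / 2 < Im z"
      by (rule order_tendstoD(1)[of Im "Im w"]) (use w in \<open>auto intro!: tendsto_intros\<close>)
    ultimately show ?thesis
    proof eventually_elim
      case (elim z)
      define D where "D = cmod (m z - m w)"
      have iz: "Im z \<noteq> 0" "Im z > 0" using elim w by auto
      have "Im z * weyl_norm_sq z \<le> cmod (m z)"
        using weyl_norm_sq_eq[OF iz(1)] abs_Im_le_cmod[of "m z"] by linarith
      then have "Im w / 2 * weyl_norm_sq z \<le> cmod (m z)"
        using mult_right_mono[of "Im w / 2" "Im z" "weyl_norm_sq z"] weyl_norm_sq_nonneg[OF iz(1)] elim by simp
      also have "\<dots> \<le> cmod (m w) + D"
        using norm_triangle_sub[of "m z" "m w"] by (simp add: D_def)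
      finally have nz: "weyl_norm_sq z \<le> 2 / Im w * (cmod (m w) + D)"
        using w by (simp add: field_simps)
      have "D\<^sup>2 \<le> (cmod (z - w))\<^sup>2 * (weyl_norm_sq z * weyl_norm_sq w)"
        unfolding D_def by (rule m_diff_le) (use iz w in auto)
      also have "\<dots> \<le> (cmod (z - w))\<^sup>2 * (2 / Im w * (cmod (m w) + D) * weyl_norm_sq w)"
        using nz weyl_norm_sq_nonneg[of w] w by (intro mult_left_mono mult_right_mono) auto
      also have "\<dots> = (cmod (z - w))\<^sup>2 * (2 * weyl_norm_sq w / Im w) * (cmod (m w) + D)"
        by simp
      also have "\<dots> \<le> (cmod (z - w))\<^sup>2 * (2 * weyl_norm_sq w / Im w) * ((cmod (m w) + 1) * max 1 D)"
      proof (rule mult_left_mono)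
        have "cmod (m w) * 1 \<le> cmod (m w) * max 1 D" by (rule mult_left_mono) auto
        then show "cmod (m w) + D \<le> (cmod (m w) + 1) * max 1 D"
          by (simp add: algebra_simps)
      qed (use weyl_norm_sq_nonneg[of w] w in auto)
      also have "\<dots> = (cmod (z - w))\<^sup>2 * c * max 1 D" by (simp add: c_def)
      finally have D2: "D\<^sup>2 \<le> (cmod (z - w))\<^sup>2 * c * max 1 D" .
      have "D < 1"
      proof (rule ccontr)
        assume "\<not> D < 1"
        then have "D * D \<le> ((cmod (z - w))\<^sup>2 * c) * D" using D2 by (simp add: power2_eq_square max_def split: if_splits)
        then have "D \<le> (cmod (z - w))\<^sup>2 * c" using \<open>\<not> D < 1\<close> by simp
        then show False using elim \<open>\<not> D < 1\<close> by simp
      qed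
      then have "D\<^sup>2 \<le> (cmod (z - w) * sqrt c)\<^sup>2" using D2 c0 by (simp add: power_mult_distrib)
      then show ?case unfolding D_def by (rule power2_le_imp_le) (use c0 in auto)
    qed
  qed
  have "((\<lambda>z. cmod (z - w) * sqrt c) \<longlongrightarrow> cmod (w - w) * sqrt c) (at w)"
    by (intro tendsto_intros)
  then have "((\<lambda>z. m z - m w) \<longlongrightarrow> 0) (at w)"
    by (intro Lim_null_comparison[OF ev]) simp
  then show ?thesis by (simp add: isCont_def LIM_zero_iff)
qed

lemma norm_weyl_diff:
  assumes "Im z \<noteq> 0" "Im w \<noteq> 0"
  shows "L2 l (\<lambda>x. weyl z x - weyl w x)"
    "integral {l..} (\<lambda>x. (cmod (weyl z x - weyl w x))\<^sup>2) = weyl_norm_sq z + weyl_norm_sq w - 2 * Re (ip l (weyl z) (weyl w))"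
proof -
  have L: "sq_integrable {l..} (weyl z)" "sq_integrable {l..} (weyl w)"
    using weyl(2) assms by (auto simp: L2_iff_sq_integrable)
  have "sq_integrable {l..} (\<lambda>x. weyl z x + (-1) * weyl w x)"
    by (intro sq_integrable_add sq_integrable_cmult L) auto
  then show "L2 l (\<lambda>x. weyl z x - weyl w x)" by (simp add: L2_iff_sq_integrable)
  have i: "(\<lambda>x. weyl z x * cnj (weyl w x)) integrable_on {l..}"
    by (rule abs_integrable_integrable[OF sq_integrable_mult]) (use L in auto)
  have ir: "((\<lambda>x. Re (weyl z x * cnj (weyl w x))) has_integral Re (ip l (weyl z) (weyl w))) {l..}"
    using has_integral_linear[OF integrable_integral[OF i] bounded_linear_Re] by (simp only: o_def ip_def)
  have eq: "(\<lambda>x. (cmod (weyl z x - weyl w x))\<^sup>2) = (\<lambda>x. (cmod (weyl z x))\<^sup>2 + (cmod (weyl w x))\<^sup>2 - 2 * Re (weyl z x * cnj (weyl w x)))"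
    by (auto simp: cmod_power2 power2_diff algebra_simps)
  show "integral {l..} (\<lambda>x. (cmod (weyl z x - weyl w x))\<^sup>2) = weyl_norm_sq z + weyl_norm_sq w - 2 * Re (ip l (weyl z) (weyl w))"
    unfolding eq weyl_norm_sq_def
    by (intro integral_unique has_integral_diff has_integral_add has_integral_mult_right ir integrable_integral cmod_sq_integrable_on L)
qed

text \<open>
  The difference quotient at \<open>w\<close> is \<open>- ip (weyl z) (weyl (cnj w))\<close>, so it suffices that
  \<open>weyl z\<close> tends to \<open>weyl w\<close> in norm.  The squared distance of the two is a combination of kernel
  values, that is, of values of \<open>m\<close>, and continuity of \<open>m\<close> makes it tend to \<open>0\<close>.
\<close>

lemma m_holomorphic: "m holomorphic_on {z. 0 < Im z}"
proof -
  have "\<exists>D. (m has_field_derivative D) (at w)" if w: "0 < Im w" for w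
  proof -
    note c = isCont_m[OF w]
    have w0: "Im w \<noteq> 0" "Im (cnj w) \<noteq> 0" using w by auto
    have evI: "\<forall>\<^sub>F z in at w. 0 < Im z"
      by (rule order_tendstoD(1)[of Im "Im w"]) (use w in \<open>auto intro!: tendsto_intros\<close>)
    have limm: "(m \<longlongrightarrow> m w) (at w)" using c by (simp add: isCont_def)
    have nz: "w - cnj w \<noteq> 0" using w by (auto simp: complex_eq_iff)
    have "((\<lambda>z. - Im (m z) / Im z + weyl_norm_sq w - 2 * Re ((cnj (m w) - m z) / (z - cnj w)))
        \<longlongrightarrow> - Im (m w) / Im w + weyl_norm_sq w - 2 * Re ((cnj (m w) - m w) / (w - cnj w))) (at w)"
      by (intro tendsto_intros limm) (use w nz in auto)
    also have "- Im (m w) / Im w + weyl_norm_sq w - 2 * Re ((cnj (m w) - m w) / (w - cnj w)) = 0"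
    proof -
      have "(cnj (m w) - m w) / (w - cnj w) = of_real (- Im (m w) / Im w)"
        using w by (simp add: complex_eq_iff Re_divide Im_divide power2_eq_square)
      moreover have "weyl_norm_sq w = - Im (m w) / Im w"
        by (rule weyl_norm_sq_eq_divide[OF w0(1)])
      ultimately show ?thesis by (simp only: Re_complex_of_real)
    qed
    finally have "((\<lambda>z. - Im (m z) / Im z + weyl_norm_sq w - 2 * Re ((cnj (m w) - m z) / (z - cnj w))) \<longlongrightarrow> 0) (at w)" .
    moreover have "\<forall>\<^sub>F z in at w. - Im (m z) / Im z + weyl_norm_sq w - 2 * Re ((cnj (m w) - m z) / (z - cnj w))
        = integral {l..} (\<lambda>x. (cmod (weyl z x - weyl w x))\<^sup>2)"
      using evI
    proof eventually_elim
      case (elim z)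
      have z: "Im z \<noteq> 0" using elim by simp
      have "z - cnj w \<noteq> 0" using elim w by (auto simp: complex_eq_iff)
      then have "ip l (weyl z) (weyl w) = (cnj (m w) - m z) / (z - cnj w)"
        using m_kernel[OF z w0(1)] by (simp add: field_simps)
      moreover have "weyl_norm_sq z = - Im (m z) / Im z"
        by (rule weyl_norm_sq_eq_divide[OF z])
      ultimately show ?case using norm_weyl_diff(2)[OF z w0(1)] by simp
    qed
    ultimately have lim0: "((\<lambda>z. integral {l..} (\<lambda>x. (cmod (weyl z x - weyl w x))\<^sup>2)) \<longlongrightarrow> 0) (at w)"
      by (rule Lim_transform_eventually)
    have ipd: "ip l (weyl z) (weyl (cnj w)) - ip l (weyl w) (weyl (cnj w)) = ip l (\<lambda>x. weyl z x - weyl w x) (weyl (cnj w))"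
      if "Im z \<noteq> 0" for z
      unfolding ip_def left_diff_distrib
      by (intro Henstock_Kurzweil_Integration.integral_diff[symmetric] abs_integrable_integrable ip_L2 weyl that w0)
    have ev2: "\<forall>\<^sub>F z in at w. cmod (ip l (weyl z) (weyl (cnj w)) - ip l (weyl w) (weyl (cnj w)))
        \<le> sqrt (integral {l..} (\<lambda>x. (cmod (weyl z x - weyl w x))\<^sup>2) * weyl_norm_sq (cnj w))"
      using evI
    proof eventually_elim
      case (elim z)
      have z: "Im z \<noteq> 0" using elim by simp
      show ?case unfolding ipd[OF z]
        by (rule real_le_rsqrt) (rule ip_weyl_CS[OF norm_weyl_diff(1)[OF z w0(1)] w0(2)])
    qed
    have "((\<lambda>z. sqrt (integral {l..} (\<lambda>x. (cmod (weyl z x - weyl w x))\<^sup>2) * weyl_norm_sq (cnj w))) \<longlongrightarrow> sqrt (0 * weyl_norm_sq (cnj w))) (at w)"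
      by (intro tendsto_intros lim0)
    then have "((\<lambda>z. ip l (weyl z) (weyl (cnj w)) - ip l (weyl w) (weyl (cnj w))) \<longlongrightarrow> 0) (at w)"
      by (intro Lim_null_comparison[OF ev2]) simp
    then have "((\<lambda>z. ip l (weyl z) (weyl (cnj w))) \<longlongrightarrow> ip l (weyl w) (weyl (cnj w))) (at w)"
      by (simp add: LIM_zero_iff)
    then have "((\<lambda>z. - ip l (weyl z) (weyl (cnj w))) \<longlongrightarrow> - ip l (weyl w) (weyl (cnj w))) (at w)"
      by (rule tendsto_minus)
    moreover have "\<forall>\<^sub>F z in at w. - ip l (weyl z) (weyl (cnj w)) = (m z - m w) / (z - w)"
      using evI eventually_neq_at_within[of w w]
    proof eventually_elim
      case (elim z)
      then show ?case using m_diff[of z w] w0 by (simp add: field_simps)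
    qed
    ultimately have "((\<lambda>z. (m z - m w) / (z - w)) \<longlongrightarrow> - ip l (weyl w) (weyl (cnj w))) (at w)"
      by (rule Lim_transform_eventually)
    then show ?thesis using has_field_derivative_iff by blast
  qed
  moreover have "open {z. 0 < Im z}" by (rule open_halfspace_Im_gt)
  ultimately show ?thesis by (auto simp: holomorphic_on_open)
qed

text \<open>
  At \<open>z = \<i> * t\<^sup>2\<close> the natural length scale is \<open>1 / t\<close>.  On an interval of length \<open>d\<close>
  comparable to \<open>1 / t\<close> the Weyl solution is close to \<open>- 1 + m * (x - l)\<close>, and its squared norm over
  that interval is at most \<open>- Im m / t\<^sup>2\<close>.  If \<open>\<bar>m\<bar> * d\<close> were large, the solution would
  be large on the right half of the interval and its norm would exceed \<open>\<bar>m\<bar> / t\<^sup>2\<close>.  Once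
  \<open>\<bar>m\<bar> = O(t)\<close> is known, the solution is close to \<open>- 1\<close> on a smaller interval of the same
  order, which bounds \<open>- Im m\<close> from below.
\<close>

lemma m_asymptotics:
  obtains C c t0 where "0 < C" "0 < c" "0 < t0"
    "\<And>t. t0 \<le> t \<Longrightarrow> cmod (m (\<i> * of_real (t\<^sup>2))) \<le> C * t \<and> c * t \<le> - Im (m (\<i> * of_real (t\<^sup>2)))"
proof -
  define A where "A = integral {l..l+1} (\<lambda>x. \<bar>q x\<bar>)"
  have qi: "(\<lambda>t. \<bar>q t\<bar>) integrable_on {l..b}" for b
    using loc_integrable_integrable[OF loc_integrable_norm[OF loc_int] order_refl] by simp
  have A0: "0 \<le> A" unfolding A_def by (rule integral_nonneg[OF qi]) auto
  define t0 where "t0 = 1 + 8 * A"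
  have main: "cmod (m (\<i> * of_real (t\<^sup>2))) \<le> 65536 * t \<and> 1/2097152 * t \<le> - Im (m (\<i> * of_real (t\<^sup>2)))" if t: "t0 \<le> t" for t
  proof -
    define z where "z = \<i> * complex_of_real (t\<^sup>2)"
    have t1: "1 \<le> t" "8 * A \<le> t" "0 < t" using t A0 by (auto simp: t0_def)
    have iz: "Im z = t\<^sup>2" "cmod z = t\<^sup>2" by (auto simp: z_def norm_mult norm_power)
    have z0: "Im z \<noteq> 0" using iz t1 by simp
    define M where "M = cmod (m z)"
    have M0: "0 \<le> M" by (simp add: M_def)
    have nz: "t\<^sup>2 * weyl_norm_sq z = - Im (m z)" using weyl_norm_sq_eq[OF z0] iz by simp
    have near: "cmod (weyl z x - (- 1 + m z * of_real (x - l))) \<le> 1/24 * (1 + M * d)"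
      if d: "0 < d" "d \<le> 1 / (8 * t)" and x: "l \<le> x" "x \<le> l + d" for d x
    proof -
      have dt: "d * t \<le> 1/8" using d t1 by (simp add: field_simps)
      have d1: "d \<le> 1" using d t1 by (simp add: field_simps) (smt (verit) mult_le_cancel_left1)
      have "integral {l..l+d} (\<lambda>x. \<bar>q x\<bar>) \<le> A"
        unfolding A_def by (rule integral_subset_le) (use d1 qi in auto)
      then have "d * (integral {l..l+d} (\<lambda>t. \<bar>q t\<bar>) + cmod z * d) \<le> d * (A + t\<^sup>2 * d)"
        using d iz by (intro mult_left_mono) auto
      also have "\<dots> = d * A + (d * t)\<^sup>2" by (simp add: power2_eq_square algebra_simps)
      also have "\<dots> \<le> 1/64 + (1/8)\<^sup>2"
      proof (rule add_mono)
        have "d * A \<le> d * (t / 8)" using d t1 by (intro mult_left_mono) auto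
        then show "d * A \<le> 1/64" using dt by simp
        show "(d * t)\<^sup>2 \<le> (1/8)\<^sup>2" using dt d t1 by (intro power_mono) auto
      qed
      finally have eta: "d * (integral {l..l+d} (\<lambda>t. \<bar>q t\<bar>) + cmod z * d) \<le> 1/32" by (simp add: power2_eq_square)
      show ?thesis
        using solution_near_tangent[OF weyl(1)[OF z0] loc_int d(1) eta _ x] weyl(3)[OF z0]
        by (simp add: M_def m_def[symmetric])
    qed
    have up: "M \<le> 65536 * t"
    proof (rule ccontr)
      assume "\<not> M \<le> 65536 * t"
      then have Mt: "65536 * t < M" by simp
      \<comment> \<open>If M exceeds 65536 t then M * d is at least 4, and d^3 / 128 * M^2, which bounds the norm from
        below, exceeds M / t^2; here 65536 = 128 * 8^3.\<close>
      define d where "d = 1 / (8 * t)"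
      have d: "0 < d" "d \<le> 1 / (8 * t)" using t1 by (auto simp: d_def)
      have Md: "4 \<le> M * d" using Mt t1 by (simp add: d_def field_simps)
      have big: "M * d / 8 \<le> cmod (weyl z x)" if x: "l + d/2 \<le> x" "x \<le> l + d" for x
      proof -
        have "M * (d / 2) \<le> M * (x - l)" using x M0 by (intro mult_left_mono) auto
        also have "\<dots> = cmod (m z * of_real (x - l))" using x d by (simp add: M_def norm_mult del: of_real_diff)
        also have "\<dots> \<le> cmod (weyl z x) + cmod (weyl z x - (- 1 + m z * of_real (x - l))) + 1"
        proof -
          have "m z * of_real (x - l) = weyl z x - (weyl z x - (- 1 + m z * of_real (x - l))) + 1" by simp
          then show ?thesis
            by (metis (no_types, lifting) add_right_mono norm_one norm_triangle_ineq norm_triangle_ineq4 order_trans)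
        qed
        also have "\<dots> \<le> cmod (weyl z x) + 1/24 * (1 + M * d) + 1"
          using near[OF d, of x] x d by simp
        finally have "M * (d / 2) \<le> cmod (weyl z x) + 1/24 * (1 + M * d) + 1" .
        moreover have "M * (d / 2) = (M * d) / 2" by simp
        ultimately have "(M * d) / 2 \<le> cmod (weyl z x) + 1/24 * (1 + M * d) + 1" by (simp only:)
        moreover have "p / 8 \<le> s" if "p / 2 \<le> s + 1/24 * (1 + p) + 1" "4 \<le> p" for p s :: real
          using that by (simp add: field_simps)
        ultimately show ?thesis using Md by blast
      qed
      have "(l + d - (l + d/2)) * (M * d / 8)\<^sup>2 \<le> weyl_norm_sq z"
        by (rule interval_le_weyl_norm_sq[OF z0]) (use d Md big in auto)
      then have "t\<^sup>2 * ((d/2) * (M * d / 8)\<^sup>2) \<le> t\<^sup>2 * weyl_norm_sq z" by (intro mult_left_mono) auto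
      also have "\<dots> \<le> M" unfolding nz M_def using abs_Im_le_cmod[of "m z"] by linarith
      finally have "M * (M / (65536 * t)) \<le> M * 1"
        using t1 by (simp add: d_def field_simps power2_eq_square)
      then have "M / (65536 * t) \<le> 1" using Mt t1 by (subst (asm) mult_le_cancel_left_pos) auto
      then show False using Mt t1 by (simp add: field_simps)
    qed
    have low: "1/2097152 * t \<le> - Im (m z)"
    proof -
      \<comment> \<open>524288 = 8 * 65536 makes M * d at most 1/8.\<close>
      define d where "d = 1 / (524288 * t)"
      have d: "0 < d" "d \<le> 1 / (8 * t)" using t1 by (auto simp: d_def field_simps)
      have Md: "M * d \<le> 1/8" using up t1 by (simp add: d_def field_simps)
      have big: "1/2 \<le> cmod (weyl z x)" if x: "l \<le> x" "x \<le> l + d" for x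
      proof -
        have "M * (x - l) \<le> M * d" using x M0 by (intro mult_left_mono) auto
        moreover have "M * (x - l) = cmod (m z * of_real (x - l))" using x by (simp add: M_def norm_mult del: of_real_diff)
        moreover have "1 \<le> cmod (weyl z x) + cmod (weyl z x - (- 1 + m z * of_real (x - l))) + cmod (m z * of_real (x - l))"
        proof -
          have "1 = m z * of_real (x - l) - weyl z x + (weyl z x - (- 1 + m z * of_real (x - l)))" by simp
          then have "1 = cmod (m z * of_real (x - l) - weyl z x + (weyl z x - (- 1 + m z * of_real (x - l))))"
            by simp
          also have "\<dots> \<le> cmod (m z * of_real (x - l) - weyl z x) + cmod (weyl z x - (- 1 + m z * of_real (x - l)))"
            by (rule norm_triangle_ineq)
          also have "cmod (m z * of_real (x - l) - weyl z x) \<le> cmod (m z * of_real (x - l)) + cmod (weyl z x)"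
            by (rule norm_triangle_ineq4)
          finally show ?thesis by simp
        qed
        moreover have "1/2 \<le> w" if "1 \<le> w + e + u" "e \<le> 1/24 * (1 + p)" "u \<le> p" "p \<le> 1/8" for w e u p :: real
          using that by (simp add: field_simps)
        ultimately show ?thesis using near[OF d x] Md by metis
      qed
      have "(l + d - l) * (1/2)\<^sup>2 \<le> weyl_norm_sq z"
        by (rule interval_le_weyl_norm_sq[OF z0]) (use d big in auto)
      then have "t\<^sup>2 * (d * (1/2)\<^sup>2) \<le> t\<^sup>2 * weyl_norm_sq z" by (intro mult_left_mono) auto
      then show ?thesis unfolding nz using t1 by (simp add: d_def field_simps power2_eq_square)
    qed
    show ?thesis using up low by (simp add: z_def M_def)
  qed
  show ?thesis by (rule that[of 65536 "1/2097152" t0]) (use main A0 in \<open>auto simp: t0_def\<close>)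
qed

end

section \<open>The impedance function\<close>

lemma moebius_Im:
  fixes al be ga de :: real and w :: complex
  assumes "of_real ga * w + of_real de \<noteq> 0"
  shows "Im ((of_real al * w + of_real be) / (of_real ga * w + of_real de))
    = (al * de - be * ga) * Im w / (cmod (of_real ga * w + of_real de))\<^sup>2"
  by (simp add: Im_divide cmod_power2 algebra_simps)

text \<open>
  The boundary terms at \<open>l\<close> of the impedance equation for \<open>y = C * weyl z\<close> collect into a multiple
  of \<open>\<mu> * w0 - w1\<close>, the boundary functional of the channel vector.  It is applied with \<open>h'\<close> the
  conjugate of \<open>h\<close> and \<open>w0\<close>, \<open>w1\<close> the conjugates of \<open>w(l)\<close>, \<open>w'(l)\<close>.
\<close>

lemma impedance_algebra:
  fixes a b h h' \<mu> u u1 w0 w1 C M :: complex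
  assumes "a = \<mu> - h" "b = \<mu> - h'" "a \<noteq> 0" "b \<noteq> 0" "u = - C" "u1 = C * M"
  shows "u * w1 - u1 * w0 - (u1 - h * u) * (1 / a * (\<mu> * w0 - w1)) - (w1 - h' * w0) * (1 / b * (\<mu> * u - u1))
    = - (C * (2 * \<mu> - (h + h')) * M + C * (\<mu> * (h + h') - 2 * h * h')) / (a * b) * (\<mu> * w0 - w1)"
proof -
  have clear: "a * b * (X - P * (1 / a * Q) - R * (1 / b * S)) = a * b * X - b * (P * Q) - a * (R * S)" for X P Q R S
    using assms(3,4) by (simp add: right_diff_distrib)
  have "a * b * (u * w1 - u1 * w0 - (u1 - h * u) * (1 / a * (\<mu> * w0 - w1)) - (w1 - h' * w0) * (1 / b * (\<mu> * u - u1)))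
    = a * b * (u * w1 - u1 * w0) - b * ((u1 - h * u) * (\<mu> * w0 - w1)) - a * ((w1 - h' * w0) * (\<mu> * u - u1))"
    by (rule clear)
  also have "\<dots> = - (C * (2 * \<mu> - (h + h')) * M + C * (\<mu> * (h + h') - 2 * h * h')) * (\<mu> * w0 - w1)"
    unfolding assms(1,2,5,6) by algebra
  finally have "a * b * (u * w1 - u1 * w0 - (u1 - h * u) * (1 / a * (\<mu> * w0 - w1)) - (w1 - h' * w0) * (1 / b * (\<mu> * u - u1)))
    = - (C * (2 * \<mu> - (h + h')) * M + C * (\<mu> * (h + h') - 2 * h * h')) * (\<mu> * w0 - w1)" .
  moreover have "x = y / (a * b) * v" if "a * b * x = y * v" for x y v
    using that assms(3,4) by (metis mult_eq_0_iff nonzero_mult_div_cancel_left times_divide_eq_left)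
  ultimately show ?thesis by blast
qed

context limit_point begin

definition solves_impedance_eq :: "real option \<Rightarrow> complex \<Rightarrow> complex \<Rightarrow> (real \<Rightarrow> complex) \<Rightarrow> bool" where
  "solves_impedance_eq mu h z y \<longleftrightarrow> y \<in> Dstar l q \<and> (\<forall>w\<in>Dstar l q.
     op_Re (state_space_op l q mu h) y w - z * ip l y w = channel_op l mu h 1 w)"

text \<open>
  Testing the equation for \<open>y\<close> with \<open>w\<close> and the one for \<open>w\<close> with \<open>y\<close> gives conjugate
  left-hand sides, because the real part is symmetric.  So the value at \<open>y\<close> is expressed through
  \<open>w\<close> alone, and the impedance at \<open>z\<close> is unique as soon as the equation at \<open>cnj z\<close> has a
  solution.
\<close>

lemma channel_adj_unique:
  assumes y: "solves_impedance_eq mu h z y" and w: "solves_impedance_eq mu h (cnj z) w"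
  shows "channel_adj l mu h y = channel_op l mu h 1 w"
proof -
  have "op_Re (state_space_op l q mu h) w y - cnj z * ip l w y = channel_op l mu h 1 y"
    using y w by (auto simp: solves_impedance_eq_def)
  then have "channel_adj l mu h y = cnj (op_Re (state_space_op l q mu h) w y - cnj z * ip l w y)"
    by (simp add: channel_adj_def)
  also have "\<dots> = op_Re (state_space_op l q mu h) y w - z * ip l y w"
    by (simp add: op_Re_def op_adj_def ip_cnj add.commute)
  also have "\<dots> = channel_op l mu h 1 w"
    using y w by (auto simp: solves_impedance_eq_def)
  finally show ?thesis .
qed

lemma op_Re_weyl_multiple:
  fixes C :: complex
  assumes z: "Im z \<noteq> 0" and w: "w \<in> Dstar l q"
  defines "y \<equiv> \<lambda>x. C * weyl z x"
  shows "y \<in> Dstar l q" "y l = - C" "deriv1 l y l = C * m z"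
    "op_Re (state_space_op l q mu h) y w - z * ip l y w =
      (y l * cnj (deriv1 l w l) - deriv1 l y l * cnj (w l)
       - (deriv1 l y l - h * y l) * (case mu of Some r \<Rightarrow> 1 / (of_real r - h) * (of_real r * delta l w + delta' l w) | None \<Rightarrow> delta l w)
       - cnj ((deriv1 l w l - h * w l) * (case mu of Some r \<Rightarrow> 1 / (of_real r - h) * (of_real r * delta l y + delta' l y) | None \<Rightarrow> delta l y))) / 2"
proof -
  note W = weyl[OF z]
  have ysol: "solves l q z y" and d: "deriv1 l y l = C * m z"
    using solves_lincomb[OF W(1) W(1), where a=C and b=0] by (auto simp: y_def m_def)
  have "L2 l y"
    using W(2) sq_integrable_cmult unfolding y_def L2_iff_sq_integrable by blast
  with ysol show yD: "y \<in> Dstar l q" by (rule solves_L2_imp_Dstar)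
  show "y l = - C" using W(3) by (simp add: y_def)
  show "deriv1 l y l = C * m z" by (rule d)
  have lag: "cnj (ip l (diff_expr l q w) y) = z * ip l y w + bracket l y w l"
    using lagrange_identity[OF yD w] unfolding ip_solves_left[OF ysol] by (simp add: algebra_simps)
  show "op_Re (state_space_op l q mu h) y w - z * ip l y w =
      (y l * cnj (deriv1 l w l) - deriv1 l y l * cnj (w l)
       - (deriv1 l y l - h * y l) * (case mu of Some r \<Rightarrow> 1 / (of_real r - h) * (of_real r * delta l w + delta' l w) | None \<Rightarrow> delta l w)
       - cnj ((deriv1 l w l - h * w l) * (case mu of Some r \<Rightarrow> 1 / (of_real r - h) * (of_real r * delta l y + delta' l y) | None \<Rightarrow> delta l y))) / 2"
    unfolding op_Re_def op_adj_def state_space_op_def ip_solves_left[OF ysol] complex_cnj_diff lag bracket_def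
    by (simp add: field_simps)
qed

lemma m_Im_nonzero: "Im z \<noteq> 0 \<Longrightarrow> Im (m z) \<noteq> 0"
  using m_Im_neg[of z] m_Im_neg[of "cnj z"] m_cnj[of z] by (cases "0 < Im z") auto

lemma moebius_m_denom:
  assumes "Im z \<noteq> 0" "ga \<noteq> 0 \<or> de \<noteq> 0"
  shows "of_real ga * m z + of_real de \<noteq> 0"
proof
  assume 0: "of_real ga * m z + of_real de = 0"
  have "Im (of_real ga * m z + of_real de) = 0" "Re (of_real ga * m z + of_real de) = 0"
    unfolding 0 by simp_all
  then show False using m_Im_nonzero[OF assms(1)] assms(2) by auto
qed

text \<open>
  The constant \<open>C\<close> is determined by comparing the coefficient in \<open>impedance_algebra\<close>, which is
  \<open>- 2 * C * D / \<bar>\<mu> - h\<bar>\<^sup>2\<close>, with the coefficient \<open>sqrt (Im h) / \<bar>\<mu> - h\<bar>\<close> of the channel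
  vector.
\<close>

lemma impedance_solution_Some:
  fixes \<mu> :: real
  assumes h: "0 < Im h" and z: "Im z \<noteq> 0"
  defines "D \<equiv> of_real (\<mu> - Re h) * m z + of_real (\<mu> * Re h - (cmod h)\<^sup>2)"
  defines "C \<equiv> - of_real (sqrt (Im h) * cmod (of_real \<mu> - h)) / D"
  shows "solves_impedance_eq (Some \<mu>) h z (\<lambda>x. C * weyl z x)"
    "channel_adj l (Some \<mu>) h (\<lambda>x. C * weyl z x) = (of_real (Im h) * m z + of_real (\<mu> * Im h)) / D"
    "D \<noteq> 0"
proof -
  let ?y = "\<lambda>x. C * weyl z x"
  let ?a = "of_real \<mu> - h" and ?b = "of_real \<mu> - cnj h"
  have a0: "?a \<noteq> 0" "?b \<noteq> 0" using h by (auto simp: complex_eq_iff)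
  have ab: "?a * ?b = of_real ((cmod ?a)\<^sup>2)"
    unfolding complex_norm_square by simp
  have "\<mu> - Re h \<noteq> 0 \<or> \<mu> * Re h - (cmod h)\<^sup>2 \<noteq> 0"
    using h cmod_power2[of h] by (auto simp: power2_eq_square)
  then show D0: "D \<noteq> 0" unfolding D_def by (rule moebius_m_denom[OF z])
  have n0: "cmod ?a \<noteq> 0" using a0 by simp
  have CD: "C * (2 * of_real \<mu> - (h + cnj h)) * m z + C * (of_real \<mu> * (h + cnj h) - 2 * h * cnj h) = C * (2 * D)"
  proof -
    have hh: "h + cnj h = of_real (2 * Re h)" "h * cnj h = of_real ((cmod h)\<^sup>2)"
      by (simp_all add: complex_add_cnj complex_norm_square del: of_real_power)
    have "2 * h * cnj h = of_real (2 * (cmod h)\<^sup>2)" using hh(2) by simp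
    then show ?thesis unfolding hh(1) D_def by (simp add: algebra_simps)
  qed
  have "op_Re (state_space_op l q (Some \<mu>) h) ?y w - z * ip l ?y w = channel_op l (Some \<mu>) h 1 w"
    if w: "w \<in> Dstar l q" for w
  proof -
    note * = op_Re_weyl_multiple[OF z w, where C=C]
    have "op_Re (state_space_op l q (Some \<mu>) h) ?y w - z * ip l ?y w =
      ((- C) * cnj (deriv1 l w l) - (C * m z) * cnj (w l)
       - (C * m z - h * (- C)) * (1 / ?a * (of_real \<mu> * cnj (w l) - cnj (deriv1 l w l)))
       - (cnj (deriv1 l w l) - cnj h * cnj (w l)) * (1 / ?b * (of_real \<mu> * (- C) - C * m z))) / 2"
      unfolding *(4) *(2,3) by (simp add: delta_def delta'_def *(2,3))
    also have "\<dots> = - (C * (2 * D)) / (?a * ?b) * (of_real \<mu> * cnj (w l) - cnj (deriv1 l w l)) / 2"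
      using impedance_algebra[OF refl refl a0 refl refl, of C "cnj (deriv1 l w l)" "m z" "cnj (w l)"] CD by simp
    also have "\<dots> = (- (C * D) / (?a * ?b)) * (of_real \<mu> * cnj (w l) - cnj (deriv1 l w l))"
      by simp
    also have "- (C * D) / (?a * ?b) = of_real (sqrt (Im h) / cmod ?a)"
      unfolding ab C_def using D0 n0 by (simp add: power2_eq_square)
    finally show ?thesis
      by (simp add: channel_op_def channel_vec_def delta_def delta'_def)
  qed
  then show "solves_impedance_eq (Some \<mu>) h z ?y"
    unfolding solves_impedance_eq_def using op_Re_weyl_multiple(1)[OF z weyl(4)[OF z], where C=C] by blast
  have "channel_adj l (Some \<mu>) h ?y = of_real (sqrt (Im h) / cmod ?a) * (of_real \<mu> * (- C) - C * m z)"
    using op_Re_weyl_multiple(2,3)[OF z weyl(4)[OF z], where C=C]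
    by (simp add: channel_adj_def channel_op_def channel_vec_def delta_def delta'_def)
  also have "\<dots> = of_real (sqrt (Im h) * sqrt (Im h)) * (of_real \<mu> + m z) / D"
  proof -
    have "s / r * (u * (- (- (s * r) / D)) - (- (s * r) / D) * M) = s * s * (u + M) / D"
      if "r \<noteq> 0" for s r u M :: complex
      using that D0 by (simp add: field_simps)
    from this[of "of_real (cmod ?a)"] n0 show ?thesis
      unfolding C_def of_real_mult of_real_divide by simp
  qed
  also have "sqrt (Im h) * sqrt (Im h) = Im h" using h by simp
  finally show "channel_adj l (Some \<mu>) h ?y = (of_real (Im h) * m z + of_real (\<mu> * Im h)) / D"
    by (simp add: algebra_simps)
qed

lemma impedance_solution_None:
  assumes h: "0 < Im h" and z: "Im z \<noteq> 0"
  defines "D \<equiv> of_real 1 * m z + of_real (Re h)"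
  defines "C \<equiv> - of_real (sqrt (Im h)) / D"
  shows "solves_impedance_eq None h z (\<lambda>x. C * weyl z x)"
    "channel_adj l None h (\<lambda>x. C * weyl z x) = (of_real 0 * m z + of_real (Im h)) / D"
    "D \<noteq> 0"
proof -
  let ?y = "\<lambda>x. C * weyl z x"
  show D0: "D \<noteq> 0" unfolding D_def by (rule moebius_m_denom[OF z]) simp
  have "op_Re (state_space_op l q None h) ?y w - z * ip l ?y w = channel_op l None h 1 w"
    if w: "w \<in> Dstar l q" for w
  proof -
    note * = op_Re_weyl_multiple[OF z w, where C=C]
    have "h + cnj h = of_real (2 * Re h)" by (simp add: complex_add_cnj)
    then have "op_Re (state_space_op l q None h) ?y w - z * ip l ?y w = - (C * D) * cnj (w l)"
      unfolding *(4) *(2,3) by (simp add: delta_def *(2,3) D_def) algebra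
    also have "- (C * D) = of_real (sqrt (Im h))" using D0 by (simp add: C_def)
    finally show ?thesis by (simp add: channel_op_def channel_vec_def delta_def)
  qed
  then show "solves_impedance_eq None h z ?y"
    unfolding solves_impedance_eq_def using op_Re_weyl_multiple(1)[OF z weyl(4)[OF z], where C=C] by blast
  have "channel_adj l None h ?y = of_real (sqrt (Im h)) * (- C)"
    using op_Re_weyl_multiple(2)[OF z weyl(4)[OF z], where C=C]
    by (simp add: channel_adj_def channel_op_def channel_vec_def delta_def)
  also have "\<dots> = of_real (sqrt (Im h) * sqrt (Im h)) / D"
    unfolding C_def of_real_mult by simp
  also have "sqrt (Im h) * sqrt (Im h) = Im h" using h by simp
  finally show "channel_adj l None h ?y = (of_real 0 * m z + of_real (Im h)) / D"
    by simp
qed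

lemma impedance_eqI:
  assumes "solves_impedance_eq mu h z y" "solves_impedance_eq mu h (cnj z) w"
  shows "impedance l q mu h z = channel_adj l mu h y"
  unfolding impedance_def
proof (rule the_equality)
  show "\<exists>y'\<in>Dstar l q. (\<forall>w\<in>Dstar l q.
        op_Re (state_space_op l q mu h) y' w - z * ip l y' w = channel_op l mu h 1 w) \<and>
     channel_adj l mu h y = channel_adj l mu h y'"
    using assms(1) by (auto simp: solves_impedance_eq_def)
next
  fix v assume "\<exists>y'\<in>Dstar l q. (\<forall>w\<in>Dstar l q.
        op_Re (state_space_op l q mu h) y' w - z * ip l y' w = channel_op l mu h 1 w) \<and>
     v = channel_adj l mu h y'"
  then obtain y' where "solves_impedance_eq mu h z y'" "v = channel_adj l mu h y'"
    by (auto simp: solves_impedance_eq_def)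
  then show "v = channel_adj l mu h y"
    using channel_adj_unique[OF _ assms(2)] assms(1) by metis
qed

lemma impedance_Some:
  assumes "0 < Im h" "Im z \<noteq> 0"
  shows "impedance l q (Some \<mu>) h z = (of_real (Im h) * m z + of_real (\<mu> * Im h)) /
     (of_real (\<mu> - Re h) * m z + of_real (\<mu> * Re h - (cmod h)\<^sup>2))"
  using impedance_eqI[OF impedance_solution_Some(1)[OF assms] impedance_solution_Some(1)[OF assms(1), of "cnj z"]]
    impedance_solution_Some(2)[OF assms] assms(2) by simp

lemma impedance_None:
  assumes "0 < Im h" "Im z \<noteq> 0"
  shows "impedance l q None h z = (of_real 0 * m z + of_real (Im h)) / (of_real 1 * m z + of_real (Re h))"
  using impedance_eqI[OF impedance_solution_None(1)[OF assms] impedance_solution_None(1)[OF assms(1), of "cnj z"]]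
    impedance_solution_None(2)[OF assms] assms(2) by simp

text \<open>
  The negative determinant compensates for \<open>Im m < 0\<close>: the impedance function maps the upper half
  plane into itself.
\<close>

lemma impedance_moebius:
  assumes "0 < Im h"
  obtains al be ga de :: real where "al * de - be * ga < 0"
    "\<And>z. Im z \<noteq> 0 \<Longrightarrow> impedance l q mu h z = (of_real al * m z + of_real be) / (of_real ga * m z + of_real de)"
proof (cases mu)
  case None
  show ?thesis
    by (rule that[of 0 "Re h" "Im h" 1]) (use None assms impedance_None in auto)
next
  case (Some \<mu>)
  have "Im h * (\<mu> * Re h - (cmod h)\<^sup>2) - \<mu> * Im h * (\<mu> - Re h) = - Im h * ((\<mu> - Re h)\<^sup>2 + (Im h)\<^sup>2)"
    unfolding cmod_power2 by (simp add: power2_eq_square algebra_simps)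
  also have "\<dots> < 0"
  proof -
    have "0 < (\<mu> - Re h)\<^sup>2 + (Im h)\<^sup>2" using assms by (simp add: add_nonneg_pos)
    then show ?thesis using assms by simp
  qed
  finally show ?thesis
    by (rule that) (use Some assms impedance_Some in auto)
qed

text \<open>
  The last claim transfers the exact order of \<open>m\<close> along the imaginary axis.  As
  \<open>Im V = - det * (- Im m) / \<bar>ga * m + de\<bar>\<^sup>2\<close>, where \<open>det\<close> is the determinant, the imaginary
  part is of order \<open>1 / t\<close> or \<open>t\<close> at \<open>\<i> * t\<^sup>2\<close>, according to whether
  \<open>ga\<close> is different from \<open>0\<close> or not; both satisfy the bounds stated.
\<close>

lemma impedance_properties:
  fixes mu :: "real option"
  assumes h: "0 < Im h"
  defines "V \<equiv> impedance l q mu h"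
  shows "V holomorphic_on {z. 0 < Im z}" "\<And>z. 0 < Im z \<Longrightarrow> 0 \<le> Im (V z)"
    "\<And>z. Im z \<noteq> 0 \<Longrightarrow> V (cnj z) = cnj (V z)"
    "\<exists>K k t0. 0 < k \<and> 0 < t0 \<and> (\<forall>t\<ge>t0. Im (V (\<i> * of_real (t\<^sup>2))) \<le> K * t \<and> k * t \<le> t\<^sup>2 * Im (V (\<i> * of_real (t\<^sup>2))))"
proof -
  obtain al be ga de :: real where det: "al * de - be * ga < 0" and
    V: "\<And>z. Im z \<noteq> 0 \<Longrightarrow> V z = (of_real al * m z + of_real be) / (of_real ga * m z + of_real de)"
    unfolding V_def by (rule impedance_moebius[OF h, of mu]) blast
  have gd: "ga \<noteq> 0 \<or> de \<noteq> 0" using det by auto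
  note den = moebius_m_denom[OF _ gd]
  have "(\<lambda>z. (of_real al * m z + of_real be) / (of_real ga * m z + of_real de)) holomorphic_on {z. 0 < Im z}"
    by (intro holomorphic_intros m_holomorphic) (use den in auto)
  then show "V holomorphic_on {z. 0 < Im z}"
    by (rule holomorphic_transform) (simp add: V)
  have ImV: "Im (V z) = (al * de - be * ga) * Im (m z) / (cmod (of_real ga * m z + of_real de))\<^sup>2" if "Im z \<noteq> 0" for z
    unfolding V[OF that] by (rule moebius_Im[OF den[OF that]])
  define dt where "dt = - (al * de - be * ga)"
  have dt: "0 < dt" using det by (simp add: dt_def)
  have ImV': "Im (V z) = dt * (- Im (m z)) / (cmod (of_real ga * m z + of_real de))\<^sup>2" if "Im z \<noteq> 0" for z
    using ImV[OF that] by (simp add: dt_def algebra_simps)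
  show "0 \<le> Im (V z)" if "0 < Im z" for z
  proof -
    have "Im z \<noteq> 0" using that by simp
    then show ?thesis
      unfolding ImV'[OF \<open>Im z \<noteq> 0\<close>] using m_Im_neg[OF that] dt
      by (intro divide_nonneg_nonneg mult_nonneg_nonneg) auto
  qed
  show "V (cnj z) = cnj (V z)" if "Im z \<noteq> 0" for z
    using that by (simp add: V m_cnj)
  obtain C c t0 where C: "0 < C" "0 < c" "0 < t0"
    "\<And>t. t0 \<le> t \<Longrightarrow> cmod (m (\<i> * of_real (t\<^sup>2))) \<le> C * t \<and> c * t \<le> - Im (m (\<i> * of_real (t\<^sup>2)))"
    by (rule m_asymptotics) blast
  define K where "K = (if ga = 0 then dt * C / de\<^sup>2 else dt * C / (ga * c)\<^sup>2)"
  define k where "k = dt * c / (\<bar>ga\<bar> * C + \<bar>de\<bar>)\<^sup>2"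
  have B0: "0 < \<bar>ga\<bar> * C + \<bar>de\<bar>" using gd C by (auto simp: add_pos_nonneg add_nonneg_pos)
  have k0: "0 < k" using dt C B0 by (simp add: k_def)
  have "Im (V (\<i> * of_real (t\<^sup>2))) \<le> K * t \<and> k * t \<le> t\<^sup>2 * Im (V (\<i> * of_real (t\<^sup>2)))" if t: "max 1 t0 \<le> t" for t
  proof -
    define M where "M = m (\<i> * of_real (t\<^sup>2))"
    define Q where "Q = cmod (of_real ga * M + of_real de)"
    have t1: "1 \<le> t" "t0 \<le> t" using t by auto
    have M: "cmod M \<le> C * t" "c * t \<le> - Im M" using C(4)[OF t1(2)] by (auto simp: M_def)
    have iz: "Im (\<i> * complex_of_real (t\<^sup>2)) \<noteq> 0" using t1 by simp
    have Q0: "0 < Q" using den[OF iz] by (simp add: Q_def M_def)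
    have I: "Im (V (\<i> * of_real (t\<^sup>2))) = dt * (- Im M) / Q\<^sup>2"
      unfolding ImV'[OF iz] M_def Q_def ..
    have ct: "0 < c * t" using C t1 by simp
    have Mle: "- Im M \<le> C * t" using M(1) abs_Im_le_cmod[of M] by linarith
    have up: "dt * (- Im M) / Q\<^sup>2 \<le> K * t"
    proof (cases "ga = 0")
      case True
      then have "Q = \<bar>de\<bar>" by (simp add: Q_def)
      then have "dt * (- Im M) / Q\<^sup>2 = dt * (- Im M) / de\<^sup>2" by simp
      also have "\<dots> \<le> dt * (C * t) / de\<^sup>2" using Mle dt by (intro divide_right_mono mult_left_mono) auto
      finally show ?thesis using True by (simp add: K_def)
    next
      case False
      have "\<bar>ga\<bar> * (c * t) \<le> \<bar>ga\<bar> * (- Im M)" using M by (intro mult_left_mono) auto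
      also have "\<dots> = \<bar>Im (of_real ga * M + of_real de)\<bar>" using M ct by (simp add: abs_mult)
      also have "\<dots> \<le> Q" unfolding Q_def by (rule abs_Im_le_cmod)
      finally have Q: "\<bar>ga\<bar> * (c * t) \<le> Q" .
      have "(\<bar>ga\<bar> * (c * t))\<^sup>2 \<le> Q\<^sup>2" by (rule power_mono[OF Q]) (use ct in auto)
      then have Q2: "(ga * c)\<^sup>2 * t\<^sup>2 \<le> Q\<^sup>2" by (simp add: power_mult_distrib)
      have "dt * (- Im M) / Q\<^sup>2 \<le> dt * (C * t) / ((ga * c)\<^sup>2 * t\<^sup>2)"
        using Mle dt Q2 t1 False C ct M by (intro frac_le mult_left_mono) auto
      also have "\<dots> = K * (1 / t)" using False t1 by (simp add: K_def power2_eq_square)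
      also have "\<dots> \<le> K * t"
      proof (rule mult_left_mono)
        have "1 / t \<le> 1" using t1 by simp
        then show "1 / t \<le> t" using t1 by linarith
        show "0 \<le> K" using dt C by (simp add: K_def)
      qed
      finally show ?thesis .
    qed
    have "Q \<le> \<bar>ga\<bar> * cmod M + \<bar>de\<bar>"
      unfolding Q_def by (rule order_trans[OF norm_triangle_ineq]) (simp add: norm_mult)
    also have "\<dots> \<le> \<bar>ga\<bar> * (C * t) + \<bar>de\<bar> * t"
      using M t1 mult_left_mono[of 1 t "\<bar>de\<bar>"] by (intro add_mono mult_left_mono) auto
    also have "\<dots> = (\<bar>ga\<bar> * C + \<bar>de\<bar>) * t" by (simp add: algebra_simps)
    finally have "Q\<^sup>2 \<le> ((\<bar>ga\<bar> * C + \<bar>de\<bar>) * t)\<^sup>2" using Q0 by (intro power_mono) auto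
    then have "dt * (c * t) / ((\<bar>ga\<bar> * C + \<bar>de\<bar>) * t)\<^sup>2 \<le> dt * (- Im M) / Q\<^sup>2"
      using M dt Q0 ct by (intro frac_le mult_left_mono mult_nonneg_nonneg) auto
    then have "t\<^sup>2 * (dt * (c * t) / ((\<bar>ga\<bar> * C + \<bar>de\<bar>) * t)\<^sup>2) \<le> t\<^sup>2 * (dt * (- Im M) / Q\<^sup>2)"
      by (rule mult_left_mono) simp
    moreover have "t\<^sup>2 * (dt * (c * t) / ((\<bar>ga\<bar> * C + \<bar>de\<bar>) * t)\<^sup>2) = k * t"
      using t1 by (simp add: k_def power_mult_distrib)
    ultimately show ?thesis using up I by simp
  qed
  then show "\<exists>K k t0. 0 < k \<and> 0 < t0 \<and> (\<forall>t\<ge>t0. Im (V (\<i> * of_real (t\<^sup>2))) \<le> K * t \<and> k * t \<le> t\<^sup>2 * Im (V (\<i> * of_real (t\<^sup>2))))"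
    using k0 C(3) by (intro exI[of _ K] exI[of _ k] exI[of _ "max 1 t0"]) auto
qed

end

section \<open>The Herglotz representation\<close>

definition circ :: "real \<Rightarrow> complex" where "circ t = exp (2 * of_real pi * \<i> * of_real t)"

lemma cmod_circ [simp]: "cmod (circ t) = 1"
  by (simp add: circ_def)

lemma circ_nz [simp]: "circ t \<noteq> 0"
  by (simp add: circ_def)

lemma circ_cnj: "cnj (circ t) = 1 / circ t"
  using complex_norm_square[of "circ t"] by (simp add: field_simps)

lemma continuous_circ: "continuous_on A circ"
  unfolding circ_def[abs_def] by (intro continuous_intros)

lemma measurable_circ [measurable]: "circ \<in> borel_measurable borel"
  by (intro borel_measurable_continuous_onI continuous_circ)

lemma circ_neq: "cmod w < 1 \<Longrightarrow> circ t - w \<noteq> 0"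
  using cmod_circ[of t] by auto

lemma Cauchy_circ:
  assumes G: "continuous_on (cball 0 1) G" "G holomorphic_on ball 0 1" and w: "cmod w < 1"
  shows "((\<lambda>t. G (circ t) * circ t / (circ t - w)) has_integral G w) {0..1}"
proof -
  have "((\<lambda>u. G u / (u - w)) has_contour_integral (2 * of_real pi * \<i> * G w)) (circlepath 0 1)"
    by (rule Cauchy_integral_circlepath) (use assms in auto)
  then have "((\<lambda>t. G (circlepath 0 1 t) / (circlepath 0 1 t - w) * vector_derivative (circlepath 0 1) (at t within {0..1}))
     has_integral (2 * of_real pi * \<i> * G w)) {0..1}"
    by (simp add: has_contour_integral_def)
  then have "((\<lambda>t. 2 * of_real pi * \<i> * (G (circ t) * circ t / (circ t - w))) has_integral (2 * of_real pi * \<i> * G w)) {0..1}"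
  proof (rule has_integral_eq[rotated])
    fix t :: real assume t: "t \<in> {0..1}"
    have vd: "vector_derivative (circlepath 0 1) (at t within {0..1}) = 2 * of_real pi * \<i> * circ t"
      using vector_derivative_circlepath01[of t 0 1] t by (simp add: circ_def)
    have "circlepath 0 1 t = circ t" by (simp add: circlepath circ_def)
    then show "G (circlepath 0 1 t) / (circlepath 0 1 t - w) * vector_derivative (circlepath 0 1) (at t within {0..1})
      = 2 * of_real pi * \<i> * (G (circ t) * circ t / (circ t - w))"
      unfolding vd by simp
  qed
  from has_integral_mult_right[OF this, of "1 / (2 * of_real pi * \<i>)"] show ?thesis
    by simp
qed

text \<open>
  Cauchy's formula for \<open>G\<close> recovers \<open>G w\<close> from \<open>G\<close> on the circle.  Cauchy's formula at \<open>0\<close>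
  for \<open>G u / (1 - cnj w * u)\<close> gives, after conjugation, the integral of \<open>cnj G\<close> against the same
  kernel \<open>circ t / (circ t - w)\<close>.  The sum involves only the real part of \<open>G\<close>, and subtracting its
  mean value turns \<open>2 * circ t / (circ t - w)\<close> into the Schwarz kernel.
\<close>

lemma Schwarz_formula:
  assumes G: "continuous_on (cball 0 1) G" "G holomorphic_on ball 0 1" and w: "cmod w < 1"
    and G0: "Im (G 0) = 0"
  shows "((\<lambda>t. Re (G (circ t)) *\<^sub>R ((circ t + w) / (circ t - w))) has_integral G w) {0..1}"
proof -
  define H where "H u = G u / (1 - cnj w * u)" for u
  have nz: "1 - cnj w * u \<noteq> 0" if "cmod u \<le> 1" for u
  proof
    assume "1 - cnj w * u = 0"
    then have "cmod (cnj w * u) = 1" by simp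
    moreover have "cmod w * cmod u \<le> cmod w * 1" using that by (intro mult_left_mono) auto
    ultimately show False using w by (simp add: norm_mult)
  qed
  have "continuous_on (cball 0 1) H" unfolding H_def[abs_def]
    by (intro continuous_intros G) (use nz in auto)
  moreover have "H holomorphic_on ball 0 1" unfolding H_def[abs_def]
    by (intro holomorphic_intros G) (use nz in auto)
  ultimately have "((\<lambda>t. H (circ t) * circ t / (circ t - 0)) has_integral H 0) {0..1}"
    by (intro Cauchy_circ) auto
  then have "((\<lambda>t. G (circ t) / (1 - cnj w * circ t)) has_integral G 0) {0..1}"
    by (simp add: H_def)
  then have "(cnj \<circ> (\<lambda>t. G (circ t) / (1 - cnj w * circ t)) has_integral cnj (G 0)) {0..1}"
    by (simp add: has_integral_cnj)
  moreover have "cnj (G (circ t) / (1 - cnj w * circ t)) = cnj (G (circ t)) * circ t / (circ t - w)" for t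
    using circ_neq[OF w, of t] by (simp add: circ_cnj field_simps)
  ultimately have 2: "((\<lambda>t. cnj (G (circ t)) * circ t / (circ t - w)) has_integral cnj (G 0)) {0..1}"
    by (simp add: o_def)
  have "((\<lambda>t. G (circ t) * circ t / (circ t - 0)) has_integral G 0) {0..1}"
    by (rule Cauchy_circ[OF G]) simp
  from has_integral_linear[OF this bounded_linear_Re]
  have "((\<lambda>t. Re (G (circ t))) has_integral Re (G 0)) {0..1}" by (simp add: o_def)
  from has_integral_linear[OF this bounded_linear_of_real[where 'a=complex]]
  have 3: "((\<lambda>t. complex_of_real (Re (G (circ t)))) has_integral of_real (Re (G 0))) {0..1}" by (simp add: o_def)
  have "((\<lambda>t. G (circ t) * circ t / (circ t - w) + cnj (G (circ t)) * circ t / (circ t - w) - of_real (Re (G (circ t))))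
      has_integral (G w + cnj (G 0) - of_real (Re (G 0)))) {0..1}"
    by (intro has_integral_add has_integral_diff Cauchy_circ[OF G w] 2 3)
  moreover have "G w + cnj (G 0) - of_real (Re (G 0)) = G w"
    using G0 by (simp add: complex_eq_iff)
  moreover have "G (circ t) * circ t / (circ t - w) + cnj (G (circ t)) * circ t / (circ t - w) - of_real (Re (G (circ t)))
     = Re (G (circ t)) *\<^sub>R ((circ t + w) / (circ t - w))" for t
  proof -
    have "G (circ t) * circ t / (circ t - w) + cnj (G (circ t)) * circ t / (circ t - w)
      = (G (circ t) + cnj (G (circ t))) * (circ t / (circ t - w))"
      by (simp add: algebra_simps add_divide_distrib)
    also have "\<dots> = of_real (Re (G (circ t))) * (2 * circ t / (circ t - w))"
      by (simp add: complex_add_cnj)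
    finally show ?thesis
      using circ_neq[OF w, of t] by (simp add: scaleR_conv_of_real field_simps)
  qed
  ultimately show ?thesis by simp
qed

lemma poisson_kernel_bound:
  assumes "cmod w < 1"
  shows "cmod ((circ t + w) / (circ t - w)) \<le> 2 / (1 - cmod w)"
proof -
  have "1 - cmod w \<le> cmod (circ t - w)"
    using norm_triangle_ineq2[of "circ t" w] by simp
  moreover have "cmod (circ t + w) \<le> 2"
    using norm_triangle_ineq[of "circ t" w] assms by simp
  ultimately show ?thesis
    unfolding norm_divide using assms by (intro frac_le) auto
qed

text \<open>
  On the circles of radius \<open>r n < 1\<close> the Schwarz formula represents \<open>F\<close> by the probability measures
  with density \<open>Re F / a\<close>.  They all live on \<open>[0, 1]\<close>, so they are tight; a weak limit along
  Helly's selection represents \<open>F\<close> itself, since the kernel is bounded and continuous.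
\<close>

lemma herglotz_disc:
  assumes F: "F holomorphic_on ball 0 1" "\<And>w. cmod w < 1 \<Longrightarrow> 0 \<le> Re (F w)" and F0: "F 0 = of_real a" and a: "0 < a"
  obtains N where "real_distribution N"
    "\<And>w. cmod w < 1 \<Longrightarrow> F w = of_real a * (\<integral>t. (circ t + w) / (circ t - w) \<partial>N)"
proof -
  define r where "r n = 1 - 1 / (real n + 2)" for n
  have r: "0 \<le> r n" "r n < 1" for n by (auto simp: r_def field_simps)
  have r_lim: "r \<longlonglongrightarrow> 1" unfolding r_def[abs_def] by real_asymp
  define d where "d n t = indicator {0..1} t * (Re (F (of_real (r n) * circ t)) / a)" for n t
  have inball: "cmod (of_real (r n) * u) < 1" if "cmod u \<le> 1" for n u
  proof -
    have "r n * cmod u \<le> r n * 1" using that r by (intro mult_left_mono) auto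
    then show ?thesis using r[of n] by (simp add: norm_mult)
  qed
  have contF: "continuous_on (ball 0 1) F" using F(1) by (rule holomorphic_on_imp_continuous_on)
  have contG: "continuous_on (cball 0 1) (\<lambda>u. F (of_real (r n) * u))" for n
    by (rule continuous_on_compose2[OF contF]) (use inball in \<open>auto intro!: continuous_intros\<close>)
  have holG: "(\<lambda>u. F (of_real (r n) * u)) holomorphic_on ball 0 1" for n
  proof -
    have "(F \<circ> (\<lambda>u. of_real (r n) * u)) holomorphic_on ball 0 1"
      by (rule holomorphic_on_compose_gen[OF _ F(1)]) (use inball in \<open>auto intro!: holomorphic_intros\<close>)
    then show ?thesis by (simp add: o_def)
  qed
  have contd: "continuous_on UNIV (\<lambda>t. F (of_real (r n) * circ t))" for n
    by (rule continuous_on_compose2[OF contF]) (use inball in \<open>auto intro!: continuous_intros continuous_circ\<close>)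
  have d_meas[measurable]: "d n \<in> borel_measurable borel" for n
  proof -
    have "(\<lambda>t. Re (F (of_real (r n) * circ t)) / a) \<in> borel_measurable borel"
      by (intro borel_measurable_continuous_onI continuous_intros contd) (use a in auto)
    then show ?thesis unfolding d_def[abs_def] by measurable
  qed
  have d0: "0 \<le> d n t" for n t
    unfolding d_def using F(2)[OF inball[of "circ t" n]] a by (auto simp: indicator_def)
  have S: "((\<lambda>t. Re (F (of_real (r n) * circ t)) *\<^sub>R ((circ t + w) / (circ t - w))) has_integral F (of_real (r n) * w)) {0..1}"
    if "cmod w < 1" for w n
    using Schwarz_formula[OF contG holG that, of n] F0 by simp
  define M where "M n = density lborel (\<lambda>t. ennreal (d n t))" for n
  have dI: "(d n has_integral 1) UNIV" for n
  proof -
    from has_integral_linear[OF S[of 0 n] bounded_linear_Re]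
    have "((\<lambda>t. Re (F (of_real (r n) * circ t))) has_integral a) {0..1}"
      by (simp add: o_def F0)
    from has_integral_mult_right[OF this, of "1 / a"]
    have "((\<lambda>t. Re (F (of_real (r n) * circ t)) / a) has_integral 1) {0..1}" using a by simp
    then have "((\<lambda>t. if t \<in> {0..1} then Re (F (of_real (r n) * circ t)) / a else 0) has_integral 1) UNIV"
      by (simp only: has_integral_restrict_UNIV)
    moreover have "d n = (\<lambda>t. if t \<in> {0..1} then Re (F (of_real (r n) * circ t)) / a else 0)"
      by (auto simp: d_def indicator_def)
    ultimately show ?thesis by (simp only:)
  qed
  have M_emeasure: "emeasure (M n) A = 1" if "{0..1} \<subseteq> A" "A \<in> sets borel" for n A
  proof -
    have "emeasure (M n) A = (\<integral>\<^sup>+t. ennreal (d n t) * indicator A t \<partial>lborel)"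
      unfolding M_def by (rule emeasure_density) (use that in auto)
    also have "\<dots> = (\<integral>\<^sup>+t. ennreal (d n t) \<partial>lborel)"
      by (rule nn_integral_cong) (use that in \<open>auto simp: d_def indicator_def\<close>)
    also have "\<dots> = ennreal 1" by (rule nn_integral_has_integral_lborel[OF d_meas d0 dI])
    finally show ?thesis by simp
  qed
  have M_dist: "real_distribution (M n)" for n
  proof -
    have "prob_space (M n)" by (rule prob_spaceI) (use M_emeasure[of UNIV n] in \<open>simp add: M_def\<close>)
    then show ?thesis unfolding real_distribution_def real_distribution_axioms_def by (simp add: M_def)
  qed
  have "tight M"
    unfolding tight_def
  proof (intro conjI allI impI M_dist)
    fix e :: real assume "e > 0"
    have "measure (M n) {-1<..2} = 1" for n
    proof -
      have "emeasure (M n) {-1<..2} = 1" by (rule M_emeasure) auto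
      then show ?thesis by (simp add: measure_def)
    qed
    then show "\<exists>a b. a < b \<and> (\<forall>n. 1 - e < measure (M n) {a<..b})"
      using \<open>e > 0\<close> by (intro exI[of _ "-1"] exI[of _ 2]) auto
  qed
  from tight_imp_convergent_subsubsequence[OF this strict_mono_id]
  obtain s N where s: "strict_mono (s :: nat \<Rightarrow> nat)" and N: "real_distribution N" and conv: "weak_conv_m (M \<circ> id \<circ> s) N"
    by blast
  have conv': "weak_conv_m (\<lambda>n. M (s n)) N" using conv by (simp add: o_def)
  have "F w = of_real a * (\<integral>t. (circ t + w) / (circ t - w) \<partial>N)" if w: "cmod w < 1" for w
  proof -
    let ?k = "\<lambda>t. (circ t + w) / (circ t - w)"
    have k_cont: "continuous_on UNIV ?k"
      by (intro continuous_intros continuous_circ) (use circ_neq[OF w] in auto)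
    have k_meas[measurable]: "?k \<in> borel_measurable borel"
      by (rule borel_measurable_continuous_onI[OF k_cont])
    have MI: "(\<integral>t. ?k t \<partial>M n) = F (of_real (r n) * w) / of_real a" for n
    proof -
      have "(\<integral>t. ?k t \<partial>M n) = (\<integral>t. d n t *\<^sub>R ?k t \<partial>lborel)"
        unfolding M_def by (rule integral_density) (use d0 in auto)
      also have "(\<lambda>t. d n t *\<^sub>R ?k t) = (\<lambda>t. indicator {0..1} t *\<^sub>R ((Re (F (of_real (r n) * circ t)) / a) *\<^sub>R ?k t))"
        by (auto simp: d_def)
      also have "integral\<^sup>L lborel \<dots> = (LINT t:{0..1}|lborel. (Re (F (of_real (r n) * circ t)) / a) *\<^sub>R ?k t)"
        by (simp add: set_lebesgue_integral_def)
      also have "\<dots> = integral {0..1} (\<lambda>t. (Re (F (of_real (r n) * circ t)) / a) *\<^sub>R ?k t)"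
      proof (rule set_borel_integral_eq_integral(2))
        show "set_integrable lborel {0..1} (\<lambda>t. (Re (F (of_real (r n) * circ t)) / a) *\<^sub>R ?k t)"
          by (rule borel_integrable_atLeastAtMost')
            (use a in \<open>auto intro!: continuous_intros continuous_on_subset[OF contd] continuous_on_subset[OF k_cont]\<close>)
      qed
      also have "\<dots> = F (of_real (r n) * w) / of_real a"
      proof -
        from has_integral_mult_right[OF S[OF w, of n], of "1 / of_real a"]
        show ?thesis by (intro integral_unique) (simp add: scaleR_conv_of_real mult_ac)
      qed
      finally show ?thesis .
    qed
    have "(\<lambda>n. \<integral>t. ?k t \<partial>M (s n)) \<longlonglongrightarrow> (\<integral>t. ?k t \<partial>N)"
    proof (rule weak_conv_imp_integral_bdd_continuous_conv[OF M_dist N conv'])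
      show "isCont ?k x" for x using k_cont by (simp add: continuous_on_eq_continuous_at)
      show "cmod (?k x) \<le> 2 / (1 - cmod w)" for x by (rule poisson_kernel_bound[OF w])
    qed
    moreover have "(\<lambda>n. F (of_real (r (s n)) * w) / of_real a) \<longlonglongrightarrow> F (of_real 1 * w) / of_real a"
    proof -
      have lim: "(\<lambda>n. of_real (r (s n)) * w) \<longlonglongrightarrow> of_real 1 * w"
        using LIMSEQ_subseq_LIMSEQ[OF r_lim s] by (intro tendsto_intros) (simp add: o_def)
      have "isCont F (of_real 1 * w)"
        using contF w by (simp add: continuous_on_eq_continuous_at)
      from isCont_tendsto_compose[OF this lim] show ?thesis
        by (rule tendsto_divide[OF _ tendsto_const]) (use a in auto)
    qed
    ultimately have "(\<integral>t. ?k t \<partial>N) = F w / of_real a"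
      unfolding MI using LIMSEQ_unique by fastforce
    then show ?thesis using a by simp
  qed
  then show ?thesis using N that by blast
qed

text \<open>
  The Cayley transform \<open>c\<close> carries the disc to the half plane and the circle to the extended real line
  by \<open>s\<close>.  The mass at the point \<open>1\<close> of the circle, which goes to infinity, produces the linear
  term \<open>b * z\<close>; the rest is transported by \<open>s\<close>, with the weight \<open>1 + s\<^sup>2\<close> that turns
  the kernel \<open>(1 + s * z) / (s - z)\<close> into \<open>1 / (s - z) - s / (1 + s\<^sup>2)\<close>.
\<close>

theorem herglotz_half_plane:
  assumes f: "f holomorphic_on {z. 0 < Im z}" "\<And>z. 0 < Im z \<Longrightarrow> 0 \<le> Im (f z)"
    and fi: "f \<i> = \<i> * of_real a" and a: "0 < a"
  obtains sigma :: "real measure" and b :: real where "sets sigma = sets borel" "0 \<le> b"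
    "integrable sigma (\<lambda>t. 1 / (1 + t\<^sup>2))" "(\<integral>t. 1 / (1 + t\<^sup>2) \<partial>sigma) = a - b"
    "\<And>z. 0 < Im z \<Longrightarrow> integrable sigma (\<lambda>t. 1 / (of_real t - z) - of_real (t / (1 + t\<^sup>2)))"
    "\<And>z. 0 < Im z \<Longrightarrow> f z = of_real b * z + (\<integral>t. (1 / (of_real t - z) - of_real (t / (1 + t\<^sup>2))) \<partial>sigma)"
proof -
  define c where "c w = \<i> * (1 + w) / (1 - w)" for w :: complex
  define F where "F w = - \<i> * f (c w)" for w
  have c_Im: "0 < Im (c w)" if "cmod w < 1" for w
  proof -
    have w1: "w \<noteq> 1" using that by auto
    have "c w = \<i> * ((1 + w) * cnj (1 - w)) / of_real ((cmod (1 - w))\<^sup>2)"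
    proof -
      have nz: "cnj (1 - w) \<noteq> 0" using w1 by (metis complex_cnj_zero_iff eq_iff_diff_eq_0)
      show ?thesis
        unfolding c_def complex_norm_square
        using nonzero_mult_divide_mult_cancel_right[OF nz, of "\<i> * (1 + w)" "1 - w"]
        by (simp only: mult.assoc)
    qed
    then have "Im (c w) = Re ((1 + w) * cnj (1 - w)) / (cmod (1 - w))\<^sup>2"
      by (simp del: of_real_power)
    also have "Re ((1 + w) * cnj (1 - w)) = 1 - (cmod w)\<^sup>2"
      unfolding cmod_power2 by (simp add: algebra_simps power2_eq_square)
    also have "0 < (1 - (cmod w)\<^sup>2) / (cmod (1 - w))\<^sup>2"
      using that w1 power_strict_mono[of "cmod w" 1 2] by (intro divide_pos_pos) auto
    finally show ?thesis .
  qed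
  have "F holomorphic_on ball 0 1"
  proof -
    have "(f \<circ> c) holomorphic_on ball 0 1"
      by (rule holomorphic_on_compose_gen[OF _ f(1)]) (use c_Im in \<open>auto simp: c_def[abs_def] intro!: holomorphic_intros\<close>)
    then show ?thesis unfolding F_def[abs_def] o_def by (intro holomorphic_intros)
  qed
  moreover have "0 \<le> Re (F w)" if "cmod w < 1" for w
    using f(2)[OF c_Im[OF that]] by (simp add: F_def)
  moreover have "F 0 = of_real a" by (simp add: F_def c_def fi)
  ultimately obtain N where N: "real_distribution N"
    and FN: "\<And>w. cmod w < 1 \<Longrightarrow> F w = of_real a * (\<integral>t. (circ t + w) / (circ t - w) \<partial>N)"
    using herglotz_disc[of F a] a by metis
  interpret N: real_distribution N by (rule N)
  define s where "s t = Re (c (circ t))" for t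
  define E where "E = {t. circ t = 1}"
  have s_meas: "s \<in> borel_measurable borel" unfolding s_def[abs_def] c_def by measurable
  have E_meas: "E \<in> sets borel" unfolding E_def by measurable
  define g where "g t = a * (1 + (s t)\<^sup>2) * indicator (- E) t" for t
  have g_meas: "g \<in> borel_measurable N" unfolding g_def[abs_def] using s_meas E_meas by measurable
  have g0: "0 \<le> g t" for t using a by (simp add: g_def)
  define sigma where "sigma = distr (density N (\<lambda>t. ennreal (g t))) borel s"
  define b where "b = a * measure N E"
  have sig_int: "(\<integral>x. G x \<partial>sigma) = (\<integral>t. g t *\<^sub>R G (s t) \<partial>N)"
    and sig_integrable: "integrable sigma G \<longleftrightarrow> integrable N (\<lambda>t. g t *\<^sub>R G (s t))"
    if "G \<in> borel_measurable borel" for G :: "real \<Rightarrow> 'b::{banach, second_countable_topology}"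
  proof -
    have m: "s \<in> measurable (density N (\<lambda>t. ennreal (g t))) borel" using s_meas by simp
    have m2: "(\<lambda>t. G (s t)) \<in> borel_measurable N" using that s_meas by measurable
    have "(\<integral>x. G x \<partial>sigma) = (\<integral>t. G (s t) \<partial>density N (\<lambda>t. ennreal (g t)))"
      unfolding sigma_def by (rule integral_distr[OF m that])
    also have "\<dots> = (\<integral>t. g t *\<^sub>R G (s t) \<partial>N)"
      by (rule integral_density[OF m2 g_meas]) (use g0 in auto)
    finally show "(\<integral>x. G x \<partial>sigma) = (\<integral>t. g t *\<^sub>R G (s t) \<partial>N)" .
    have "integrable sigma G \<longleftrightarrow> integrable (density N (\<lambda>t. ennreal (g t))) (\<lambda>t. G (s t))"
      unfolding sigma_def by (rule integrable_distr_eq[OF m that])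
    also have "\<dots> \<longleftrightarrow> integrable N (\<lambda>t. g t *\<^sub>R G (s t))"
      by (rule integrable_density[OF m2 g_meas]) (use g0 in auto)
    finally show "integrable sigma G \<longleftrightarrow> integrable N (\<lambda>t. g t *\<^sub>R G (s t))" .
  qed
  have norm_eq: "g t *\<^sub>R (1 / (1 + (s t)\<^sup>2)) = a * indicator (- E) t" for t
  proof -
    have "0 < 1 + (s t)\<^sup>2" by (simp add: add_pos_nonneg)
    then show ?thesis by (simp add: g_def)
  qed
  have mm: "(\<lambda>x::real. 1 / (1 + x\<^sup>2)) \<in> borel_measurable borel" by measurable
  have iE: "integrable N (\<lambda>t. a * indicator (- E) t)"
    using E_meas by (intro integrable_mult_right) (auto intro!: integrable_real_indicator simp: N.emeasure_eq_measure)
  have "(\<integral>t. a * indicator (- E) t \<partial>N) = a * measure N (- E)"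
    using E_meas by simp
  also have "measure N (- E) = 1 - measure N E"
    using N.prob_compl[of E] E_meas by (simp add: N.space_eq_univ Compl_eq_Diff_UNIV)
  finally have aE: "(\<integral>t. a * indicator (- E) t \<partial>N) = a - b"
    by (simp add: b_def algebra_simps)
  have kernel: "integrable sigma (\<lambda>t. 1 / (of_real t - z) - of_real (t / (1 + t\<^sup>2)))"
    "f z = of_real b * z + (\<integral>t. (1 / (of_real t - z) - of_real (t / (1 + t\<^sup>2))) \<partial>sigma)" if z: "0 < Im z" for z
  proof -
    define w where "w = (z - \<i>) / (z + \<i>)"
    have zi: "z + \<i> \<noteq> 0" using z by (auto simp: complex_eq_iff)
    have w1: "cmod w < 1"
    proof -
      have "(cmod (z - \<i>))\<^sup>2 < (cmod (z + \<i>))\<^sup>2" 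
        unfolding cmod_power2 using z by (simp add: power2_eq_square algebra_simps)
      then have "cmod (z - \<i>) < cmod (z + \<i>)" by (rule power_less_imp_less_base) simp
      then show ?thesis using zi by (simp add: w_def norm_divide)
    qed
    have wne: "1 - w \<noteq> 0" using w1 by auto
    have cw: "c w = z"
    proof -
      have "1 + w = 2 * z / (z + \<i>)" "1 - w = 2 * \<i> / (z + \<i>)" using zi by (auto simp: w_def field_simps)
      then show ?thesis unfolding c_def using zi by simp
    qed
    let ?K = "\<lambda>t. 1 / (complex_of_real t - z) - of_real (t / (1 + t\<^sup>2))"
    let ?k = "\<lambda>t. (circ t + w) / (circ t - w)"
    have K_meas: "?K \<in> borel_measurable borel" by measurable
    have pt: "of_real a * \<i> * ?k t = of_real a * z * indicator E t + g t *\<^sub>R ?K (s t)" for t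
    proof (cases "circ t = 1")
      case True
      have "of_real a * \<i> * ((1 + w) / (1 - w)) = of_real a * z"
        unfolding cw[symmetric] c_def by simp
      then show ?thesis using True by (simp add: E_def g_def)
    next
      case False
      have s_real: "c (circ t) = of_real (s t)"
      proof -
        have "cnj (c (circ t)) = c (circ t)"
          using False by (simp add: c_def circ_cnj field_simps)
        then have "Im (c (circ t)) = 0" by (metis Reals_cnj_iff complex_is_Real_iff)
        then show ?thesis by (simp add: s_def complex_eq_iff)
      qed
      have e1: "1 - circ t \<noteq> 0" using False by auto
      have sc: "of_real (s t) * (1 - circ t) = \<i> * (1 + circ t)"
        unfolding s_real[symmetric] c_def using e1 by simp
      have zc: "z * (1 - w) = \<i> * (1 + w)"
        using cw wne unfolding c_def by (simp add: field_simps)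
      have sz: "of_real (s t) - z \<noteq> 0" using z by (auto simp: complex_eq_iff)
      have cwn: "circ t - w \<noteq> 0" by (rule circ_neq[OF w1])
      define S where "S = complex_of_real (s t)"
      \<comment> \<open>The identity holds after multiplication by (1 - circ t) * (1 - w), where the Cayley relations
        for S and z can be inserted.\<close>
      have main: "\<i> * (circ t + w) * (S - z) = (circ t - w) * (1 + S * z)"
      proof -
        have "(\<i> * (circ t + w) * (S - z) - (circ t - w) * (1 + S * z)) * ((1 - circ t) * (1 - w))
          = \<i> * (circ t + w) * (S * (1 - circ t) * (1 - w) - z * (1 - w) * (1 - circ t))
            - (circ t - w) * ((1 - circ t) * (1 - w) + (S * (1 - circ t)) * (z * (1 - w)))"
          by (simp add: algebra_simps)
        also have "\<dots> = 0"
          unfolding sc[folded S_def] zc by (simp add: algebra_simps)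
        finally show ?thesis using e1 wne by simp
      qed
      have "\<i> * ?k t = (1 + S * z) / (S - z)"
        using main cwn sz by (simp add: S_def field_simps)
      moreover have "of_real (1 + (s t)\<^sup>2) * ?K (s t) = (1 + S * z) / (S - z)"
      proof -
        have q0: "1 + S\<^sup>2 \<noteq> 0"
        proof -
          have "0 < 1 + (s t)\<^sup>2" by (simp add: add_pos_nonneg)
          then have "complex_of_real (1 + (s t)\<^sup>2) \<noteq> 0" by (simp only: of_real_eq_0_iff)
          then show ?thesis by (simp add: S_def)
        qed
        have "of_real (1 + (s t)\<^sup>2) * ?K (s t) = (1 + S\<^sup>2) * (1 / (S - z) - S / (1 + S\<^sup>2))"
          by (simp add: S_def)
        also have "\<dots> = (1 + S\<^sup>2) / (S - z) - S" using q0 by (simp add: right_diff_distrib)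
        also have "\<dots> = (1 + S * z) / (S - z)" using sz by (simp add: S_def field_simps power2_eq_square)
        finally show ?thesis .
      qed
      ultimately have "of_real a * \<i> * ?k t = of_real a * (of_real (1 + (s t)\<^sup>2) * ?K (s t))"
        by (simp only: mult.assoc)
      also have "\<dots> = g t *\<^sub>R ?K (s t)"
        using False by (simp add: E_def g_def scaleR_conv_of_real)
      finally show ?thesis using False by (simp add: E_def)
    qed
    have ik: "integrable N ?k"
      by (rule N.integrable_const_bound[where B="2 / (1 - cmod w)"]) (use poisson_kernel_bound[OF w1] in auto)
    have iE': "integrable N (\<lambda>t. of_real a * z * indicator E t)"
      using E_meas by (intro integrable_mult_right) (auto intro!: N.integrable_const_bound[where B=1] simp: indicator_def)
    have gK: "(\<lambda>t. g t *\<^sub>R ?K (s t)) = (\<lambda>t. of_real a * \<i> * ?k t - of_real a * z * indicator E t)"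
      using pt by (auto simp: fun_eq_iff algebra_simps)
    show "integrable sigma ?K"
      unfolding sig_integrable[OF K_meas] gK by (intro Bochner_Integration.integrable_diff integrable_mult_right ik iE')
    have "(\<integral>t. ?K t \<partial>sigma) = (\<integral>t. of_real a * \<i> * ?k t - of_real a * z * indicator E t \<partial>N)"
      unfolding sig_int[OF K_meas] gK ..
    also have "\<dots> = (\<integral>t. of_real a * \<i> * ?k t \<partial>N) - (\<integral>t. of_real a * z * indicator E t \<partial>N)"
      by (intro Bochner_Integration.integral_diff integrable_mult_right ik iE')
    also have "(\<integral>t. of_real a * \<i> * ?k t \<partial>N) = \<i> * F w"
      unfolding FN[OF w1] by (subst integral_mult_right_zero) simp
    also have "(\<integral>t. of_real a * z * indicator E t \<partial>N) = of_real b * z"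
    proof -
      have "(\<integral>t. of_real a * z * indicator E t \<partial>N) = of_real a * z * (\<integral>t. complex_of_real (indicator E t) \<partial>N)"
      proof -
        have "(\<lambda>t. of_real a * z * indicator E t) = (\<lambda>t. of_real a * z * complex_of_real (indicator E t))"
          by (auto simp: indicator_def)
        then show ?thesis by (simp only: integral_mult_right_zero)
      qed
      then show ?thesis using E_meas by (simp add: b_def mult_ac)
    qed
    also have "\<i> * F w = f z" by (simp add: F_def cw)
    finally show "f z = of_real b * z + (\<integral>t. ?K t \<partial>sigma)" by simp
  qed
  show ?thesis
  proof (rule that[of sigma b])
    show "sets sigma = sets borel" by (simp add: sigma_def)
    show "0 \<le> b" using a by (simp add: b_def)
    show "integrable sigma (\<lambda>t. 1 / (1 + t\<^sup>2))"
      unfolding sig_integrable[OF mm] norm_eq by (rule iE)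
    show "(\<integral>t. 1 / (1 + t\<^sup>2) \<partial>sigma) = a - b"
      unfolding sig_int[OF mm] norm_eq by (rule aE)
  qed (use kernel in auto)
qed

section \<open>The generalized Donoghue class\<close>

text \<open>
  At \<open>\<i> * y\<close> the imaginary part is \<open>b * y\<close> plus the integral of \<open>y / (x\<^sup>2 + y\<^sup>2)\<close>.  So
  \<open>Im V = O(t)\<close> at \<open>y = t\<^sup>2\<close> is incompatible with \<open>b > 0\<close>, and a finite measure would keep
  \<open>y * Im V\<close> bounded.  On the lower half plane the representation follows by conjugation.
\<close>

lemma Herglotz_in_gen_Donoghue_class:
  fixes V :: "complex \<Rightarrow> complex" and a :: real
  assumes holo: "V holomorphic_on {z. 0 < Im z}" and nn: "\<And>z. 0 < Im z \<Longrightarrow> 0 \<le> Im (V z)"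
    and cnj: "\<And>z. Im z \<noteq> 0 \<Longrightarrow> V (cnj z) = cnj (V z)"
    and Vi: "V \<i> = \<i> * of_real a" and a: "0 < a"
    and k: "0 < k" and t0: "0 < t0"
    and asymp: "\<And>t. t0 \<le> t \<Longrightarrow> Im (V (\<i> * of_real (t\<^sup>2))) \<le> K * t \<and> k * t \<le> t\<^sup>2 * Im (V (\<i> * of_real (t\<^sup>2)))"
  shows "V \<in> gen_Donoghue_class ((1 - a) / (1 + a))"
proof -
  obtain sigma b where s: "sets sigma = sets (borel :: real measure)" and b: "0 \<le> b"
    and i1: "integrable sigma (\<lambda>t. 1 / (1 + t\<^sup>2))" "(\<integral>t. 1 / (1 + t\<^sup>2) \<partial>sigma) = a - b"
    and iK: "\<And>z. 0 < Im z \<Longrightarrow> integrable sigma (\<lambda>t. 1 / (of_real t - z) - of_real (t / (1 + t\<^sup>2)))"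
    and rep: "\<And>z. 0 < Im z \<Longrightarrow> V z = of_real b * z + (\<integral>t. (1 / (of_real t - z) - of_real (t / (1 + t\<^sup>2))) \<partial>sigma)"
    by (rule herglotz_half_plane[OF holo _ Vi a], erule nn, rule that)
  let ?P = "\<lambda>y t. y / (t\<^sup>2 + y\<^sup>2) :: real"
  have ImV: "integrable sigma (?P y)" "Im (V (\<i> * of_real y)) = b * y + (\<integral>t. ?P y t \<partial>sigma)" if y: "0 < y" for y
  proof -
    let ?K = "\<lambda>t. 1 / (complex_of_real t - \<i> * of_real y) - of_real (t / (1 + t\<^sup>2))"
    have y': "0 < Im (\<i> * complex_of_real y)" using y by simp
    have ImK: "Im (?K t) = ?P y t" for t
      by (simp add: Im_divide)
    have "integrable sigma (\<lambda>t. Im (?K t))"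
      by (rule integrable_bounded_linear[OF bounded_linear_Im iK[OF y']])
    then show "integrable sigma (?P y)" unfolding ImK .
    have "(\<integral>t. Im (?K t) \<partial>sigma) = Im (\<integral>t. ?K t \<partial>sigma)"
      by (rule integral_bounded_linear[OF bounded_linear_Im iK[OF y']])
    then show "Im (V (\<i> * of_real y)) = b * y + (\<integral>t. ?P y t \<partial>sigma)"
      unfolding ImK rep[OF y'] by simp
  qed
  have P0: "0 \<le> (\<integral>t. ?P y t \<partial>sigma)" if "0 < y" for y
    using that by (intro Bochner_Integration.integral_nonneg) auto
  have b0: "b = 0"
  proof (rule ccontr)
    assume "b \<noteq> 0"
    then have "0 < b" using b by simp
    define t where "t = max t0 (\<bar>K\<bar> / b + 1)"
    have t: "t0 \<le> t" "0 < t" "\<bar>K\<bar> / b < t" using t0 by (auto simp: t_def)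
    have "b * t\<^sup>2 \<le> Im (V (\<i> * of_real (t\<^sup>2)))"
      using ImV(2)[of "t\<^sup>2"] P0[of "t\<^sup>2"] t by simp
    also have "\<dots> \<le> K * t" using asymp[OF t(1)] by simp
    finally have "b * t \<le> K" using t by (simp add: power2_eq_square)
    moreover have "\<bar>K\<bar> < b * t" using t(3) \<open>0 < b\<close> by (simp add: field_simps)
    ultimately show False by simp
  qed
  have inf: "emeasure sigma UNIV = \<infinity>"
  proof (rule ccontr)
    assume fin: "emeasure sigma UNIV \<noteq> \<infinity>"
    have sp: "space sigma = UNIV" using sets_eq_imp_space_eq[OF s] by simp
    interpret finite_measure sigma by (rule finite_measureI) (use fin sp in simp)
    define B where "B = measure sigma UNIV"
    define t where "t = max t0 (B / k + 1)"
    have t: "t0 \<le> t" "0 < t" "B / k < t" using t0 by (auto simp: t_def)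
    have "k * t \<le> t\<^sup>2 * (\<integral>x. ?P (t\<^sup>2) x \<partial>sigma)"
      using asymp[OF t(1)] ImV(2)[of "t\<^sup>2"] t b0 by simp
    also have "\<dots> = (\<integral>x. t\<^sup>2 * ?P (t\<^sup>2) x \<partial>sigma)"
      by (rule integral_mult_right_zero[symmetric])
    also have "\<dots> \<le> (\<integral>x. 1 \<partial>sigma)"
    proof (rule integral_mono)
      show "integrable sigma (\<lambda>x. t\<^sup>2 * ?P (t\<^sup>2) x)"
        by (intro integrable_mult_right ImV(1)) (use t in auto)
      show "t\<^sup>2 * ?P (t\<^sup>2) x \<le> 1" for x
      proof -
        have "0 < (t\<^sup>2)\<^sup>2" using t by simp
        then have "0 < x\<^sup>2 + (t\<^sup>2)\<^sup>2" by (intro add_nonneg_pos) auto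
        then show ?thesis by (simp add: power2_eq_square)
      qed
    qed simp
    also have "\<dots> = B" by (simp add: B_def sp)
    finally have "k * t \<le> B" .
    then show False using t(3) k by (simp add: field_simps)
  qed
  have all: "V z = (\<integral>t. (1 / (of_real t - z) - of_real (t / (1 + t\<^sup>2))) \<partial>sigma)" if z: "Im z \<noteq> 0" for z
  proof (cases "0 < Im z")
    case True
    then show ?thesis using rep b0 by simp
  next
    case False
    then have p: "0 < Im (cnj z)" using z by simp
    have "V z = cnj (V (cnj z))" using cnj[of "cnj z"] z by simp
    also have "V (cnj z) = (\<integral>t. 1 / (of_real t - cnj z) - of_real (t / (1 + t\<^sup>2)) \<partial>sigma)"
      using rep[OF p] b0 by simp
    also have "cnj \<dots> = (\<integral>t. cnj (1 / (of_real t - cnj z) - of_real (t / (1 + t\<^sup>2))) \<partial>sigma)"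
      by (rule Bochner_Integration.integral_cnj[symmetric])
    also have "(\<lambda>t. cnj (1 / (of_real t - cnj z) - of_real (t / (1 + t\<^sup>2)))) = (\<lambda>t. 1 / (of_real t - z) - of_real (t / (1 + t\<^sup>2)))"
      by (auto simp del: of_real_divide)
    finally show ?thesis .
  qed
  have "(1 - (1 - a) / (1 + a)) / (1 + (1 - a) / (1 + a)) = a"
    using a by (simp add: field_simps)
  then show ?thesis
    unfolding gen_Donoghue_class_def using s inf i1 b0 all by (auto intro!: exI[of _ sigma])
qed

lemma gen_Donoghue_class_at_i:
  assumes "M \<in> gen_Donoghue_class k"
  shows "M \<i> = \<i> * of_real ((1 - k) / (1 + k))"
proof -
  obtain sigma :: "real measure" where s: "(\<integral>t. 1 / (1 + t\<^sup>2) \<partial>sigma) = (1 - k) / (1 + k)"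
    "\<And>z. Im z \<noteq> 0 \<Longrightarrow> M z = (\<integral>t. (1 / (of_real t - z) - of_real (t / (1 + t\<^sup>2))) \<partial>sigma)"
    using assms unfolding gen_Donoghue_class_def by auto
  have K: "1 / (complex_of_real t - \<i>) - of_real (t / (1 + t\<^sup>2)) = \<i> * complex_of_real (1 / (1 + t\<^sup>2))" for t
  proof -
    have nz: "complex_of_real t - \<i> \<noteq> 0" by (auto simp: complex_eq_iff)
    have "0 < 1 + t\<^sup>2" by (simp add: add_pos_nonneg)
    then have Q: "complex_of_real (1 + t\<^sup>2) \<noteq> 0" by (simp only: of_real_eq_0_iff)
    have "(of_real t + \<i>) * (of_real t - \<i>) = complex_of_real (1 + t\<^sup>2)"
      by (simp add: algebra_simps power2_eq_square)
    then have "1 / (complex_of_real t - \<i>) = (of_real t + \<i>) / of_real (1 + t\<^sup>2)"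
      unfolding frac_eq_eq[OF nz Q] by simp
    then show ?thesis by (simp only: of_real_divide diff_divide_distrib[symmetric]) simp
  qed
  have "M \<i> = (\<integral>t. \<i> * complex_of_real (1 / (1 + t\<^sup>2)) \<partial>sigma)"
    using s(2)[of \<i>] unfolding K by simp
  also have "\<dots> = \<i> * of_real (\<integral>t. 1 / (1 + t\<^sup>2) \<partial>sigma)"
    by (simp only: integral_mult_right_zero integral_complex_of_real)
  finally show ?thesis by (simp only: s(1))
qed

text \<open>
  Written with the common factor \<open>s\<close>, the formula for \<open>h\<close> is what elimination yields in
  \<open>impedance_system_iff\<close>.
\<close>

lemma h_formula_eq:
  fixes a c d \<mu> :: real
  assumes "a \<noteq> 0" "d \<noteq> 0"
  defines "s \<equiv> (d\<^sup>2 + (c + \<mu>)\<^sup>2) / (a\<^sup>2 * d\<^sup>2 + (c + \<mu>)\<^sup>2)"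
  shows "h_formula a c d \<mu> = of_real (\<mu> - (c + \<mu>) * s) - \<i> * of_real (a * d * s)"
proof -
  have Q: "a\<^sup>2 * d\<^sup>2 + (c + \<mu>)\<^sup>2 \<noteq> 0"
  proof -
    have "0 < a\<^sup>2 * d\<^sup>2" using assms by simp
    then have "0 < a\<^sup>2 * d\<^sup>2 + (c + \<mu>)\<^sup>2" by (rule add_pos_nonneg) simp
    then show ?thesis by simp
  qed
  have "(a\<^sup>2 * d\<^sup>2 * \<mu> - d\<^sup>2 * (c + \<mu>) - c * (c + \<mu>)\<^sup>2) = \<mu> * (a\<^sup>2 * d\<^sup>2 + (c + \<mu>)\<^sup>2) - (c + \<mu>) * (d\<^sup>2 + (c + \<mu>)\<^sup>2)"
    by (simp add: power2_eq_square algebra_simps)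
  then have 1: "(a\<^sup>2 * d\<^sup>2 * \<mu> - d\<^sup>2 * (c + \<mu>) - c * (c + \<mu>)\<^sup>2) / (a\<^sup>2 * d\<^sup>2 + (c + \<mu>)\<^sup>2) = \<mu> - (c + \<mu>) * s"
    using Q by (simp add: s_def diff_divide_distrib)
  have "a * d ^ 3 + a * d * (c + \<mu>)\<^sup>2 = a * d * (d\<^sup>2 + (c + \<mu>)\<^sup>2)"
    by (simp add: power2_eq_square power3_eq_cube algebra_simps)
  then have 2: "(a * d ^ 3 + a * d * (c + \<mu>)\<^sup>2) / (a\<^sup>2 * d\<^sup>2 + (c + \<mu>)\<^sup>2) = a * d * s"
    by (simp add: s_def)
  show ?thesis unfolding h_formula_def 1 2 ..
qed

text \<open>
  The left-hand side is \<open>V(\<i>) = \<i> * a\<close> separated into real and imaginary part, for \<open>h = x + \<i> * y\<close>.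
  The first equation expresses \<open>\<mu> - x\<close> through \<open>y\<close>; in the second one all terms are then
  divisible by \<open>y\<close>, and a linear equation remains.
\<close>

lemma impedance_system_iff:
  fixes a c d \<mu> x y :: real
  assumes a: "0 < a" and d: "d \<noteq> 0" and y: "y \<noteq> 0"
  defines "s \<equiv> (d\<^sup>2 + (c + \<mu>)\<^sup>2) / (a\<^sup>2 * d\<^sup>2 + (c + \<mu>)\<^sup>2)"
  shows "y * (c + \<mu>) = - a * d * (\<mu> - x) \<and> y * d = a * ((\<mu> - x) * (c + x) - y\<^sup>2)
    \<longleftrightarrow> x = \<mu> - (c + \<mu>) * s \<and> y = - a * d * s" (is "?L \<longleftrightarrow> ?R")
proof -
  define p where "p = c + \<mu>"
  define Q where "Q = a\<^sup>2 * d\<^sup>2 + p\<^sup>2"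
  have Q: "0 < Q" unfolding Q_def using a d by (intro add_pos_nonneg) auto
  have sQ: "s * Q = d\<^sup>2 + p\<^sup>2" using Q by (simp add: s_def Q_def p_def)
  show ?thesis
  proof
    assume L: ?L
    have L1: "a * d * (\<mu> - x) = - y * p" using L by (simp add: p_def)
    have cx: "c + x = p - (\<mu> - x)" by (simp add: p_def)
    have "y * (a * d ^ 3) = a\<^sup>2 * d\<^sup>2 * ((\<mu> - x) * (c + x)) - a\<^sup>2 * d\<^sup>2 * y\<^sup>2"
    proof -
      have "y * (a * d ^ 3) = (y * d) * (a * d\<^sup>2)" by (simp add: power2_eq_square power3_eq_cube)
      also have "\<dots> = a * ((\<mu> - x) * (c + x) - y\<^sup>2) * (a * d\<^sup>2)" using L by simp
      finally show ?thesis by (simp add: power2_eq_square algebra_simps)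
    qed
    also have "a\<^sup>2 * d\<^sup>2 * ((\<mu> - x) * (c + x)) = (a * d * (\<mu> - x)) * (a * d * p - a * d * (\<mu> - x))"
      unfolding cx by (simp add: power2_eq_square algebra_simps)
    also have "\<dots> = (- y * p) * (a * d * p + y * p)" unfolding L1 by simp
    finally have "y * (a * d ^ 3) = y * (- p * (a * d * p + y * p) - a\<^sup>2 * d\<^sup>2 * y)"
      by (simp add: power2_eq_square algebra_simps)
    then have "a * d ^ 3 = - p * (a * d * p + y * p) - a\<^sup>2 * d\<^sup>2 * y" using y by simp
    then have "y * Q = - a * d * (d\<^sup>2 + p\<^sup>2)"
      by (simp add: Q_def power2_eq_square power3_eq_cube algebra_simps)
    also have "\<dots> = (- a * d * s) * Q" by (simp add: sQ[symmetric])
    finally have ys: "y = - a * d * s" using Q by (simp only: mult_cancel_right) auto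
    have "a * d * (\<mu> - x) = a * d * (p * s)" unfolding L1 ys by (simp add: mult_ac)
    then have "\<mu> - x = p * s" using a d by simp
    then show ?R using ys by (simp add: p_def)
  next
    assume R: ?R
    have mx: "\<mu> - x = p * s" and ys: "y = - a * d * s" using R by (auto simp: p_def)
    have cx: "c + x = p - p * s" using mx by (simp add: p_def)
    have "(\<mu> - x) * (c + x) - y\<^sup>2 = s * (p\<^sup>2 - s * Q)"
      unfolding mx cx ys Q_def by (simp add: power2_eq_square algebra_simps)
    also have "\<dots> = - s * d\<^sup>2" unfolding sQ by simp
    finally have "y * d = a * ((\<mu> - x) * (c + x) - y\<^sup>2)" unfolding ys by (simp add: power2_eq_square)
    moreover have "y * (c + \<mu>) = - a * d * (\<mu> - x)" unfolding mx ys p_def by simp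
    ultimately show ?L by blast
  qed
qed

text \<open>
  Subtracting the limits leaves multiples of \<open>(c + m) / (k + (c + m)\<^sup>2)\<close> and of
  \<open>1 / (k + (c + m)\<^sup>2)\<close>.
\<close>

lemma h_formula_limit:
  assumes "a \<noteq> 0" "d \<noteq> 0"
  shows "(h_formula a c d \<longlongrightarrow> - of_real c - \<i> * of_real (a * d)) at_infinity"
proof -
  define k where "k = a\<^sup>2 * d\<^sup>2"
  have k: "0 < k" using assms by (simp add: k_def)
  have Q: "k + (c + m)\<^sup>2 \<noteq> 0" for m using k by (metis add_pos_nonneg less_irrefl zero_le_power2)
  have 1: "((\<lambda>m. - c + d\<^sup>2 * (a\<^sup>2 - 1) * ((c + m) / (k + (c + m)\<^sup>2))) \<longlongrightarrow> - c + d\<^sup>2 * (a\<^sup>2 - 1) * 0) at_infinity"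
    unfolding at_infinity_eq_at_top_bot
    by (intro tendsto_intros filterlim_sup) real_asymp+
  have 2: "((\<lambda>m. a * d + a * d * (d\<^sup>2 - k) * (1 / (k + (c + m)\<^sup>2))) \<longlongrightarrow> a * d + a * d * (d\<^sup>2 - k) * 0) at_infinity"
    unfolding at_infinity_eq_at_top_bot
    by (intro tendsto_intros filterlim_sup) real_asymp+
  have split: "(u * w + v * p) / w = u + v * (p / w)" if "w \<noteq> 0" for u v p w :: real
    using that by (simp add: add_divide_distrib)
  have "h_formula a c d = (\<lambda>m. of_real (- c + d\<^sup>2 * (a\<^sup>2 - 1) * ((c + m) / (k + (c + m)\<^sup>2)))
      - \<i> * of_real (a * d + a * d * (d\<^sup>2 - k) * (1 / (k + (c + m)\<^sup>2))))"
  proof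
    fix m
    have "(a\<^sup>2 * d\<^sup>2 * m - d\<^sup>2 * (c + m) - c * (c + m)\<^sup>2) = - c * (k + (c + m)\<^sup>2) + d\<^sup>2 * (a\<^sup>2 - 1) * (c + m)"
      by (simp add: k_def power2_eq_square algebra_simps)
    then have e1: "(a\<^sup>2 * d\<^sup>2 * m - d\<^sup>2 * (c + m) - c * (c + m)\<^sup>2) / (a\<^sup>2 * d\<^sup>2 + (c + m)\<^sup>2)
       = - c + d\<^sup>2 * (a\<^sup>2 - 1) * ((c + m) / (k + (c + m)\<^sup>2))"
      unfolding k_def[symmetric] by (simp only: split[OF Q])
    have "a * d ^ 3 + a * d * (c + m)\<^sup>2 = a * d * (k + (c + m)\<^sup>2) + a * d * (d\<^sup>2 - k) * 1"
      by (simp add: power2_eq_square power3_eq_cube algebra_simps)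
    then have e2: "(a * d ^ 3 + a * d * (c + m)\<^sup>2) / (a\<^sup>2 * d\<^sup>2 + (c + m)\<^sup>2) = a * d + a * d * (d\<^sup>2 - k) * (1 / (k + (c + m)\<^sup>2))"
      unfolding k_def[symmetric] by (simp only: split[OF Q])
    show "h_formula a c d m = of_real (- c + d\<^sup>2 * (a\<^sup>2 - 1) * ((c + m) / (k + (c + m)\<^sup>2)))
      - \<i> * of_real (a * d + a * d * (d\<^sup>2 - k) * (1 / (k + (c + m)\<^sup>2)))"
      unfolding h_formula_def e1 e2 ..
  qed
  moreover have "((\<lambda>m. of_real (- c + d\<^sup>2 * (a\<^sup>2 - 1) * ((c + m) / (k + (c + m)\<^sup>2)))
      - \<i> * of_real (a * d + a * d * (d\<^sup>2 - k) * (1 / (k + (c + m)\<^sup>2))))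
    \<longlongrightarrow> of_real (- c + d\<^sup>2 * (a\<^sup>2 - 1) * 0) - \<i> * of_real (a * d + a * d * (d\<^sup>2 - k) * 0)) at_infinity"
    by (rule tendsto_diff[OF tendsto_of_real[OF 1] tendsto_mult[OF tendsto_const tendsto_of_real[OF 2]]])
  ultimately show ?thesis by simp
qed

context limit_point begin

lemma impedance_at_i_iff:
  assumes h: "0 < Im h" and a: "0 < a" and c: "c = Re (m \<i>)" and d: "d = Im (m \<i>)"
  shows "impedance l q mu h \<i> = \<i> * of_real a \<longleftrightarrow> h = h_formula_ext a c d mu"
proof -
  have d0: "d < 0" using m_Im_neg[of \<i>] d by simp
  have mi: "m \<i> = Complex c d" using c d by (simp add: complex_eq_iff)
  define x where "x = Re h"
  define y where "y = Im h"
  have h_eq: "h = Complex x y" by (simp add: x_def y_def)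
  have y0: "0 < y" using h by (simp add: y_def)
  show ?thesis
  proof (cases mu)
    case None
    let ?D = "of_real 1 * m \<i> + of_real (Re h)"
    have D: "?D \<noteq> 0" by (rule impedance_solution_None(3)[OF h]) simp
    have "impedance l q mu h \<i> = \<i> * of_real a \<longleftrightarrow> of_real 0 * m \<i> + of_real (Im h) = \<i> * of_real a * ?D"
      using impedance_None[OF h, of \<i>] D unfolding None by (simp add: divide_eq_eq)
    also have "\<dots> \<longleftrightarrow> x = - c \<and> y = - (a * d)"
      using a unfolding mi h_eq by (auto simp: complex_eq_iff)
    also have "\<dots> \<longleftrightarrow> h = - of_real c - \<i> * of_real (a * d)"
      unfolding h_eq by (simp add: complex_eq_iff)
    also have "- of_real c - \<i> * of_real (a * d) = h_formula_ext a c d mu"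
    proof -
      have "Lim at_infinity (h_formula a c d) = - of_real c - \<i> * of_real (a * d)"
        by (rule tendsto_Lim[OF trivial_limit_at_infinity h_formula_limit]) (use a d0 in auto)
      then show ?thesis by (simp add: h_formula_ext_def None)
    qed
    finally show ?thesis .
  next
    case (Some \<mu>)
    let ?D = "of_real (\<mu> - Re h) * m \<i> + of_real (\<mu> * Re h - (cmod h)\<^sup>2)"
    have D: "?D \<noteq> 0" by (rule impedance_solution_Some(3)[OF h]) simp
    have h2: "(cmod h)\<^sup>2 = x\<^sup>2 + y\<^sup>2" unfolding cmod_power2 x_def y_def ..
    have "impedance l q mu h \<i> = \<i> * of_real a \<longleftrightarrow>
        of_real (Im h) * m \<i> + of_real (\<mu> * Im h) = \<i> * of_real a * ?D"
    proof -
      have V: "impedance l q (Some \<mu>) h \<i> = (of_real (Im h) * m \<i> + of_real (\<mu> * Im h)) / ?D"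
        by (rule impedance_Some[OF h]) simp
      show ?thesis unfolding Some V nonzero_divide_eq_eq[OF D] ..
    qed
    also have "\<dots> \<longleftrightarrow> y * (c + \<mu>) = - a * d * (\<mu> - x) \<and> y * d = a * ((\<mu> - x) * (c + x) - y\<^sup>2)"
      unfolding h2 mi x_def[symmetric] y_def[symmetric]
      by (auto simp: complex_eq_iff power2_eq_square algebra_simps)
    also have "\<dots> \<longleftrightarrow> h = h_formula a c d \<mu>"
    proof -
      have ne: "a \<noteq> 0" "d \<noteq> 0" "y \<noteq> 0" using a d0 y0 by auto
      show ?thesis
        unfolding impedance_system_iff[OF a ne(2,3)] h_formula_eq[OF ne(1,2)]
        by (simp add: complex_eq_iff x_def y_def)
    qed
    also have "h_formula a c d \<mu> = h_formula_ext a c d mu" by (simp add: h_formula_ext_def Some)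
    finally show ?thesis .
  qed
qed

end

theorem theorem9:
  fixes l :: real and q :: "real \<Rightarrow> real" and mu :: "real option" and h :: complex
    and a kappa c d :: real
  assumes "loc_integrable l q"
    and "deficiency_indices_1_1 l q"
    and "0 < a" and "a < 1" and "kappa = (1 - a) / (1 + a)"
    and "Im h > 0"
    and "\<exists>k. von_Neumann_parameter l q h k \<and> cmod k = kappa"
    and "c = Re (weyl_m l q \<i>)" and "d = Im (weyl_m l q \<i>)"
  shows "impedance l q mu h \<in> gen_Donoghue_class kappa \<longleftrightarrow>
     (mu = Some (- c) \<and> h = - of_real c - (\<i> / of_real a) * of_real d) \<or>
     h = h_formula_ext a c d mu"
proof -
  interpret limit_point l q
    using deficiency_imp_limit_point assms(1,2) by unfold_locales auto
  have cd: "c = Re (m \<i>)" "d = Im (m \<i>)" using assms(8,9) weyl_m_eq[of \<i>] by simp_all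
  have d0: "d < 0" using m_Im_neg[of \<i>] cd by simp
  have kap: "(1 - kappa) / (1 + kappa) = a" unfolding assms(5) using assms(3) by (simp add: field_simps)
  have "impedance l q mu h \<in> gen_Donoghue_class kappa \<longleftrightarrow> impedance l q mu h \<i> = \<i> * of_real a"
  proof
    assume "impedance l q mu h \<in> gen_Donoghue_class kappa"
    from gen_Donoghue_class_at_i[OF this] show "impedance l q mu h \<i> = \<i> * of_real a"
      unfolding kap .
  next
    assume Vi: "impedance l q mu h \<i> = \<i> * of_real a"
    note V = impedance_properties[OF assms(6), where mu=mu]
    obtain K k t0 where k: "0 < k" "0 < t0" and asymp:
      "\<And>t. t0 \<le> t \<Longrightarrow> Im (impedance l q mu h (\<i> * of_real (t\<^sup>2))) \<le> K * t \<and>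
         k * t \<le> t\<^sup>2 * Im (impedance l q mu h (\<i> * of_real (t\<^sup>2)))"
      using V(4) by blast
    show "impedance l q mu h \<in> gen_Donoghue_class kappa"
      unfolding assms(5)
      by (rule Herglotz_in_gen_Donoghue_class[OF V(1) _ _ Vi assms(3) k asymp]) (simp_all add: V(2,3))
  qed
  also have "\<dots> \<longleftrightarrow> h = h_formula_ext a c d mu"
    by (rule impedance_at_i_iff[OF assms(6,3) cd])
  also have "\<dots> \<longleftrightarrow> (mu = Some (- c) \<and> h = - of_real c - (\<i> / of_real a) * of_real d) \<or> h = h_formula_ext a c d mu"
  proof -
    have "h_formula_ext a c d (Some (- c)) = - of_real c - (\<i> / of_real a) * of_real d"
      using assms(3) d0 by (simp add: h_formula_ext_def h_formula_def complex_eq_iff power2_eq_square power3_eq_cube)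
    then show ?thesis by auto
  qed
  finally show ?thesis .
qed

end
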